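(* There is a constant $C'>0$ such that, for all integers $n$ and $\ell$ with $42\le\ell\le n$, the size of every extension of $\mathrm{P}_{\mathrm{cycl}}^{\ell}(n)$ that is symmetric with respect to the group $\mathfrak{S}(n)$ (acting by permuting the nodes of $K_n$) is at least $$C'\cdot\binom{\lfloor\frac{n}{3}\rfloor}{\lfloor(\lfloor\frac{\ell}{6}\rfloor-1)/2\rfloor}.$$
   Context: $K_n=([n],E_n)$ is the complete graph on $[n]=\{1,\dots,n\}$. $\mathcal{C}^{\ell}(n)$ is the set of all (edge sets of) simple cycles $C\subseteq E_n$ of length $|C|=\ell$ in $K_n$; $\chi(C)\in\{0,1\}^{E_n}$ is the characteristic vector of $C$; and $\mathrm{P}_{\mathrm{cycl}}^{\ell}(n)=\operatorname{conv}\{\chi(C): C\in\mathcal{C}^{\ell}(n)\}\subseteq\mathbb{R}^{E_n}$. The symmetric group $\mathfrak{S}(n)$ acts on $E_n$ by $\pi.\{v,w\}=\{\pi(v),\pi(w)\}$ and hence on $\mathbb{R}^{E_n}$ by $(\pi.x)_{\{v,w\}}=x_{\{\pi^{-1}(v),\pi^{-1}(w)\}}$; this action maps $\mathrm{P}_{\mathrm{cycl}}^{\ell}(n)$ to itself. An extension of a polytope $P\subseteq\mathbb{R}^m$ is a polyhedron $Q\subseteq\mathbb{R}^d$ together with an affine map $p:\mathbb{R}^d\to\mathbb{R}^m$ with $p(Q)=P$. The size of the extension is the number of facets of $Q$. Let $\mathcal{O}(d)$ be the group of affine isometries of $\mathbb{R}^d$ (maps $y\mapsto Uy+u$ with $U$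 an orthogonal matrix, $u\in\mathbb{R}^d$). If $G$ is a group of affine transformations $\pi$ of $\mathbb{R}^m$ with $\pi.P=P$, the extension is (isometry-)symmetric with respect to $G$ if for every $\pi\in G$ there is $\varkappa_\pi\in\mathcal{O}(d)$ with $\varkappa_\pi.Q=Q$ and $p(\varkappa_\pi.y)=\pi.p(y)$ for all $y\in Q$. *)

theory Defs
  imports "HOL-Analysis.Analysis" "HOL-Combinatorics.Permutations" "HOL-Library.Function_Algebras"
begin

text \<open>
  Dimensions vary within the statement (under a constant that must not depend on them), so
  $\mathbb{R}^I$ for a finite index set \<open>I\<close> is the subspace of functions \<open>'i \<Rightarrow> real\<close> that vanish outside
  \<open>I\<close>; $\mathbb{R}^d$ is the case \<open>I = {..<d}\<close>. The pointwise vector space structure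
  makes the library's \<open>convex hull\<close>, \<open>face_of\<close> and \<open>dim\<close> available on such functions.
\<close>

instantiation "fun" :: (type, real_vector) real_vector
begin

definition scaleR_fun :: "real \<Rightarrow> ('a \<Rightarrow> 'b) \<Rightarrow> 'a \<Rightarrow> 'b"
  where "scaleR_fun r f = (\<lambda>x. r *\<^sub>R f x)"

instance
  by standard (auto simp: fun_eq_iff scaleR_fun_def scaleR_add_right scaleR_add_left)

end

definition coord_space :: "'i set \<Rightarrow> ('i \<Rightarrow> real) set"
  where "coord_space I = {x. \<forall>i. i \<notin> I \<longrightarrow> x i = 0}"

definition affine_map ::
  "'i set \<Rightarrow> 'j set \<Rightarrow> ('j \<Rightarrow> 'i \<Rightarrow> real) \<Rightarrow> ('j \<Rightarrow> real) \<Rightarrow> ('i \<Rightarrow> real) \<Rightarrow> 'j \<Rightarrow> real"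
  where "affine_map I J A c y = (\<lambda>j. if j \<in> J then (\<Sum>i\<in>I. A j i * y i) + c j else 0)"

definition affine_maps :: "'i set \<Rightarrow> 'j set \<Rightarrow> (('i \<Rightarrow> real) \<Rightarrow> 'j \<Rightarrow> real) set"
  where "affine_maps I J = {affine_map I J A c | A c. True}"

definition orthogonal_coeffs :: "nat \<Rightarrow> (nat \<Rightarrow> nat \<Rightarrow> real) \<Rightarrow> bool"
  where "orthogonal_coeffs d U \<longleftrightarrow>
    (\<forall>i<d. \<forall>j<d. (\<Sum>k<d. U k i * U k j) = (if i = j then 1 else 0))"

definition affine_isometries :: "nat \<Rightarrow> ((nat \<Rightarrow> real) \<Rightarrow> nat \<Rightarrow> real) set"
  where "affine_isometries d = {affine_map {..<d} {..<d} U u | U u. orthogonal_coeffs d U}"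

definition polyhedron_in :: "nat \<Rightarrow> (nat \<Rightarrow> real) set \<Rightarrow> bool"
  where "polyhedron_in d Q \<longleftrightarrow>
    (\<exists>H :: ((nat \<Rightarrow> real) \<times> real) set. finite H \<and>
      Q = {y \<in> coord_space {..<d}. \<forall>(a, b)\<in>H. (\<Sum>i<d. a i * y i) \<le> b})"

text \<open>
  The library's \<open>aff_dim\<close> and \<open>facet_of\<close> are restricted to types of class \<open>euclidean_space\<close>.
  For nonempty \<open>S\<close>, the affine dimension is the dimension of the direction space of the affine
  hull, which is spanned by the differences of points of \<open>S\<close>.
\<close>

definition affdim :: "'a::real_vector set \<Rightarrow> nat"
  where "affdim S = dim {x - y | x y. x \<in> S \<and> y \<in> S}"

definition facets :: "'a::real_vector set \<Rightarrow> 'a set set"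
  where "facets Q = {F. F face_of Q \<and> F \<noteq> {} \<and> affdim Q = affdim F + 1}"

definition is_extension ::
  "nat \<Rightarrow> (nat \<Rightarrow> real) set \<Rightarrow> ((nat \<Rightarrow> real) \<Rightarrow> 'i \<Rightarrow> real) \<Rightarrow> 'i set \<Rightarrow> ('i \<Rightarrow> real) set \<Rightarrow> bool"
  where "is_extension d Q p I P \<longleftrightarrow>
    polyhedron_in d Q \<and> p \<in> affine_maps {..<d} I \<and> p ` Q = P"

definition extension_size :: "(nat \<Rightarrow> real) set \<Rightarrow> nat"
  where "extension_size Q = card (facets Q)"

definition symmetric_extension ::
  "(('i \<Rightarrow> real) \<Rightarrow> 'i \<Rightarrow> real) set \<Rightarrow>
    nat \<Rightarrow> (nat \<Rightarrow> real) set \<Rightarrow> ((nat \<Rightarrow> real) \<Rightarrow> 'i \<Rightarrow> real) \<Rightarrow> bool"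
  where "symmetric_extension G d Q p \<longleftrightarrow>
    (\<forall>g\<in>G. \<exists>\<kappa>\<in>affine_isometries d. \<kappa> ` Q = Q \<and> (\<forall>y\<in>Q. p (\<kappa> y) = g (p y)))"

definition complete_edges :: "nat \<Rightarrow> nat set set"
  where "complete_edges n = {{v, w} | v w. v \<in> {1..n} \<and> w \<in> {1..n} \<and> v \<noteq> w}"

definition cycles :: "nat \<Rightarrow> nat \<Rightarrow> nat set set set"
  where "cycles l n = {C. \<exists>vs. distinct vs \<and> length vs = l \<and> 3 \<le> l \<and> set vs \<subseteq> {1..n} \<and>
    C = {{vs ! i, vs ! (Suc i mod l)} | i. i < l}}"

definition cycle_polytope :: "nat \<Rightarrow> nat \<Rightarrow> (nat set \<Rightarrow> real) set"
  where "cycle_polytope l n = convex hull (indicat_real ` cycles l n)"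

definition node_action :: "(nat \<Rightarrow> nat) \<Rightarrow> (nat set \<Rightarrow> real) \<Rightarrow> nat set \<Rightarrow> real"
  where "node_action \<pi> x = (\<lambda>e. x (inv \<pi> ` e))"

definition node_symmetries :: "nat \<Rightarrow> ((nat set \<Rightarrow> real) \<Rightarrow> nat set \<Rightarrow> real) set"
  where "node_symmetries n = {node_action \<pi> | \<pi>. \<pi> permutes {1..n}}"

end

theory Submission
  imports Defs "HOL-Computational_Algebra.Polynomial"
begin

text \<open>
  Normalised slack functions turn a symmetric extension into a family of at most \<open>f\<close> nonnegative
  functions on the cycles, closed under \<open>S(n)\<close>, such that an affine combination of cycles on which
  every member of the family is nonnegative lies in the cycle polytope.

  Double the nodes \<open>v \<le> N\<close> (with \<open>N\<close> about \<open>n / 2\<close>) by copies \<open>N + v\<close>. Averaging over the cycles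
  that restrict to a given matching \<open>M\<close> on the first \<open>N\<close> nodes and contain the edges
  \<open>{v, N + v}\<close> for \<open>v\<close> covered by \<open>M\<close> turns the family into functions of \<open>M\<close>, closed under \<open>S(N)\<close>.
  If \<open>f\<close> is small, a pigeonhole version of Bochert's commutator argument shows that the stabiliser of
  each of them contains the alternating group on all but \<open>h\<close> nodes, so that it depends only on the
  edges of \<open>M\<close> that touch these \<open>h\<close> nodes.

  Let \<open>A\<close>, \<open>B\<close> be disjoint with \<open>2 h + 1\<close> nodes each. A perfect matching of \<open>A \<union> B\<close> has an
  odd number \<open>i\<close> of edges between \<open>A\<close> and \<open>B\<close>, and the probability that a random one with \<open>i\<close> such
  edges contains \<open>r \<le> h\<close> given edges is a polynomial in \<open>i\<close> of degree at most \<open>r\<close> whose value at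
  \<open>i = 0\<close> is nonnegative. Extrapolating from the \<open>h + 1\<close> odd values of \<open>i\<close> to \<open>i = 0\<close> gives an affine
  combination of cycles that must lie in the polytope and in a face, on which the number of edges
  between \<open>A\<close> and \<open>B\<close> is at least 1, although that number is 0 for the combination.
\<close>

subsection \<open>Facets and slack functions\<close>

text \<open>The rungs \<open>{v, N + v}\<close> turn cycles into matchings: a rung uses one of the
  two cycle edges at \<open>v\<close>, so exactly one more remains. Since the copy is determined by
  \<open>v\<close>, the symmetric group of the first \<open>N\<close> nodes moves nodes and copies
  together, and averaging commutes with it. The face is cut out by value 1 on the rungs at
  \<open>A \<union> B\<close> and value 0 on all other edges leaving \<open>A \<union> B\<close>; a
  cycle in it restricts to a perfect matching of \<open>A \<union> B\<close>, and \<open>A\<close>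
  being odd forces an edge across.

  The weights must be signed, as no perfect matching has 0 crossing edges; they look like a
  probability distribution only to functions that see the edges at \<open>h\<close> nodes. This is
  why the stabilisers have to be controlled first. Each matching edge takes four nodes of the cycle,
  hence \<open>8 h + 4 \<le> l\<close>. The group argument needs \<open>f < N choose y\<close> for
  \<open>h < y \<le> N / 2\<close>, which a lower index \<open>k \<le> h\<close> in the claimed
  binomial provides; the gap between \<open>n / 3\<close> and \<open>N\<close> pays for the factor
  lost in counting unions of classes.\<close>

lemma affine_combination_functional:
  fixes c :: "'j \<Rightarrow> real" and y :: "'j \<Rightarrow> 'i \<Rightarrow> real"
  assumes "(\<Sum>j\<in>J. c j) = 1"
  shows "(\<Sum>i\<in>I. a i * (\<Sum>j\<in>J. c j * y j i)) + b = (\<Sum>j\<in>J. c j * ((\<Sum>i\<in>I. a i * y j i) + b))"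
proof -
  have "(\<Sum>i\<in>I. a i * (\<Sum>j\<in>J. c j * y j i)) = (\<Sum>j\<in>J. c j * (\<Sum>i\<in>I. a i * y j i))"
    by (simp add: sum_distrib_left sum.swap[of _ I] mult.left_commute)
  moreover have "(\<Sum>j\<in>J. c j * ((\<Sum>i\<in>I. a i * y j i) + b)) = (\<Sum>j\<in>J. c j * (\<Sum>i\<in>I. a i * y j i)) + (\<Sum>j\<in>J. c j) * b"
    by (simp add: algebra_simps sum.distrib sum_distrib_left)
  ultimately show ?thesis using assms by simp
qed

lemma affine_map_combination:
  assumes "(\<Sum>j\<in>J. c j) = 1"
  shows "affine_map I K A b (\<lambda>i. \<Sum>j\<in>J. c j * y j i) = (\<lambda>k. \<Sum>j\<in>J. c j * affine_map I K A b (y j) k)"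
  by (simp add: affine_map_def fun_eq_iff affine_combination_functional[OF assms])

section \<open>Affine isometries preserve distances\<close>

definition dist2 :: "nat \<Rightarrow> (nat \<Rightarrow> real) \<Rightarrow> (nat \<Rightarrow> real) \<Rightarrow> real"
  where "dist2 d x y = L2_set (\<lambda>i. x i - y i) {..<d}"

lemma dist2_isometry:
  assumes "\<kappa> \<in> affine_isometries d"
  shows "dist2 d (\<kappa> x) (\<kappa> y) = dist2 d x y"
proof -
  obtain U u where \<kappa>: "\<kappa> = affine_map {..<d} {..<d} U u" and U: "orthogonal_coeffs d U"
    using assms by (auto simp: affine_isometries_def)
  let ?v = "\<lambda>i. x i - y i"
  have diff: "\<kappa> x k - \<kappa> y k = (\<Sum>i<d. U k i * ?v i)" if "k < d" for k
    using that by (simp add: \<kappa> affine_map_def sum_subtractf algebra_simps)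
  have "(\<Sum>k<d. (\<kappa> x k - \<kappa> y k)\<^sup>2) = (\<Sum>k<d. \<Sum>i<d. \<Sum>j<d. (U k i * U k j) * (?v i * ?v j))"
    by (intro sum.cong) (auto simp: diff power2_eq_square sum_product algebra_simps)
  also have "\<dots> = (\<Sum>i<d. \<Sum>j<d. (\<Sum>k<d. U k i * U k j) * (?v i * ?v j))"
    unfolding sum_distrib_right by (subst sum.swap, rule sum.cong[OF refl], rule sum.swap)
  also have "\<dots> = (\<Sum>i<d. \<Sum>j<d. (if i = j then 1 else 0) * (?v i * ?v j))"
    using U by (intro sum.cong) (auto simp: orthogonal_coeffs_def)
  also have "\<dots> = (\<Sum>i<d. (?v i)\<^sup>2)"
  proof (rule sum.cong)
    fix i assume "i \<in> {..<d}"
    then have "(\<Sum>j<d. if i = j then ?v i * ?v j else 0) = ?v i * ?v i" by (subst sum.delta') auto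
    then show "(\<Sum>j<d. (if i = j then 1 else 0) * (?v i * ?v j)) = (?v i)\<^sup>2"
      by (simp add: power2_eq_square if_distrib[of "\<lambda>x. x * _"] cong: if_cong)
  qed simp
  finally show ?thesis by (simp add: dist2_def L2_set_def)
qed

lemma dist2_eq_0:
  assumes "x \<in> coord_space {..<d}" "y \<in> coord_space {..<d}" "dist2 d x y = 0"
  shows "x = y"
proof
  fix i
  have "\<forall>i<d. x i - y i = 0" using assms(3) by (simp add: dist2_def L2_set_eq_0_iff)
  then show "x i = y i" using assms(1,2) by (cases "i < d") (auto simp: coord_space_def)
qed

lemma affine_isometries_inj_on:
  "\<kappa> \<in> affine_isometries d \<Longrightarrow> inj_on \<kappa> (coord_space {..<d})"
proof (rule inj_onI)
  fix x y assume "\<kappa> \<in> affine_isometries d" "x \<in> coord_space {..<d}" "y \<in> coord_space {..<d}" "\<kappa> x = \<kappa> y"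
  then show "x = y"
    using dist2_isometry[of \<kappa> d x y] by (intro dist2_eq_0) (auto simp: dist2_def L2_set_def)
qed

text \<open>With \<open>r = s x / s y\<close> and \<open>s z = 0\<close> the direction
  \<open>x - z - r (y - z)\<close> is killed by the linear part of \<open>s\<close>. Tilting thus
  moves from \<open>z\<close> towards an arbitrary \<open>x\<close> inside the hyperplane where
  \<open>s\<close> vanishes, by correcting along \<open>y\<close>.\<close>

abbreviation tilt :: "(nat \<Rightarrow> real) \<Rightarrow> real \<Rightarrow> (nat \<Rightarrow> real) \<Rightarrow> real \<Rightarrow> (nat \<Rightarrow> real) \<Rightarrow> nat \<Rightarrow> real"
  where "tilt z \<epsilon> x r y \<equiv> \<lambda>i. z i + \<epsilon> * (x i - z i - r * (y i - z i))"

text \<open>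
  A slack function of a facet of \<open>Q\<close>, extended by \<open>0\<close> outside \<open>Q\<close>. Scaling to Lipschitz
  constant 1 makes the set of these functions invariant under the isometries of \<open>Q\<close>. The assumption
  \<open>nb\<close> states that the zero set of \<open>s\<close> contains a neighbourhood of \<open>z\<close> in the hyperplane that \<open>s\<close>
  defines in the affine hull of \<open>Q\<close>.
\<close>

locale slack_function =
  fixes d :: nat and Q :: "(nat \<Rightarrow> real) set" and s :: "(nat \<Rightarrow> real) \<Rightarrow> real"
    and a :: "nat \<Rightarrow> real" and b :: real and z y0 :: "nat \<Rightarrow> real"
  assumes out: "y \<notin> Q \<Longrightarrow> s y = 0"
    and aff: "y \<in> Q \<Longrightarrow> s y = (\<Sum>i<d. a i * y i) + b"
    and nn: "y \<in> Q \<Longrightarrow> 0 \<le> s y"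
    and z: "z \<in> Q" "s z = 0"
    and nb: "x \<in> Q \<Longrightarrow> y \<in> Q \<Longrightarrow> 0 < s y \<Longrightarrow> \<exists>\<epsilon>>0. tilt z \<epsilon> x (s x / s y) y \<in> Q"
    and y0: "y0 \<in> Q" "0 < s y0"
    and lip: "x \<in> Q \<Longrightarrow> y \<in> Q \<Longrightarrow> \<bar>s x - s y\<bar> \<le> dist2 d x y"
    and lip_ge: "(\<And>x y. x \<in> Q \<Longrightarrow> y \<in> Q \<Longrightarrow> \<bar>s x - s y\<bar> \<le> L * dist2 d x y) \<Longrightarrow> 1 \<le> L"

definition slack_functions :: "nat \<Rightarrow> (nat \<Rightarrow> real) set \<Rightarrow> ((nat \<Rightarrow> real) \<Rightarrow> real) set"
  where "slack_functions d Q = {s. \<exists>a b z y0. slack_function d Q s a b z y0}"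

lemma functional_comb:
  fixes a :: "nat \<Rightarrow> real"
  shows "(\<Sum>i<d. a i * (z i + e * (x i - z i - r * (y i - z i)))) + b =
    ((\<Sum>i<d. a i * z i) + b) + e * (((\<Sum>i<d. a i * x i) + b) - ((\<Sum>i<d. a i * z i) + b) -
      r * (((\<Sum>i<d. a i * y i) + b) - ((\<Sum>i<d. a i * z i) + b)))"
  by (simp add: algebra_simps sum.distrib sum_subtractf sum_distrib_left)

lemma affine_functional_segment:
  assumes "\<And>y. y \<in> Q \<Longrightarrow> s y = (\<Sum>i<d. a i * y i) + b" "x \<in> Q" "y \<in> Q"
    "(1 - u) *\<^sub>R x + u *\<^sub>R y \<in> Q"
  shows "s ((1 - u) *\<^sub>R x + u *\<^sub>R y) = (1 - u) * s x + u * s y"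
  using assms by (simp add: scaleR_fun_def algebra_simps sum.distrib sum_subtractf sum_distrib_left)

text \<open>\<open>dim\<close> is the cardinality of a basis, so comparing the dimensions of
  \<open>Q\<close> and of a facet by adding one vector to a basis requires that basis to be
  finite.\<close>

lemma finite_independent_coord_space:
  fixes B :: "(nat \<Rightarrow> real) set" and d :: nat
  assumes "independent B" "B \<subseteq> coord_space {..<d}"
  shows "finite B"
proof -
  define e :: "nat \<Rightarrow> nat \<Rightarrow> real" where "e i = (\<lambda>k. of_bool (k = i))" for i
  have "coord_space {..<d} \<subseteq> span (e ` {..<d})"
  proof
    fix x :: "nat \<Rightarrow> real" assume x: "x \<in> coord_space {..<d}"
    have "x = (\<Sum>i<d. x i *\<^sub>R e i)"
    proof
      fix k
      have "(\<Sum>i<d. x i *\<^sub>R e i) k = (\<Sum>i<d. x i * of_bool (k = i))"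
      proof -
        have "(\<Sum>i\<in>J. x i *\<^sub>R e i) k = (\<Sum>i\<in>J. x i * of_bool (k = i))" if "finite J" for J
          using that by (induction J) (auto simp: scaleR_fun_def e_def)
        then show ?thesis by simp
      qed
      also have "\<dots> = x k"
        using x by (auto simp: coord_space_def of_bool_def if_distrib cong: if_cong)
      finally show "x k = (\<Sum>i<d. x i *\<^sub>R e i) k" by simp
    qed
    moreover have "(\<Sum>i<d. x i *\<^sub>R e i) \<in> span (e ` {..<d})"
      by (intro span_sum span_scale span_base) auto
    ultimately show "x \<in> span (e ` {..<d})" by simp
  qed
  then show ?thesis
    using real_vector.independent_span_bound[of "e ` {..<d}" B] assms by (meson finite_imageI finite_lessThan subset_trans)
qed

text \<open>Nonnegativity of \<open>s\<close> makes its zero set a face. For the codimension, each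
  \<open>x - z\<close> is a combination of \<open>y0 - z\<close> and a difference of two zeros of
  \<open>s\<close>, namely a tilted point minus \<open>z\<close>; and \<open>y0 - z\<close> is
  independent of such differences because the linear part of \<open>s\<close> is positive on it and
  0 on them.\<close>

lemma slack_function_zero_set_facet:
  assumes Q: "Q \<subseteq> coord_space {..<d}" "convex Q" and s: "s \<in> slack_functions d Q"
  shows "{y \<in> Q. s y = 0} \<in> facets Q"
proof -
  obtain a b z y0 where "slack_function d Q s a b z y0" using s by (auto simp: slack_functions_def)
  then interpret slack_function d Q s a b z y0 .
  let ?F = "{y \<in> Q. s y = 0}"
  have face: "?F face_of Q" unfolding face_of_def
  proof (intro conjI ballI impI)
    show "convex ?F"
    proof (rule convexI)
      fix x y :: "nat \<Rightarrow> real" and u v :: real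
      assume xy: "x \<in> ?F" "y \<in> ?F" and uv: "0 \<le> u" "0 \<le> v" "u + v = 1"
      have in_Q: "u *\<^sub>R x + v *\<^sub>R y \<in> Q" using xy uv Q(2) by (auto intro: convexD)
      have "u = 1 - v" using uv by simp
      then show "u *\<^sub>R x + v *\<^sub>R y \<in> ?F"
        using affine_functional_segment[of Q s a d b x y v, OF aff] xy in_Q by simp
    qed
    fix x y w assume xy: "x \<in> Q" "y \<in> Q" and w: "w \<in> ?F" "w \<in> open_segment x y"
    obtain u where u: "0 < u" "u < 1" "w = (1 - u) *\<^sub>R x + u *\<^sub>R y"
      using w(2) by (auto simp: in_segment)
    have "(1 - u) * s x + u * s y = 0"
      using affine_functional_segment[of Q s a d b x y u, OF aff] xy w(1) u by simp
    moreover have "0 \<le> (1 - u) * s x" "0 \<le> u * s y" using u nn xy by auto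
    ultimately have "(1 - u) * s x = 0" "u * s y = 0" by linarith+
    then show "x \<in> ?F" "y \<in> ?F" using u xy by auto
  qed auto
  let ?D = "{x - y |x y. x \<in> Q \<and> y \<in> Q}"
  let ?DF = "{x - y |x y. x \<in> ?F \<and> y \<in> ?F}"
  obtain B where B: "B \<subseteq> ?DF" "independent B" "?DF \<subseteq> span B" "card B = dim ?DF"
    using real_vector.basis_exists[of ?DF] by blast
  have "?DF \<subseteq> coord_space {..<d}"
  proof
    fix v assume "v \<in> ?DF"
    then obtain x y where "v = x - y" "x \<in> Q" "y \<in> Q" by blast
    then have "v = x - y" "x \<in> coord_space {..<d}" "y \<in> coord_space {..<d}" using Q(1) by auto
    then show "v \<in> coord_space {..<d}" by (simp add: coord_space_def)
  qed
  then have fB: "finite B"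
    using finite_independent_coord_space[OF B(2)] B(1) by (meson subset_trans)
  have "(\<Sum>i<d. a i * v i) = 0" if "v \<in> span B" for v
    using that
  proof (induction rule: span_induct_alt)
    case (step c x y)
    obtain p q where pq: "x = p - q" "p \<in> ?F" "q \<in> ?F" using step(1) B(1) by blast
    then have "(\<Sum>i<d. a i * x i) = 0"
    proof -
      have "(\<Sum>i<d. a i * x i) = (\<Sum>i<d. a i * p i) - (\<Sum>i<d. a i * q i)"
        unfolding pq(1) by (simp add: right_diff_distrib sum_subtractf)
      then show ?thesis using aff[of p] aff[of q] pq by simp
    qed
    moreover have "(\<Sum>i<d. a i * (c *\<^sub>R x + y) i) = c * (\<Sum>i<d. a i * x i) + (\<Sum>i<d. a i * y i)"
      by (simp add: scaleR_fun_def algebra_simps sum.distrib sum_distrib_left)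
    ultimately show ?case using step by simp
  qed simp
  moreover have "(\<Sum>i<d. a i * (y0 - z) i) = s y0"
    using aff[of y0] aff[of z] y0 z by (simp add: right_diff_distrib sum_subtractf)
  ultimately have notin: "y0 - z \<notin> span B" using y0(2) by fastforce
  have zin: "x - z \<in> span (insert (y0 - z) B)" if x: "x \<in> Q" for x
  proof -
    obtain \<epsilon> where \<epsilon>: "0 < \<epsilon>" "tilt z \<epsilon> x (s x / s y0) y0 \<in> Q" using nb x y0 by blast
    define w where "w = tilt z \<epsilon> x (s x / s y0) y0"
    have wQ: "w \<in> Q" using \<epsilon> by (simp add: w_def)
    have "s w = s z + \<epsilon> * (s x - s z - s x / s y0 * (s y0 - s z))"
      using functional_comb[of a z \<epsilon> x "s x / s y0" y0 d b] aff[OF wQ] aff x y0 z(1)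
      by (simp only: w_def)
    then have "s w = 0" using z y0 by simp
    then have "w - z \<in> ?DF" using wQ z by blast
    then have "w - z \<in> span (insert (y0 - z) B)"
      using B(3) span_mono[of B "insert (y0 - z) B"] by blast
    then have "(1 / \<epsilon>) *\<^sub>R (w - z) + (s x / s y0) *\<^sub>R (y0 - z) \<in> span (insert (y0 - z) B)"
      by (intro span_add span_scale) (auto intro: span_base)
    moreover have "(1 / \<epsilon>) *\<^sub>R (w - z) + (s x / s y0) *\<^sub>R (y0 - z) = x - z"
      using \<epsilon>(1) by (auto simp: w_def scaleR_fun_def fun_eq_iff)
    ultimately show ?thesis by simp
  qed
  have "dim ?D = card (insert (y0 - z) B)"
  proof (rule real_vector.dim_unique)
    show "insert (y0 - z) B \<subseteq> ?D" using B(1) y0(1) z(1) by blast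
    show "?D \<subseteq> span (insert (y0 - z) B)"
    proof
      fix v assume "v \<in> ?D"
      then obtain x y where "x \<in> Q" "y \<in> Q" "v = (x - z) - (y - z)" by auto
      then show "v \<in> span (insert (y0 - z) B)" using zin span_diff by blast
    qed
    show "independent (insert (y0 - z) B)" using notin B(2) independent_insertI by blast
  qed simp
  moreover have "y0 - z \<notin> B" using notin span_base by blast
  ultimately have "affdim Q = affdim ?F + 1" using fB B(4) by (simp add: affdim_def)
  then show ?thesis using face z by (auto simp: facets_def)
qed

text \<open>Tilted points lie in the common zero set, which forces \<open>s' = c s\<close> on
  \<open>Q\<close>. Both functions have least Lipschitz constant 1, so neither \<open>c < 1\<close>
  nor \<open>c > 1\<close> is possible.\<close>

lemma slack_function_determined_by_zero_set:
  assumes s: "s \<in> slack_functions d Q" and s': "s' \<in> slack_functions d Q"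
    and eq: "{y \<in> Q. s y = 0} = {y \<in> Q. s' y = 0}"
  shows "s = s'"
proof -
  obtain a b z y0 where "slack_function d Q s a b z y0" using s by (auto simp: slack_functions_def)
  then interpret slack_function d Q s a b z y0 .
  obtain a' b' z' y0' where "slack_function d Q s' a' b' z' y0'"
    using s' by (auto simp: slack_functions_def)
  then interpret s': slack_function d Q s' a' b' z' y0' .
  have iff: "s y = 0 \<longleftrightarrow> s' y = 0" if "y \<in> Q" for y using eq that by blast
  define c where "c = s' y0 / s y0"
  have "0 < c" using s'.nn[OF y0(1)] iff[OF y0(1)] y0(2) by (simp add: c_def)
  have scaled: "s' x = c * s x" if x: "x \<in> Q" for x
  proof -
    define r where "r = s x / s y0"
    obtain \<epsilon> where \<epsilon>: "0 < \<epsilon>" "tilt z \<epsilon> x r y0 \<in> Q" using nb x y0 unfolding r_def by blast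
    define w where "w = tilt z \<epsilon> x r y0"
    have wQ: "w \<in> Q" using \<epsilon> by (simp add: w_def)
    have "s w = s z + \<epsilon> * (s x - s z - r * (s y0 - s z))"
      using functional_comb[of a z \<epsilon> x r y0 d b] aff[OF wQ] aff x y0 z(1) by (simp only: w_def)
    then have "s' w = 0" using z y0 iff[OF wQ] by (simp add: r_def)
    moreover have "s' w = s' z + \<epsilon> * (s' x - s' z - r * (s' y0 - s' z))"
      using functional_comb[of a' z \<epsilon> x r y0 d b'] s'.aff[OF wQ] s'.aff x y0 z(1) by (simp only: w_def)
    ultimately have "s' x = r * s' y0" using \<epsilon>(1) iff[OF z(1)] z(2) by simp
    then show ?thesis by (simp add: r_def c_def)
  qed
  have "1 \<le> c"
  proof (rule s'.lip_ge)
    fix x y assume xy: "x \<in> Q" "y \<in> Q"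
    have "\<bar>s' x - s' y\<bar> = c * \<bar>s x - s y\<bar>"
      using scaled xy \<open>0 < c\<close> by (simp add: abs_mult right_diff_distrib[symmetric])
    then show "\<bar>s' x - s' y\<bar> \<le> c * dist2 d x y" using lip[OF xy] \<open>0 < c\<close> by simp
  qed
  moreover have "1 \<le> 1 / c"
  proof (rule lip_ge)
    fix x y assume xy: "x \<in> Q" "y \<in> Q"
    have "\<bar>s' x - s' y\<bar> = c * \<bar>s x - s y\<bar>"
      using scaled xy \<open>0 < c\<close> by (simp add: abs_mult right_diff_distrib[symmetric])
    then show "\<bar>s x - s y\<bar> \<le> 1 / c * dist2 d x y"
      using s'.lip[OF xy] \<open>0 < c\<close> by (simp add: field_simps)
  qed
  ultimately have "c = 1" using \<open>0 < c\<close> by (simp add: field_simps)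
  then show ?thesis using scaled out s'.out by (metis ext mult_1)
qed

lemma exists_small_step:
  assumes "finite H" "\<And>h. h \<in> H \<Longrightarrow> 0 < u h"
  shows "\<exists>\<delta>>0::real. \<forall>h\<in>H. \<delta> * w h \<le> u h"
proof -
  have "\<forall>\<^sub>F \<delta> in at_right 0. \<forall>h\<in>H. \<delta> * w h \<le> u h"
  proof (rule eventually_ball_finite[OF assms(1)], rule ballI)
    fix h assume h: "h \<in> H"
    have "((\<lambda>\<delta>. \<delta> * w h) \<longlongrightarrow> 0 * w h) (at_right 0)" by (intro tendsto_intros)
    then have "\<forall>\<^sub>F \<delta> in at_right 0. \<delta> * w h < u h" using assms(2)[OF h] by (intro order_tendstoD) simp_all
    then show "\<forall>\<^sub>F \<delta> in at_right 0. \<delta> * w h \<le> u h" by eventually_elim simp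
  qed
  with eventually_at_right_less[of "0::real"] have "\<forall>\<^sub>F \<delta> in at_right 0. 0 < \<delta> \<and> (\<forall>h\<in>H. \<delta> * w h \<le> u h)"
    by eventually_elim simp
  then show ?thesis using eventually_happens'[OF trivial_limit_at_right_real] by blast
qed

section \<open>Polyhedra given by finitely many inequalities\<close>

definition slack :: "nat \<Rightarrow> ((nat \<Rightarrow> real) \<times> real) \<Rightarrow> (nat \<Rightarrow> real) \<Rightarrow> real"
  where "slack d h y = (\<Sum>i<d. - fst h i * y i) + snd h"

lemma slack_segment: "slack d h ((1 - u) *\<^sub>R x + u *\<^sub>R y) = (1 - u) * slack d h x + u * slack d h y"
  by (simp add: slack_def scaleR_fun_def algebra_simps sum.distrib sum_subtractf sum_distrib_left sum_negf)

lemma slack_combination: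
  "(\<Sum>j\<in>J. c j) = 1 \<Longrightarrow> slack d h (\<lambda>i. \<Sum>j\<in>J. c j * y j i) = (\<Sum>j\<in>J. c j * slack d h (y j))"
  unfolding slack_def by (rule affine_combination_functional)

lemma slack_comb:
  "slack d h (tilt z e x r y) =
    slack d h z + e * (slack d h x - slack d h z - r * (slack d h y - slack d h z))"
  unfolding slack_def by (rule functional_comb)

locale polyhedron_description =
  fixes d :: nat and H :: "((nat \<Rightarrow> real) \<times> real) set" and Q :: "(nat \<Rightarrow> real) set"
  assumes finite_H: "finite H"
    and Q_eq: "Q = {y \<in> coord_space {..<d}. \<forall>h\<in>H. 0 \<le> slack d h y}"
begin

lemma Q_coord: "Q \<subseteq> coord_space {..<d}" by (auto simp: Q_eq)

lemma convex_Q: "convex Q"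
proof (rule convexI)
  fix x y :: "nat \<Rightarrow> real" and u v :: real
  assume xy: "x \<in> Q" "y \<in> Q" and uv: "0 \<le> u" "0 \<le> v" "u + v = 1"
  have u: "u = 1 - v" using uv by simp
  have "u *\<^sub>R x + v *\<^sub>R y \<in> coord_space {..<d}"
    using xy by (simp add: Q_eq coord_space_def scaleR_fun_def)
  moreover have "0 \<le> slack d h (u *\<^sub>R x + v *\<^sub>R y)" if "h \<in> H" for h
    using xy uv that unfolding u slack_segment by (auto simp: Q_eq)
  ultimately show "u *\<^sub>R x + v *\<^sub>R y \<in> Q" by (simp add: Q_eq)
qed

text \<open>Midpoints do it: slacks are affine and nonnegative on \<open>C\<close>, so the midpoint
  of two points is strict wherever one of them is. The induction runs over the finitely many
  inequalities.\<close>

lemma exists_relative_interior_point: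
  assumes "convex C" "C \<subseteq> Q" "C \<noteq> {}"
  shows "\<exists>x\<in>C. \<forall>h\<in>H. (\<exists>y\<in>C. 0 < slack d h y) \<longrightarrow> 0 < slack d h x"
proof -
  have "\<exists>x\<in>C. \<forall>h\<in>H'. (\<exists>y\<in>C. 0 < slack d h y) \<longrightarrow> 0 < slack d h x" if "finite H'" "H' \<subseteq> H" for H'
    using that
  proof (induction H' rule: finite_induct)
    case empty
    then show ?case using assms(3) by auto
  next
    case (insert g G)
    then obtain x where x: "x \<in> C" "\<forall>h\<in>G. (\<exists>y\<in>C. 0 < slack d h y) \<longrightarrow> 0 < slack d h x" by auto
    show ?case
    proof (cases "\<exists>y\<in>C. 0 < slack d g y")
      case True
      then obtain y where y: "y \<in> C" "0 < slack d g y" by blast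
      define m where "m = (1 - 1/2) *\<^sub>R x + (1/2::real) *\<^sub>R y"
      have m: "m \<in> C" unfolding m_def using assms(1) x(1) y(1) by (intro convexD) auto
      have sl: "slack d h m = (slack d h x + slack d h y) / 2" for h
        unfolding m_def slack_segment by simp
      have nn: "0 \<le> slack d h x" "0 \<le> slack d h y" if "h \<in> insert g G" for h
        using x(1) y(1) assms(2) that insert.prems by (auto simp: Q_eq)
      have "0 < slack d h m" if "h \<in> insert g G" "\<exists>y\<in>C. 0 < slack d h y" for h
      proof (cases "h = g")
        case True
        then show ?thesis using nn[of g] y(2) unfolding sl by simp
      next
        case False
        then have "0 < slack d h x" using x(2) that by blast
        then show ?thesis using nn[OF that(1)] unfolding sl by simp
      qed
      then show ?thesis using m by blast
    next
      case False
      then show ?thesis using x by blast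
    qed
  qed
  then show ?thesis using finite_H by blast
qed

text \<open>From a point \<open>x\<close> of \<open>F\<close> that is strict wherever possible, the
  segment from \<open>y\<close> to \<open>x\<close> can be prolonged a little beyond
  \<open>x\<close> within \<open>Q\<close>, to \<open>p\<close>. So \<open>x\<close> lies inside a
  segment of \<open>Q\<close> ending at \<open>y\<close>, and the face property pulls
  \<open>y\<close> into \<open>F\<close>.\<close>

lemma face_eq_tight_set:
  assumes "F face_of Q" "F \<noteq> {}"
  shows "F = {y \<in> Q. \<forall>h\<in>{h \<in> H. \<forall>x\<in>F. slack d h x = 0}. slack d h y = 0}"
proof
  show "F \<subseteq> {y \<in> Q. \<forall>h\<in>{h \<in> H. \<forall>x\<in>F. slack d h x = 0}. slack d h y = 0}"
    using assms(1) by (auto simp: face_of_def)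
  have F: "convex F" "F \<subseteq> Q" using assms(1) by (auto simp: face_of_def)
  obtain x where x: "x \<in> F" "\<forall>h\<in>H. (\<exists>y\<in>F. 0 < slack d h y) \<longrightarrow> 0 < slack d h x"
    using exists_relative_interior_point[OF F assms(2)] by blast
  show "{y \<in> Q. \<forall>h\<in>{h \<in> H. \<forall>x\<in>F. slack d h x = 0}. slack d h y = 0} \<subseteq> F"
  proof
    fix y assume "y \<in> {y \<in> Q. \<forall>h\<in>{h \<in> H. \<forall>x\<in>F. slack d h x = 0}. slack d h y = 0}"
    then have y: "y \<in> Q" "\<And>h. h \<in> H \<Longrightarrow> \<forall>x\<in>F. slack d h x = 0 \<Longrightarrow> slack d h y = 0" by auto
    have pos: "0 < slack d h x" if "h \<in> H" "slack d h y \<noteq> 0" for h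
    proof -
      obtain w where "w \<in> F" "slack d h w \<noteq> 0" using y(2) \<open>h \<in> H\<close> \<open>slack d h y \<noteq> 0\<close> by blast
      moreover have "0 \<le> slack d h w" using \<open>w \<in> F\<close> F(2) \<open>h \<in> H\<close> by (auto simp: Q_eq)
      ultimately have "\<exists>w\<in>F. 0 < slack d h w" by (intro bexI[of _ w]) auto
      then show ?thesis using x(2) \<open>h \<in> H\<close> by blast
    qed
    obtain \<delta> where \<delta>: "0 < \<delta>" "\<forall>h\<in>{h \<in> H. slack d h y \<noteq> 0}. \<delta> * (slack d h y - slack d h x) \<le> slack d h x"
      using exists_small_step[of "{h \<in> H. slack d h y \<noteq> 0}" "\<lambda>h. slack d h x" "\<lambda>h. slack d h y - slack d h x"]
        finite_H pos by auto
    define p where "p = (1 - (- \<delta>)) *\<^sub>R x + (- \<delta>) *\<^sub>R y"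
    have slp: "slack d h p = slack d h x - \<delta> * (slack d h y - slack d h x)" for h
      unfolding p_def slack_segment by (simp add: algebra_simps)
    have "0 \<le> slack d h p" if h: "h \<in> H" for h
    proof (cases "slack d h y = 0")
      case True
      have "0 \<le> slack d h x" using x(1) F(2) h by (auto simp: Q_eq)
      then show ?thesis using True \<delta>(1) unfolding slp by simp
    next
      case False
      then have "\<delta> * (slack d h y - slack d h x) \<le> slack d h x"
        using bspec[OF \<delta>(2), of h] h by blast
      then show ?thesis unfolding slp by simp
    qed
    moreover have "p \<in> coord_space {..<d}"
    proof -
      have "x \<in> coord_space {..<d}" "y \<in> coord_space {..<d}" using x(1) F(2) y(1) Q_coord by blast+
      then show ?thesis by (simp add: p_def coord_space_def scaleR_fun_def)
    qed
    ultimately have pQ: "p \<in> Q" by (simp add: Q_eq)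
    show "y \<in> F"
    proof (cases "x = y")
      case False
      \<comment> \<open>The definition of \<open>p\<close> reads
        \<open>p = (1 + \<delta>) x - \<delta> y\<close>; this is that equation solved for
        \<open>x\<close>.\<close>
      have "x = (1 - \<delta> / (1 + \<delta>)) *\<^sub>R p + (\<delta> / (1 + \<delta>)) *\<^sub>R y"
      proof
        fix i
        have ne: "1 + \<delta> \<noteq> 0" using \<delta>(1) by simp
        then have "1 - \<delta> / (1 + \<delta>) = 1 / (1 + \<delta>)" by (simp add: field_simps)
        then have "((1 - \<delta> / (1 + \<delta>)) *\<^sub>R p + (\<delta> / (1 + \<delta>)) *\<^sub>R y) i = (p i + \<delta> * y i) / (1 + \<delta>)"
          by (simp add: scaleR_fun_def add_divide_distrib)
        also have "p i + \<delta> * y i = (1 + \<delta>) * x i" by (simp add: p_def scaleR_fun_def algebra_simps)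
        finally show "x i = ((1 - \<delta> / (1 + \<delta>)) *\<^sub>R p + (\<delta> / (1 + \<delta>)) *\<^sub>R y) i" using ne by simp
      qed
      moreover have "p \<noteq> y"
      proof
        assume "p = y"
        have "x i = y i" for i
        proof -
          have "(1 + \<delta>) * (x i - y i) = p i - y i" by (simp add: p_def scaleR_fun_def algebra_simps)
          then show ?thesis using \<open>p = y\<close> \<delta>(1) by simp
        qed
        then show False using False by blast
      qed
      ultimately have "x \<in> open_segment p y"
        using \<delta>(1) by (auto simp: in_segment intro!: exI[of _ "\<delta> / (1 + \<delta>)"])
      then show ?thesis using assms(1) pQ y(1) x(1) by (auto simp: face_of_def)
    qed (use x in simp)
  qed
qed

text \<open>A face is recovered from its set of tight inequalities. Finiteness matters because
  \<open>card\<close> of an infinite set is 0, which would break every comparison with the number of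
  facets.\<close>

lemma finite_facets: "finite (facets Q)"
proof (rule finite_subset)
  show "facets Q \<subseteq> (\<lambda>T. {y \<in> Q. \<forall>h\<in>T. slack d h y = 0}) ` Pow H"
  proof
    fix F assume "F \<in> facets Q"
    then have "F face_of Q" "F \<noteq> {}" by (auto simp: facets_def)
    then show "F \<in> (\<lambda>T. {y \<in> Q. \<forall>h\<in>T. slack d h y = 0}) ` Pow H"
      using face_eq_tight_set[of F] by blast
  qed
qed (use finite_H in simp)

lemma slack_functions_finite: "finite (slack_functions d Q)"
  and card_slack_functions: "card (slack_functions d Q) \<le> card (facets Q)"
proof -
  let ?z = "\<lambda>s. {y \<in> Q. s y = (0::real)}"
  have sub: "?z ` slack_functions d Q \<subseteq> facets Q"
    using slack_function_zero_set_facet[OF Q_coord convex_Q] by blast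
  have inj: "inj_on ?z (slack_functions d Q)"
    by (rule inj_onI) (rule slack_function_determined_by_zero_set)
  show "finite (slack_functions d Q)" using inj_on_finite[OF inj sub finite_facets] .
  show "card (slack_functions d Q) \<le> card (facets Q)"
    using card_inj_on_le[OF inj sub finite_facets] .
qed

lemma slack_bounded_by_dist2: "\<exists>L. \<forall>x y. \<bar>slack d h x - slack d h y\<bar> \<le> L * dist2 d x y"
proof (intro exI allI)
  fix x y
  have "slack d h x - slack d h y = (\<Sum>i<d. - fst h i * (x i - y i))"
    by (simp add: slack_def algebra_simps sum_subtractf sum_negf)
  then have "\<bar>slack d h x - slack d h y\<bar> \<le> (\<Sum>i<d. \<bar>fst h i\<bar> * \<bar>x i - y i\<bar>)"
    using sum_abs[of "\<lambda>i. - fst h i * (x i - y i)" "{..<d}"] by (simp add: abs_mult)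
  also have "\<dots> \<le> L2_set (fst h) {..<d} * dist2 d x y" unfolding dist2_def by (rule L2_set_mult_ineq)
  finally show "\<bar>slack d h x - slack d h y\<bar> \<le> L2_set (fst h) {..<d} * dist2 d x y" .
qed

text \<open>The divisor is the least Lipschitz constant of the slack on \<open>Q\<close>. It is
  positive because the slack separates \<open>y0\<close> from \<open>z\<close>, and the infimum is
  itself a Lipschitz constant because each pair of points imposes a closed condition.\<close>

lemma slack_normalized:
  assumes h: "h \<in> H" and z: "z \<in> Q" "slack d h z = 0" and y0: "y0 \<in> Q" "0 < slack d h y0"
    and nb: "\<And>x y. x \<in> Q \<Longrightarrow> y \<in> Q \<Longrightarrow> 0 < slack d h y \<Longrightarrow>
      \<exists>\<epsilon>>0. tilt z \<epsilon> x (slack d h x / slack d h y) y \<in> Q"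
  shows "\<exists>c>0. (\<lambda>y. if y \<in> Q then slack d h y / c else 0) \<in> slack_functions d Q"
proof -
  let ?g = "slack d h"
  define R where "R = {L. \<forall>x\<in>Q. \<forall>y\<in>Q. \<bar>?g x - ?g y\<bar> \<le> L * dist2 d x y}"
  have "R \<noteq> {}" using slack_bounded_by_dist2[of h] by (auto simp: R_def)
  have d0: "0 \<le> dist2 d x y" for x y by (simp add: dist2_def L2_set_nonneg)
  have lower: "\<bar>?g x - ?g y\<bar> / dist2 d x y \<le> L" if "L \<in> R" "x \<in> Q" "y \<in> Q" "0 < dist2 d x y" for L x y
    using that by (simp add: R_def divide_le_eq)
  have dpos: "0 < dist2 d y0 z"
  proof -
    obtain L where "L \<in> R" using \<open>R \<noteq> {}\<close> by blast
    then have "\<bar>?g y0 - ?g z\<bar> \<le> L * dist2 d y0 z" using y0(1) z(1) unfolding R_def by blast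
    then have "dist2 d y0 z \<noteq> 0" using y0 z by auto
    then show ?thesis using d0[of y0 z] by simp
  qed
  have bdd: "bdd_below R" by (rule bdd_belowI) (rule lower[OF _ y0(1) z(1) dpos])
  define c where "c = Inf R"
  have "\<bar>?g y0 - ?g z\<bar> / dist2 d y0 z \<le> c"
    unfolding c_def using \<open>R \<noteq> {}\<close> lower[OF _ y0(1) z(1) dpos] by (intro cInf_greatest) auto
  moreover have "0 < \<bar>?g y0 - ?g z\<bar> / dist2 d y0 z" using y0 z dpos by simp
  ultimately have cpos: "0 < c" by linarith
  have cR: "\<bar>?g x - ?g y\<bar> \<le> c * dist2 d x y" if xy: "x \<in> Q" "y \<in> Q" for x y
  proof (cases "dist2 d x y = 0")
    case True
    obtain L where "L \<in> R" using \<open>R \<noteq> {}\<close> by blast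
    then have "\<bar>?g x - ?g y\<bar> \<le> L * dist2 d x y" using xy unfolding R_def by blast
    then show ?thesis using True by simp
  next
    case False
    then have pos: "0 < dist2 d x y" using d0[of x y] by simp
    have "\<bar>?g x - ?g y\<bar> / dist2 d x y \<le> c"
      unfolding c_def using \<open>R \<noteq> {}\<close> lower[OF _ xy pos] by (intro cInf_greatest) auto
    then show ?thesis using pos by (simp add: divide_le_eq)
  qed
  define s where "s y = (if y \<in> Q then ?g y / c else 0)" for y
  have sQ: "s y = ?g y / c" if "y \<in> Q" for y using that by (simp add: s_def)
  have "slack_function d Q s (\<lambda>i. - fst h i / c) (snd h / c) z y0"
  proof
    show "s y = 0" if "y \<notin> Q" for y using that by (simp add: s_def)
    show "s y = (\<Sum>i<d. - fst h i / c * y i) + snd h / c" if "y \<in> Q" for y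
      using that by (simp add: sQ slack_def add_divide_distrib sum_divide_distrib)
    show "0 \<le> s y" if "y \<in> Q" for y using that h cpos by (auto simp: s_def Q_eq)
    show "\<exists>\<epsilon>>0. tilt z \<epsilon> x (s x / s y) y \<in> Q" if xy: "x \<in> Q" "y \<in> Q" "0 < s y" for x y
    proof -
      have "0 < ?g y" using xy cpos by (simp add: sQ zero_less_divide_iff)
      moreover have "s x / s y = ?g x / ?g y" using xy cpos by (simp add: sQ)
      ultimately show ?thesis using nb[OF xy(1,2)] by simp
    qed
    show "z \<in> Q" "s z = 0" "y0 \<in> Q" "0 < s y0" using z y0 cpos by (simp_all add: sQ)
    have diff: "\<bar>s x - s y\<bar> = \<bar>?g x - ?g y\<bar> / c" if "x \<in> Q" "y \<in> Q" for x y
      using that cpos by (simp add: sQ diff_divide_distrib[symmetric])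
    show "\<bar>s x - s y\<bar> \<le> dist2 d x y" if "x \<in> Q" "y \<in> Q" for x y
      using that cR cpos by (simp add: diff divide_le_eq mult.commute)
    show "1 \<le> L" if L: "\<And>x y. x \<in> Q \<Longrightarrow> y \<in> Q \<Longrightarrow> \<bar>s x - s y\<bar> \<le> L * dist2 d x y" for L
    proof -
      have "c * L \<in> R" unfolding R_def
      proof (intro CollectI ballI)
        fix x y assume "x \<in> Q" "y \<in> Q"
        then have "\<bar>?g x - ?g y\<bar> / c \<le> L * dist2 d x y" using L diff by metis
        then show "\<bar>?g x - ?g y\<bar> \<le> c * L * dist2 d x y" using cpos by (simp add: divide_le_eq mult_ac)
      qed
      then have "c \<le> c * L" unfolding c_def by (rule cInf_lower[OF _ bdd])
      then show ?thesis using cpos by simp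
    qed
  qed
  then have "s \<in> slack_functions d Q" by (auto simp: slack_functions_def)
  then show ?thesis using cpos unfolding s_def by blast
qed

text \<open>A polyhedron is cut out of its implicit equations by facet inequalities. For each
  inequality \<open>h\<close> of an irredundant description there is a point of \<open>Q\<close> at
  which \<open>h\<close> is tight and every other inequality outside \<open>E\<close> is strict;
  hence the normalised slack of \<open>h\<close> is a slack function, and the assumption yields
  \<open>h\<close> for the combination.\<close>

lemma combination_mem_if_slack_functions_nonneg:
  fixes c :: "'j \<Rightarrow> real"
  assumes J: "(\<Sum>j\<in>J. c j) = 1" "\<And>j. j \<in> J \<Longrightarrow> y j \<in> Q"
    and nonneg: "\<And>s. s \<in> slack_functions d Q \<Longrightarrow> 0 \<le> (\<Sum>j\<in>J. c j * s (y j))"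
  shows "(\<lambda>i. \<Sum>j\<in>J. c j * y j i) \<in> Q"
proof -
  have "J \<noteq> {}" using J(1) by auto
  then have "Q \<noteq> {}" using J(2) by auto
  then obtain x0 where x0: "x0 \<in> Q" "\<forall>h\<in>H. (\<exists>y\<in>Q. 0 < slack d h y) \<longrightarrow> 0 < slack d h x0"
    using exists_relative_interior_point[OF convex_Q] by blast
  define E where "E = {h \<in> H. \<forall>y\<in>Q. slack d h y = 0}"
  define A where "A = {y \<in> coord_space {..<d}. \<forall>h\<in>E. slack d h y = 0}"
  have QA: "Q \<subseteq> A" using Q_coord by (auto simp: A_def E_def)
  define describes where "describes G \<longleftrightarrow> G \<subseteq> H \<and> Q = {y \<in> A. \<forall>h\<in>G. 0 \<le> slack d h y}" for G
  have "describes H" unfolding describes_def using QA by (auto simp: Q_eq A_def)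
  \<comment> \<open>A subsystem of least size is irredundant: dropping any \<open>h\<close> from it
    admits a point \<open>w\<close> of \<open>A\<close> that violates \<open>h\<close>
    alone.\<close>
  then obtain G where G: "describes G" "\<And>G'. describes G' \<Longrightarrow> card G \<le> card G'"
    using ex_has_least_nat[of describes H card] by blast
  have GH: "G \<subseteq> H" and fG: "finite G" and Qd: "Q = {y \<in> A. \<forall>h\<in>G. 0 \<le> slack d h y}"
    using G(1) finite_H finite_subset by (auto simp: describes_def)
  have comb_A: "(\<lambda>i. \<Sum>j\<in>J. c j * y j i) \<in> A"
  proof -
    have "(\<lambda>i. \<Sum>j\<in>J. c j * y j i) \<in> coord_space {..<d}"
      using J(2) Q_coord by (auto simp: coord_space_def intro!: sum.neutral dest!: subsetD)
    moreover have "slack d h (\<lambda>i. \<Sum>j\<in>J. c j * y j i) = 0" if "h \<in> E" for h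
      unfolding slack_combination[OF J(1)] using that J(2) by (intro sum.neutral) (auto simp: E_def)
    ultimately show ?thesis by (simp add: A_def)
  qed
  have "0 \<le> slack d h (\<lambda>i. \<Sum>j\<in>J. c j * y j i)" if h: "h \<in> G" for h
  proof -
    have "\<not> describes (G - {h})" using G(2)[of "G - {h}"] card_Diff1_less[OF fG h] by linarith
    then obtain w where w: "w \<in> A" "\<forall>g\<in>G - {h}. 0 \<le> slack d g w" "slack d h w < 0"
    proof -
      have "G - {h} \<subseteq> H" "Q \<subseteq> {y \<in> A. \<forall>g\<in>G - {h}. 0 \<le> slack d g y}" using GH Qd by blast+
      then obtain w where "w \<in> A" "\<forall>g\<in>G - {h}. 0 \<le> slack d g w" "w \<notin> Q"
        using \<open>\<not> describes (G - {h})\<close> unfolding describes_def by blast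
      moreover have "slack d h w < 0"
      proof (rule ccontr)
        assume "\<not> slack d h w < 0"
        then have "\<forall>g\<in>G. 0 \<le> slack d g w"
          using \<open>\<forall>g\<in>G - {h}. 0 \<le> slack d g w\<close> by (metis DiffI not_less singletonD)
        then show False using Qd \<open>w \<in> A\<close> \<open>w \<notin> Q\<close> by blast
      qed
      ultimately show ?thesis using that by blast
    qed
    have x0pos: "0 < slack d g x0" if g: "g \<in> G" "g \<notin> E" for g
    proof -
      obtain v where "v \<in> Q" "slack d g v \<noteq> 0" using g GH by (auto simp: E_def)
      moreover have "0 \<le> slack d g v" using g(1) Qd \<open>v \<in> Q\<close> by blast
      ultimately have "0 < slack d g v" by simp
      then show ?thesis using x0(2) \<open>v \<in> Q\<close> g(1) GH by blast
    qed
    have "h \<notin> E" using w by (auto simp: A_def)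
    then have hx0: "0 < slack d h x0" using x0pos h by blast
    \<comment> \<open>The parameter at which the segment from \<open>x0\<close> to \<open>w\<close>
      meets the hyperplane of \<open>h\<close>. At that point the other inequalities of
      \<open>G\<close> outside \<open>E\<close> are strict, being strict at \<open>x0\<close> and
      valid at \<open>w\<close>.\<close>
    define \<theta> where "\<theta> = slack d h x0 / (slack d h x0 - slack d h w)"
    have \<theta>: "0 < \<theta>" "\<theta> < 1" using hx0 w(3) by (auto simp: \<theta>_def divide_less_eq)
    define z where "z = (1 - \<theta>) *\<^sub>R x0 + \<theta> *\<^sub>R w"
    have slz: "slack d g z = (1 - \<theta>) * slack d g x0 + \<theta> * slack d g w" for g
      unfolding z_def by (rule slack_segment)
    have "slack d h x0 - slack d h w \<noteq> 0" using hx0 w(3) by simp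
    then have zh: "slack d h z = 0" unfolding slz \<theta>_def by (simp add: field_simps)
    have zpos: "0 < slack d g z" if "g \<in> G" "g \<notin> E" "g \<noteq> h" for g
    proof -
      have "0 < (1 - \<theta>) * slack d g x0" using x0pos that \<theta> by simp
      moreover have "0 \<le> \<theta> * slack d g w" using w(2) that \<theta> by simp
      ultimately show ?thesis unfolding slz by linarith
    qed
    have x0A: "x0 \<in> A" using x0(1) QA by blast
    have zA: "z \<in> A"
    proof -
      have "z \<in> coord_space {..<d}"
        using x0A w(1) by (auto simp: A_def z_def coord_space_def scaleR_fun_def)
      moreover have "slack d g z = 0" if "g \<in> E" for g
        using that x0A w(1) unfolding slz by (auto simp: A_def)
      ultimately show ?thesis by (simp add: A_def)
    qed
    have Epos: "0 \<le> slack d g v" if "g \<in> E" "v \<in> A" for g v using that by (auto simp: A_def)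
    have zQ: "z \<in> Q"
    proof -
      have "0 \<le> slack d g z" if "g \<in> G" for g
        using zpos[OF that] Epos[OF _ zA, of g] zh by (cases "g \<in> E"; cases "g = h") auto
      then show ?thesis using zA Qd by blast
    qed
    have nb: "\<exists>\<epsilon>>0. tilt z \<epsilon> x (slack d h x / slack d h y) y \<in> Q"
      if xy: "x \<in> Q" "y \<in> Q" "0 < slack d h y" for x y
    proof -
      define r where "r = slack d h x / slack d h y"
      define dir where "dir g = slack d g x - slack d g z - r * (slack d g y - slack d g z)" for g
      let ?G = "{g \<in> G. g \<notin> E \<and> g \<noteq> h}"
      \<comment> \<open>Along the tilt the inequalities in \<open>E\<close> stay 0 and
        \<open>h\<close> stays tight by the choice of \<open>r\<close>; the remaining ones are
        strict at \<open>z\<close> and survive a small step.\<close>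
      obtain \<epsilon> where \<epsilon>: "0 < \<epsilon>" "\<forall>g\<in>?G. \<epsilon> * (- dir g) \<le> slack d g z"
        using exists_small_step[of ?G "\<lambda>g. slack d g z" "\<lambda>g. - dir g"] fG zpos by auto
      define v where "v = tilt z \<epsilon> x r y"
      have slv: "slack d g v = slack d g z + \<epsilon> * dir g" for g
        unfolding v_def dir_def by (rule slack_comb)
      have xyA: "x \<in> A" "y \<in> A" using xy QA by auto
      have "v \<in> coord_space {..<d}" using xyA zA by (auto simp: A_def v_def coord_space_def)
      moreover have "slack d g v = 0" if "g \<in> E" for g
        using that xyA zA unfolding slv dir_def by (auto simp: A_def)
      ultimately have vA: "v \<in> A" by (simp add: A_def)
      have "0 \<le> slack d g v" if g: "g \<in> G" for g
      proof -
        consider "g \<in> E" | "g = h" | "g \<in> ?G" using g by blast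
        then show ?thesis
        proof cases
          case 1
          then show ?thesis using Epos vA by blast
        next
          case 2
          then show ?thesis using zh xy(3) unfolding slv dir_def r_def by simp
        next
          case 3
          then have "\<epsilon> * (- dir g) \<le> slack d g z" using \<epsilon>(2) by blast
          then show ?thesis unfolding slv by simp
        qed
      qed
      then have "v \<in> Q" using vA Qd by blast
      then show ?thesis using \<epsilon>(1) unfolding v_def r_def by blast
    qed
    obtain k where k: "0 < k" "(\<lambda>y. if y \<in> Q then slack d h y / k else 0) \<in> slack_functions d Q"
      using slack_normalized[OF _ zQ zh x0(1) hx0 nb] h GH by blast
    have "0 \<le> (\<Sum>j\<in>J. c j * (if y j \<in> Q then slack d h (y j) / k else 0))" by (rule nonneg[OF k(2)])
    also have "\<dots> = (\<Sum>j\<in>J. c j * slack d h (y j)) / k"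
      using J(2) by (simp add: sum_divide_distrib cong: sum.cong)
    finally show ?thesis
      unfolding slack_combination[OF J(1)] using k(1) by (simp add: zero_le_divide_iff)
  qed
  then show ?thesis using comb_A Qd by blast
qed

end

lemma polyhedron_in_description:
  assumes "polyhedron_in d Q"
  shows "\<exists>H. polyhedron_description d H Q"
proof -
  obtain H where H: "finite H" "Q = {y \<in> coord_space {..<d}. \<forall>(a, b)\<in>H. (\<Sum>i<d. a i * y i) \<le> b}"
    using assms by (auto simp: polyhedron_in_def)
  have "(\<forall>(a, b)\<in>H. (\<Sum>i<d. a i * y i) \<le> b) \<longleftrightarrow> (\<forall>h\<in>H. 0 \<le> slack d h y)" for y
    by (auto simp: slack_def sum_negf)
  then have "polyhedron_description d H Q" using H by unfold_locales auto
  then show ?thesis by blast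
qed

section \<open>Isometries of the polyhedron act on its slack functions\<close>

definition pullback :: "(nat \<Rightarrow> real) set \<Rightarrow> ((nat \<Rightarrow> real) \<Rightarrow> nat \<Rightarrow> real) \<Rightarrow> ((nat \<Rightarrow> real) \<Rightarrow> real) \<Rightarrow> (nat \<Rightarrow> real) \<Rightarrow> real"
  where "pullback Q \<kappa> s = (\<lambda>y. if y \<in> Q then s (\<kappa> y) else 0)"

lemma affine_isometries_comb:
  assumes "\<kappa> \<in> affine_isometries d" 
  shows "\<kappa> (tilt z e x r y) =
    (\<lambda>i. \<kappa> z i + e * (\<kappa> x i - \<kappa> z i - r * (\<kappa> y i - \<kappa> z i)))"
proof -
  obtain U u where \<kappa>: "\<kappa> = affine_map {..<d} {..<d} U u"
    using assms by (auto simp: affine_isometries_def)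
  show ?thesis using functional_comb[where d = d] by (auto simp: \<kappa> affine_map_def fun_eq_iff)
qed

lemma affine_isometries_functional:
  assumes "\<kappa> \<in> affine_isometries d"
  shows "\<exists>a' b'. \<forall>y. (\<Sum>i<d. a i * \<kappa> y i) + b = (\<Sum>i<d. a' i * y i) + b'"
proof -
  obtain U u where \<kappa>: "\<kappa> = affine_map {..<d} {..<d} U u"
    using assms by (auto simp: affine_isometries_def)
  have "(\<Sum>i<d. a i * \<kappa> y i) = (\<Sum>j<d. (\<Sum>i<d. a i * U i j) * y j) + (\<Sum>i<d. a i * u i)" for y
  proof -
    have "(\<Sum>i<d. a i * \<kappa> y i) = (\<Sum>i<d. \<Sum>j<d. a i * U i j * y j) + (\<Sum>i<d. a i * u i)"
      by (simp add: \<kappa> affine_map_def distrib_left sum.distrib sum_distrib_left mult.assoc)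
    also have "(\<Sum>i<d. \<Sum>j<d. a i * U i j * y j) = (\<Sum>j<d. (\<Sum>i<d. a i * U i j) * y j)"
      by (subst sum.swap) (simp add: sum_distrib_right)
    finally show ?thesis .
  qed
  then have "\<forall>y. (\<Sum>i<d. a i * \<kappa> y i) + b = (\<Sum>j<d. (\<Sum>i<d. a i * U i j) * y j) + ((\<Sum>i<d. a i * u i) + b)"
    by simp
  then show ?thesis by (intro exI[of _ "\<lambda>j. \<Sum>i<d. a i * U i j"] exI[of _ "(\<Sum>i<d. a i * u i) + b"])
qed

text \<open>An isometry preserves Lipschitz constants, hence the normalisation, and it commutes with
  tilting because it is affine. The witnesses \<open>z\<close> and \<open>y0\<close> are replaced by
  preimages.\<close>

lemma pullback_slack_function:
  assumes \<kappa>: "\<kappa> \<in> affine_isometries d" "\<kappa> ` Q = Q" and Q: "Q \<subseteq> coord_space {..<d}"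
    and s: "s \<in> slack_functions d Q"
  shows "pullback Q \<kappa> s \<in> slack_functions d Q"
proof -
  obtain a b z y0 where "slack_function d Q s a b z y0" using s by (auto simp: slack_functions_def)
  then interpret slack_function d Q s a b z y0 .
  have \<kappa>Q: "\<kappa> y \<in> Q" if "y \<in> Q" for y using \<kappa>(2) that by blast
  have surj: "\<exists>x\<in>Q. y = \<kappa> x" if "y \<in> Q" for y using \<kappa>(2) that by blast
  have p: "pullback Q \<kappa> s y = s (\<kappa> y)" if "y \<in> Q" for y using that by (simp add: pullback_def)
  obtain z' where z': "z' \<in> Q" "z = \<kappa> z'" using surj z(1) by blast
  obtain y0' where y0': "y0' \<in> Q" "y0 = \<kappa> y0'" using surj y0(1) by blast
  obtain a' b' where ab: "\<forall>y. (\<Sum>i<d. a i * \<kappa> y i) + b = (\<Sum>i<d. a' i * y i) + b'"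
    using affine_isometries_functional[OF \<kappa>(1)] by blast
  have "slack_function d Q (pullback Q \<kappa> s) a' b' z' y0'"
  proof
    show "pullback Q \<kappa> s y = 0" if "y \<notin> Q" for y using that by (simp add: pullback_def)
    show "pullback Q \<kappa> s y = (\<Sum>i<d. a' i * y i) + b'" if "y \<in> Q" for y
      using that aff[OF \<kappa>Q] p ab by simp
    show "0 \<le> pullback Q \<kappa> s y" if "y \<in> Q" for y using that nn \<kappa>Q p by simp
    show "z' \<in> Q" "pullback Q \<kappa> s z' = 0" "y0' \<in> Q" "0 < pullback Q \<kappa> s y0'"
      using z(2) z' y0(2) y0' p by auto
    show "\<exists>\<epsilon>>0. tilt z' \<epsilon> x (pullback Q \<kappa> s x / pullback Q \<kappa> s y) y \<in> Q"
      if xy: "x \<in> Q" "y \<in> Q" "0 < pullback Q \<kappa> s y" for x y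
    proof -
      define r where "r = s (\<kappa> x) / s (\<kappa> y)"
      have "0 < s (\<kappa> y)" using xy p by simp
      then obtain \<epsilon> where \<epsilon>: "0 < \<epsilon>" "tilt z \<epsilon> (\<kappa> x) r (\<kappa> y) \<in> Q"
        using nb[OF \<kappa>Q[OF xy(1)] \<kappa>Q[OF xy(2)]] unfolding r_def by blast
      define w where "w = tilt z' \<epsilon> x r y"
      have "\<kappa> w = tilt z \<epsilon> (\<kappa> x) r (\<kappa> y)"
        unfolding w_def z'(2) by (rule affine_isometries_comb[OF \<kappa>(1)])
      then obtain q where q: "q \<in> Q" "\<kappa> w = \<kappa> q" using \<epsilon>(2) surj by metis
      have "x \<in> coord_space {..<d}" "y \<in> coord_space {..<d}" "z' \<in> coord_space {..<d}" using xy z' Q by auto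
      then have "w \<in> coord_space {..<d}" by (simp add: w_def coord_space_def)
      \<comment> \<open>Membership of \<open>w\<close> in \<open>Q\<close> is not yet known, so
        injectivity on all of \<open>coord_space\<close> is needed to identify it with the preimage
        \<open>q\<close>.\<close>
      then have "w = q" using affine_isometries_inj_on[OF \<kappa>(1)] q Q by (auto dest: inj_onD)
      then show ?thesis using \<epsilon>(1) q(1) xy p unfolding w_def r_def by auto
    qed
    show "\<bar>pullback Q \<kappa> s x - pullback Q \<kappa> s y\<bar> \<le> dist2 d x y" if "x \<in> Q" "y \<in> Q" for x y
      using lip[OF \<kappa>Q \<kappa>Q] that p dist2_isometry[OF \<kappa>(1)] by metis
    show "1 \<le> L" if L: "\<And>x y. x \<in> Q \<Longrightarrow> y \<in> Q \<Longrightarrow> \<bar>pullback Q \<kappa> s x - pullback Q \<kappa> s y\<bar> \<le> L * dist2 d x y" for L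
    proof (rule lip_ge)
      fix x y assume "x \<in> Q" "y \<in> Q"
      then obtain x' y' where "x' \<in> Q" "x = \<kappa> x'" "y' \<in> Q" "y = \<kappa> y'" using surj by metis
      then show "\<bar>s x - s y\<bar> \<le> L * dist2 d x y" using L p dist2_isometry[OF \<kappa>(1)] by metis
    qed
  qed
  then show ?thesis by (auto simp: slack_functions_def)
qed

text \<open>What is kept of a symmetric extension once \<open>Q\<close> is forgotten.
  \<open>\<pi>\<close> describes the action of \<open>g\<close> on the index set \<open>X\<close> of
  the points \<open>v x\<close>, and \<open>membership\<close> makes nonnegativity on the family a
  certificate that an affine combination of these points lies in \<open>P\<close>.\<close>

locale slack_family =
  fixes G :: "(('i \<Rightarrow> real) \<Rightarrow> 'i \<Rightarrow> real) set" and v :: "'x \<Rightarrow> 'i \<Rightarrow> real"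
    and X :: "'x set" and P :: "('i \<Rightarrow> real) set" and \<Phi> :: "('x \<Rightarrow> real) set"
  assumes finite_family: "finite \<Phi>"
    and nonneg: "\<phi> \<in> \<Phi> \<Longrightarrow> x \<in> X \<Longrightarrow> 0 \<le> \<phi> x"
    and equivariant: "g \<in> G \<Longrightarrow> \<forall>x\<in>X. \<pi> x \<in> X \<and> g (v x) = v (\<pi> x) \<Longrightarrow> \<phi> \<in> \<Phi> \<Longrightarrow>
      \<exists>\<phi>'\<in>\<Phi>. \<forall>x\<in>X. \<phi> (\<pi> x) = \<phi>' x"
    and membership: "(\<Sum>x\<in>X. c x) = 1 \<Longrightarrow> \<forall>\<phi>\<in>\<Phi>. 0 \<le> (\<Sum>x\<in>X. c x * \<phi> x) \<Longrightarrow>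
      (\<lambda>i. \<Sum>x\<in>X. c x * v x i) \<in> P"

text \<open>
  The value of \<open>\<phi>\<close> at a vertex \<open>x\<close> is the value of a slack function at an average of points in the
  fibre over \<open>x\<close>. To get by with finitely many points although \<open>Q\<close> may have infinitely many isometries,
  one point is used for each vector of slack values that occurs in the orbit of a chosen section.
\<close>

theorem symmetric_extension_slack_family:
  fixes v :: "'x \<Rightarrow> 'i \<Rightarrow> real" and G :: "(('i \<Rightarrow> real) \<Rightarrow> 'i \<Rightarrow> real) set"
  assumes ext: "is_extension d Q p I P" and sym: "symmetric_extension G d Q p"
    and X: "finite X" "v ` X \<subseteq> P" and inj: "\<forall>g\<in>G. inj g"
  shows "\<exists>\<Phi>. card \<Phi> \<le> extension_size Q \<and> slack_family G v X P \<Phi>"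
proof -
  have poly: "polyhedron_in d Q" and pmap: "p \<in> affine_maps {..<d} I" and pQ: "p ` Q = P"
    using ext by (auto simp: is_extension_def)
  obtain H where "polyhedron_description d H Q" using polyhedron_in_description[OF poly] by blast
  then interpret polyhedron_description d H Q .
  obtain A b where p: "p = affine_map {..<d} I A b" using pmap by (auto simp: affine_maps_def)
  define S where "S = slack_functions d Q"
  have fS: "finite S" unfolding S_def by (rule slack_functions_finite)
  have snn: "0 \<le> s y" if "s \<in> S" "y \<in> Q" for s y
    using that slack_function.nn by (fastforce simp: S_def slack_functions_def)
  have sout: "s y = 0" if "s \<in> S" "y \<notin> Q" for s y
    using that slack_function.out by (fastforce simp: S_def slack_functions_def)
  \<comment> \<open>These maps need not be affine, so the inverse on \<open>Q\<close> of an
    isometry, taken by \<open>inv_into\<close>, belongs to \<open>K\<close> as well.\<close>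
  define K where "K = {\<kappa>. \<kappa> ` Q = Q \<and> pullback Q \<kappa> ` S \<subseteq> S}"
  have "\<exists>y\<in>Q. p y = v x" if "x \<in> X" for x
  proof -
    have "v x \<in> p ` Q" using X(2) pQ that by blast
    then show ?thesis by (metis imageE)
  qed
  then obtain y0 where y0: "\<And>x. x \<in> X \<Longrightarrow> y0 x \<in> Q" "\<And>x. x \<in> X \<Longrightarrow> p (y0 x) = v x" by metis
  define Y where "Y x = {\<kappa> (y0 x') |\<kappa> x'. \<kappa> \<in> K \<and> x' \<in> X \<and> p (\<kappa> (y0 x')) = v x}" for x
  define vec where "vec y = (\<lambda>s. if s \<in> S then s y else 0)" for y :: "nat \<Rightarrow> real"
  define V where "V x = vec ` Y x" for x
  have YQ: "Y x \<subseteq> Q" for x using y0(1) by (auto simp: Y_def K_def)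
  have Yp: "p y = v x" if "y \<in> Y x" for x y using that by (auto simp: Y_def)
  have fV: "finite (V x)" for x
  proof (rule finite_subset)
    \<comment> \<open>The value of \<open>s\<close> at \<open>\<kappa> (y0 x')\<close> is the value
      of another member of \<open>S\<close> at \<open>y0 x'\<close>, so only finitely many numbers
      occur as coordinates.\<close>
    let ?B = "(\<lambda>(s, x'). s (y0 x')) ` (S \<times> X)"
    show "V x \<subseteq> {f. \<forall>s. (s \<in> S \<longrightarrow> f s \<in> ?B) \<and> (s \<notin> S \<longrightarrow> f s = 0)}"
    proof
      fix f assume "f \<in> V x"
      then obtain \<kappa> x' where \<kappa>: "\<kappa> \<in> K" "x' \<in> X" "f = vec (\<kappa> (y0 x'))" by (auto simp: V_def Y_def)
      have "f s \<in> ?B" if "s \<in> S" for s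
      proof -
        have "pullback Q \<kappa> s \<in> S" using \<kappa>(1) that by (auto simp: K_def)
        moreover have "f s = pullback Q \<kappa> s (y0 x')"
          using \<kappa> that y0(1) by (simp add: vec_def pullback_def)
        ultimately show ?thesis using \<kappa>(2) by force
      qed
      then show "f \<in> {f. \<forall>s. (s \<in> S \<longrightarrow> f s \<in> ?B) \<and> (s \<notin> S \<longrightarrow> f s = 0)}"
        using \<kappa>(3) by (auto simp: vec_def)
    qed
    show "finite {f. \<forall>s. (s \<in> S \<longrightarrow> f s \<in> ?B) \<and> (s \<notin> S \<longrightarrow> f s = 0)}"
      by (rule finite_set_of_finite_funs) (use fS X in auto)
  qed
  have idK: "id \<in> K"
  proof -
    have "pullback Q id s = s" if "s \<in> S" for s using sout[OF that] by (auto simp: pullback_def)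
    then show ?thesis by (auto simp: K_def)
  qed
  have V_ne: "V x \<noteq> {}" if "x \<in> X" for x
  proof -
    have "id (y0 x) \<in> Y x"
      unfolding Y_def using that idK y0(2) by (intro CollectI exI[of _ id] exI[of _ x]) simp
    then show ?thesis by (auto simp: V_def)
  qed
  define \<phi> where "\<phi> s x = (\<Sum>w\<in>V x. w s) / real (card (V x))" for s x
  have K_comp: "\<kappa> \<circ> \<kappa>' \<in> K" if "\<kappa> \<in> K" "\<kappa>' \<in> K" for \<kappa> \<kappa>'
  proof -
    have img: "(\<kappa> \<circ> \<kappa>') ` Q = Q" using that unfolding image_comp[symmetric] by (simp add: K_def)
    have "pullback Q (\<kappa> \<circ> \<kappa>') s = pullback Q \<kappa>' (pullback Q \<kappa> s)" for s
      using that by (auto simp: pullback_def K_def fun_eq_iff)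
    moreover have "pullback Q \<kappa>' (pullback Q \<kappa> s) \<in> S" if "s \<in> S" for s
      using \<open>\<kappa> \<in> K\<close> \<open>\<kappa>' \<in> K\<close> that by (simp add: K_def image_subset_iff)
    ultimately show ?thesis using img by (simp add: K_def image_subset_iff)
  qed
  have equivariant: "\<phi> s (\<pi> x) = \<phi> (pullback Q \<kappa> s) x"
    if g: "g \<in> G" "\<And>x. x \<in> X \<Longrightarrow> \<pi> x \<in> X \<and> g (v x) = v (\<pi> x)"
      and \<kappa>: "\<kappa> \<in> affine_isometries d" "\<kappa> ` Q = Q" "\<And>y. y \<in> Q \<Longrightarrow> p (\<kappa> y) = g (p y)"
      and x: "x \<in> X" and s: "s \<in> S" for g \<pi> \<kappa> x s
  proof -
    have pb: "pullback Q \<kappa> ` S \<subseteq> S"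
      using pullback_slack_function[OF \<kappa>(1,2) Q_coord] by (auto simp: S_def)
    have \<kappa>K: "\<kappa> \<in> K" using \<kappa>(2) pb by (simp add: K_def)
    have inj\<kappa>: "inj_on \<kappa> Q" by (rule inj_on_subset[OF affine_isometries_inj_on[OF \<kappa>(1)] Q_coord])
    have "inj_on (pullback Q \<kappa>) S"
    proof (rule inj_onI)
      fix s s' assume ss: "s \<in> S" "s' \<in> S" "pullback Q \<kappa> s = pullback Q \<kappa> s'"
      show "s = s'"
      proof
        fix y
        show "s y = s' y"
        proof (cases "y \<in> Q")
          case True
          then obtain y' where "y' \<in> Q" "y = \<kappa> y'" using \<kappa>(2) by blast
          then show ?thesis using fun_cong[OF ss(3), of y'] by (simp add: pullback_def)
        qed (use sout[OF ss(1)] sout[OF ss(2)] in simp)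
      qed
    qed
    then have pb_eq: "pullback Q \<kappa> ` S = S" by (rule endo_inj_surj[OF fS pb])
    \<comment> \<open>\<open>T\<close> rearranges the coordinates of a value vector the way
      \<open>\<kappa>\<close> acts on \<open>S\<close>; it therefore carries \<open>V x\<close>
      bijectively to \<open>V (\<pi> x)\<close>, and the averages agree.\<close>
    define T where "T w = (\<lambda>s. if s \<in> S then w (pullback Q \<kappa> s) else 0)" for w :: "((nat \<Rightarrow> real) \<Rightarrow> real) \<Rightarrow> real"
    have T_vec: "T (vec y) = vec (\<kappa> y)" if "y \<in> Q" for y
      using that pb by (auto simp: T_def vec_def pullback_def fun_eq_iff)
    have "inj_on T (V x)"
    proof (rule inj_onI)
      fix w w' assume w: "w \<in> V x" "w' \<in> V x" "T w = T w'"
      show "w = w'"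
      proof
        fix s
        show "w s = w' s"
        proof (cases "s \<in> S")
          case True
          then obtain s' where "s' \<in> S" "s = pullback Q \<kappa> s'" using pb_eq by blast
          then show ?thesis using fun_cong[OF w(3), of s'] by (simp add: T_def)
        qed (use w in \<open>auto simp: V_def vec_def\<close>)
      qed
    qed
    moreover have "T ` V x = V (\<pi> x)"
    proof
      show "T ` V x \<subseteq> V (\<pi> x)"
      proof
        fix w assume "w \<in> T ` V x"
        then obtain y where y: "y \<in> Y x" "w = T (vec y)" by (auto simp: V_def)
        then obtain \<kappa>' x' where \<kappa>': "\<kappa>' \<in> K" "x' \<in> X" "y = \<kappa>' (y0 x')" by (auto simp: Y_def)
        have yQ: "y \<in> Q" using y(1) YQ by blast
        have "p ((\<kappa> \<circ> \<kappa>') (y0 x')) = v (\<pi> x)" using \<kappa>(3)[OF yQ] Yp[OF y(1)] g(2)[OF x] \<kappa>'(3) by simp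
        then have "(\<kappa> \<circ> \<kappa>') (y0 x') \<in> Y (\<pi> x)" unfolding Y_def using K_comp[OF \<kappa>K \<kappa>'(1)] \<kappa>'(2)
            by (intro CollectI exI[of _ "\<kappa> \<circ> \<kappa>'"] exI[of _ x']) simp
        then show "w \<in> V (\<pi> x)" using y(2) T_vec[OF yQ] \<kappa>'(3) by (auto simp: V_def)
      qed
      show "V (\<pi> x) \<subseteq> T ` V x"
      proof
        fix w assume "w \<in> V (\<pi> x)"
        then obtain y where y: "y \<in> Y (\<pi> x)" "w = vec y" by (auto simp: V_def)
        then obtain \<kappa>' x' where \<kappa>': "\<kappa>' \<in> K" "x' \<in> X" "y = \<kappa>' (y0 x')" by (auto simp: Y_def)
        define \<kappa>i where "\<kappa>i = inv_into Q \<kappa>"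
        have \<kappa>i: "\<kappa>i y \<in> Q" "\<kappa> (\<kappa>i y) = y" if "y \<in> Q" for y
          using that \<kappa>(2) by (auto simp: \<kappa>i_def inv_into_into f_inv_into_f)
        have \<kappa>i': "\<kappa>i (\<kappa> y) = y" if "y \<in> Q" for y using that inj\<kappa> by (simp add: \<kappa>i_def)
        have "\<kappa>i \<in> K"
        proof -
          have "\<kappa>i ` Q = Q"
            using \<kappa>i \<kappa>i' \<kappa>(2) by (metis \<kappa>i_def image_inv_into_cancel inj\<kappa> inv_into_image_cancel subset_refl)
          moreover have "pullback Q \<kappa>i s \<in> S" if "s \<in> S" for s
          proof -
            have "s \<in> pullback Q \<kappa> ` S" unfolding pb_eq by (rule that)
            then obtain s' where s': "s' \<in> S" "s = pullback Q \<kappa> s'" by blast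
            have "pullback Q \<kappa>i s y = s' y" for y
              using s'(2) \<kappa>i[of y] sout[OF s'(1), of y] by (simp add: pullback_def)
            then have "pullback Q \<kappa>i s = s'" by blast
            then show ?thesis using s' by simp
          qed
          ultimately show ?thesis by (simp add: K_def image_subset_iff)
        qed
        have yQ: "y \<in> Q" using y(1) YQ by blast
        have "g (p (\<kappa>i y)) = g (v x)"
          using \<kappa>(3)[OF \<kappa>i(1)[OF yQ]] \<kappa>i(2)[OF yQ] Yp[OF y(1)] g(2)[OF x] by simp
        then have "p (\<kappa>i y) = v x" using bspec[OF inj g(1)] by (auto dest: injD)
        then have "(\<kappa>i \<circ> \<kappa>') (y0 x') \<in> Y x" unfolding Y_def using K_comp[OF \<open>\<kappa>i \<in> K\<close> \<kappa>'(1)] \<kappa>'(2,3)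
            by (intro CollectI exI[of _ "\<kappa>i \<circ> \<kappa>'"] exI[of _ x']) simp
        then have "vec (\<kappa>i y) \<in> V x" using \<kappa>'(3) by (simp add: V_def)
        moreover have "T (vec (\<kappa>i y)) = w" using T_vec[OF \<kappa>i(1)[OF yQ]] \<kappa>i(2)[OF yQ] y(2) by simp
        ultimately show "w \<in> T ` V x" by blast
      qed
    qed
    ultimately have bij: "bij_betw T (V x) (V (\<pi> x))" by (simp add: bij_betw_def)
    have "(\<Sum>w\<in>V (\<pi> x). w s) = (\<Sum>w\<in>V x. T w s)"
      using sum.reindex_bij_betw[OF bij, of "\<lambda>w. w s"] by simp
    also have "\<dots> = (\<Sum>w\<in>V x. w (pullback Q \<kappa> s))" using s by (simp add: T_def)
    finally show ?thesis using bij_betw_same_card[OF bij] by (simp add: \<phi>_def)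
  qed
  have \<phi>nn: "0 \<le> \<phi> s x" if "s \<in> S" for s x
  proof -
    have "0 \<le> w s" if w: "w \<in> V x" for w
    proof -
      obtain y where "y \<in> Y x" "w = vec y" using w by (auto simp: V_def)
      then show ?thesis using snn[OF \<open>s \<in> S\<close>, of y] YQ[of x] \<open>s \<in> S\<close> by (auto simp: vec_def)
    qed
    then show ?thesis unfolding \<phi>_def by (intro divide_nonneg_nonneg sum_nonneg) auto
  qed
  have membership: "(\<lambda>i. \<Sum>x\<in>X. c x * v x i) \<in> P"
    if c: "(\<Sum>x\<in>X. c x) = 1" "\<And>s. s \<in> S \<Longrightarrow> 0 \<le> (\<Sum>x\<in>X. c x * \<phi> s x)" for c
  proof -
    let ?J = "Sigma X V"
    define y where "y = (\<lambda>(x, w). SOME y. y \<in> Y x \<and> vec y = w)"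
    have y: "y (x, w) \<in> Y x" "vec (y (x, w)) = w" if "w \<in> V x" for x w
      using that someI_ex[of "\<lambda>y. y \<in> Y x \<and> vec y = w"] unfolding y_def V_def by auto
    \<comment> \<open>The weight of \<open>x\<close> is shared equally among one chosen point for
      each value vector over \<open>x\<close>, which reproduces \<open>\<phi> s x\<close> for every
      \<open>s\<close> at once.\<close>
    define c' where "c' = (\<lambda>(x, w :: ((nat \<Rightarrow> real) \<Rightarrow> real) \<Rightarrow> real). c x / real (card (V x)))"
    have sumJ: "(\<Sum>j\<in>?J. c' j * f j) = (\<Sum>x\<in>X. c x * ((\<Sum>w\<in>V x. f (x, w)) / real (card (V x))))" for f
    proof -
      have "(\<Sum>j\<in>?J. c' j * f j) = (\<Sum>x\<in>X. \<Sum>w\<in>V x. c' (x, w) * f (x, w))"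
        using sum.Sigma[of X V "\<lambda>x w. c' (x, w) * f (x, w)"] X(1) fV by (simp add: case_prod_beta)
      then show ?thesis by (simp add: c'_def sum_distrib_left sum_divide_distrib)
    qed
    have avg: "(\<Sum>w\<in>V x. k) / real (card (V x)) = k" if "x \<in> X" for x and k :: real
      using V_ne[OF that] fV[of x] by simp
    have one: "(\<Sum>j\<in>?J. c' j) = 1" using sumJ[of "\<lambda>_. 1"] avg c(1) by (simp cong: sum.cong)
    have "(\<lambda>i. \<Sum>j\<in>?J. c' j * y j i) \<in> Q"
    proof (rule combination_mem_if_slack_functions_nonneg[OF one])
      fix j assume "j \<in> ?J"
      then show "y j \<in> Q" using y YQ by force
    next
      fix s assume s: "s \<in> slack_functions d Q"
      have "(\<Sum>j\<in>?J. c' j * s (y j)) = (\<Sum>x\<in>X. c x * ((\<Sum>w\<in>V x. s (y (x, w))) / real (card (V x))))"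
        by (rule sumJ)
      also have "\<dots> = (\<Sum>x\<in>X. c x * \<phi> s x)"
      proof (rule sum.cong)
        fix x assume "x \<in> X"
        have "s (y (x, w)) = w s" if "w \<in> V x" for w
          using fun_cong[OF y(2)[OF that], of s] s by (simp add: vec_def S_def)
        then show "c x * ((\<Sum>w\<in>V x. s (y (x, w))) / real (card (V x))) = c x * \<phi> s x"
          by (simp add: \<phi>_def)
      qed simp
      finally show "0 \<le> (\<Sum>j\<in>?J. c' j * s (y j))" using c(2) s by (simp add: S_def)
    qed
    then have "p (\<lambda>i. \<Sum>j\<in>?J. c' j * y j i) \<in> P" using pQ by blast
    also have "p (\<lambda>i. \<Sum>j\<in>?J. c' j * y j i) = (\<lambda>i. \<Sum>j\<in>?J. c' j * p (y j) i)"
      unfolding p by (rule affine_map_combination[OF one])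
    also have "\<dots> = (\<lambda>i. \<Sum>x\<in>X. c x * v x i)"
    proof
      fix i
      have "(\<Sum>j\<in>?J. c' j * p (y j) i) = (\<Sum>x\<in>X. c x * ((\<Sum>w\<in>V x. p (y (x, w)) i) / real (card (V x))))"
        by (rule sumJ)
      also have "\<dots> = (\<Sum>x\<in>X. c x * v x i)"
      proof (rule sum.cong)
        fix x assume x: "x \<in> X"
        have "(\<Sum>w\<in>V x. p (y (x, w)) i) = (\<Sum>w\<in>V x. v x i)"
        proof (rule sum.cong)
          fix w assume "w \<in> V x"
          then show "p (y (x, w)) i = v x i" using Yp[OF y(1)] by metis
        qed simp
        then show "c x * ((\<Sum>w\<in>V x. p (y (x, w)) i) / real (card (V x))) = c x * v x i"
          using avg[OF x, of "v x i"] by simp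
      qed simp
      finally show "(\<Sum>j\<in>?J. c' j * p (y j) i) = (\<Sum>x\<in>X. c x * v x i)" .
    qed
    finally show ?thesis .
  qed
  have "slack_family G v X P (\<phi> ` S)"
  proof
    show "finite (\<phi> ` S)" using fS by simp
    show "0 \<le> \<psi> x" if "\<psi> \<in> \<phi> ` S" for \<psi> x using that \<phi>nn by auto
    show "(\<lambda>i. \<Sum>x\<in>X. c x * v x i) \<in> P"
      if "(\<Sum>x\<in>X. c x) = 1" "\<forall>\<psi>\<in>\<phi> ` S. 0 \<le> (\<Sum>x\<in>X. c x * \<psi> x)" for c
      using that by (intro membership) auto
    fix g \<pi> \<psi>
    assume g: "g \<in> G" "\<forall>x\<in>X. \<pi> x \<in> X \<and> g (v x) = v (\<pi> x)" and "\<psi> \<in> \<phi> ` S"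
    then obtain s where s: "s \<in> S" "\<psi> = \<phi> s" by blast
    obtain \<kappa> where \<kappa>: "\<kappa> \<in> affine_isometries d" "\<kappa> ` Q = Q" "\<forall>y\<in>Q. p (\<kappa> y) = g (p y)"
      using sym g(1) by (auto simp: symmetric_extension_def)
    have "\<forall>x\<in>X. \<psi> (\<pi> x) = \<phi> (pullback Q \<kappa> s) x" using equivariant[OF g(1)] g(2) \<kappa> s by simp
    moreover have "pullback Q \<kappa> s \<in> S"
      using pullback_slack_function[OF \<kappa>(1,2) Q_coord] s(1) by (simp add: S_def)
    ultimately show "\<exists>\<phi>'\<in>\<phi> ` S. \<forall>x\<in>X. \<psi> (\<pi> x) = \<phi>' x" by blast
  qed
  moreover have "card (\<phi> ` S) \<le> extension_size Q"
    using card_image_le[OF fS, of \<phi>] card_slack_functions by (simp add: S_def extension_size_def)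
  ultimately show ?thesis by blast
qed

subsection \<open>Subgroups of small index of the symmetric group\<close>

definition cyc3 :: "'a \<Rightarrow> 'a \<Rightarrow> 'a \<Rightarrow> 'a \<Rightarrow> 'a"
  where "cyc3 a b c x = (if x = a then b else if x = b then c else if x = c then a else x)"

lemma cyc3_rotate: "distinct [a, b, c] \<Longrightarrow> cyc3 a b c = cyc3 b c a"
  by (auto simp: fun_eq_iff cyc3_def)

lemma cyc3_comp_self: "distinct [a, b, c] \<Longrightarrow> cyc3 a b c \<circ> cyc3 a b c = cyc3 a c b"
  by (auto simp: fun_eq_iff cyc3_def)

lemma cyc3_conj:
  assumes "bij g"
  shows "g \<circ> cyc3 a b c \<circ> inv g = cyc3 (g a) (g b) (g c)"
proof
  fix x
  obtain y where y: "x = g y" using assms by (meson bij_pointE)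
  have "inj g" using assms by (simp add: bij_is_inj)
  then show "(g \<circ> cyc3 a b c \<circ> inv g) x = cyc3 (g a) (g b) (g c) x"
    by (auto simp: y cyc3_def inj_eq)
qed

lemma commutator_cyc3:
  assumes "bij x" "bij y" and meet: "\<And>p. x p \<noteq> p \<Longrightarrow> y p \<noteq> p \<Longrightarrow> p = q"
    and xq: "x q \<noteq> q" and yq: "y q \<noteq> q"
  shows "x \<circ> y \<circ> inv x \<circ> inv y = cyc3 q (x q) (y q)" "distinct [q, x q, y q]"
proof -
  have inj: "x a = x b \<longleftrightarrow> a = b" "y a = y b \<longleftrightarrow> a = b" for a b
    using assms(1,2) by (auto simp: bij_def inj_eq)
  have yxq: "y (x q) = x q" using meet[of "x q"] xq inj by metis
  have xyq: "x (y q) = y q" using meet[of "y q"] yq inj by metis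
  have ne: "x q \<noteq> y q" using xyq inj yq by metis
  show "distinct [q, x q, y q]" using ne xq yq by auto
  \<comment> \<open>The commutator identity multiplied on the right by \<open>y \<circ> x\<close>,
    which removes the inverses.\<close>
  have key: "x (y p) = cyc3 q (x q) (y q) (y (x p))" for p
  proof (cases "p = q")
    case True
    then show ?thesis using xyq yxq xq yq ne by (auto simp: cyc3_def)
  next
    case pq: False
    show ?thesis
    proof (cases "x p = p")
      case False
      then have "y p = p" using meet pq by blast
      moreover have "y (x p) = x p" if "x p \<noteq> q" using meet[of "x p"] that False inj by metis
      moreover have "x p \<noteq> x q" "x p \<noteq> y q"  using pq inj xyq \<open>y p = p\<close> by metis+
      ultimately show ?thesis using ne xq yq by (cases "x p = q") (auto simp: cyc3_def)
    next
      case True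
      have a: "p \<noteq> x q" using True inj xq by metis
      show ?thesis
      proof (cases "y p = q")
        case True
        then show ?thesis using \<open>x p = p\<close> by (simp add: cyc3_def)
      next
        case F: False
        have "x (y p) = y p" using meet[of "y p"] F inj True by metis
        moreover have "y p \<noteq> x q" "y p \<noteq> y q" using pq inj yxq a by metis+
        ultimately show ?thesis using True F by (simp add: cyc3_def)
      qed
    qed
  qed
  show "x \<circ> y \<circ> inv x \<circ> inv y = cyc3 q (x q) (y q)"
  proof
    fix p
    have "x (y (inv x (inv y p))) = cyc3 q (x q) (y q) (y (x (inv x (inv y p))))" by (rule key)
    then show "(x \<circ> y \<circ> inv x \<circ> inv y) p = cyc3 q (x q) (y q) p"
      using assms(1,2) by (simp add: bij_is_surj surj_f_inv_f)
  qed
qed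

text \<open>Index at most \<open>f\<close> is expressed by labels: permutations with equal labels
  lie in the same left coset of \<open>U\<close>, so there are no more left cosets than
  labels.\<close>

locale small_index_subgroup =
  fixes V :: "'a set" and U :: "('a \<Rightarrow> 'a) set" and label :: "('a \<Rightarrow> 'a) \<Rightarrow> 'c" and f :: nat
  assumes finite_V: "finite V"
    and U_permutes: "u \<in> U \<Longrightarrow> u permutes V"
    and U_comp: "u \<in> U \<Longrightarrow> v \<in> U \<Longrightarrow> u \<circ> v \<in> U"
    and U_inv: "u \<in> U \<Longrightarrow> inv u \<in> U"
    and label: "\<sigma> permutes V \<Longrightarrow> \<tau> permutes V \<Longrightarrow> label \<sigma> = label \<tau> \<Longrightarrow> inv \<sigma> \<circ> \<tau> \<in> U"
    and card_labels: "card (label ` {\<sigma>. \<sigma> permutes V}) \<le> f"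
begin

lemma U_bij: "u \<in> U \<Longrightarrow> bij u" using U_permutes permutes_bij by blast

text \<open>Pigeonhole: \<open>T\<close> has more permutations than there are labels, and two
  permutations with the same label differ by an element of \<open>U\<close>.\<close>

lemma exists_nontrivial:
  assumes "T \<subseteq> V" "f < fact (card T)"
  shows "\<exists>u\<in>U. u permutes T \<and> u \<noteq> id"
proof -
  let ?S = "{\<sigma>. \<sigma> permutes T}"
  have fT: "finite T" using assms(1) finite_V finite_subset by blast
  have sub: "?S \<subseteq> {\<sigma>. \<sigma> permutes V}" using assms(1) by (auto intro: permutes_subset)
  have "card (label ` ?S) \<le> card (label ` {\<sigma>. \<sigma> permutes V})"
    by (intro card_mono image_mono sub finite_imageI finite_permutations finite_V)
  also have "\<dots> < card ?S" using card_labels assms(2) fT by (simp add: card_permutations)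
  finally have "\<not> inj_on label ?S" using card_image nat_neq_iff by blast
  then obtain \<sigma> \<tau> where st: "\<sigma> permutes T" "\<tau> permutes T" "label \<sigma> = label \<tau>" "\<sigma> \<noteq> \<tau>"
    by (auto simp: inj_on_def)
  have "inv \<sigma> \<circ> \<tau> \<in> U" using label st sub by blast
  moreover have "inv \<sigma> \<circ> \<tau> permutes T" using st by (intro permutes_compose permutes_inv)
  moreover have "inv \<sigma> \<circ> \<tau> \<noteq> id"
  proof
    assume "inv \<sigma> \<circ> \<tau> = id"
    then have "\<sigma> \<circ> (inv \<sigma> \<circ> \<tau>) = \<sigma>" by simp
    then show False using st permutes_inv_o(1)[OF st(1)] by (simp add: comp_assoc[symmetric])
  qed
  ultimately show ?thesis by blast
qed

text \<open>This turns out to be an equivalence relation, and \<open>U\<close> contains every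
  3-cycle, hence the alternating group, of each class.\<close>

definition linked :: "'a \<Rightarrow> 'a \<Rightarrow> bool"
  where "linked a b \<longleftrightarrow> a = b \<or> (\<exists>c. distinct [a, b, c] \<and> cyc3 a b c \<in> U)"

lemma cyc3_inv: "distinct [a, b, c] \<Longrightarrow> cyc3 a b c \<in> U \<Longrightarrow> cyc3 a c b \<in> U"
  using U_comp cyc3_comp_self by metis

lemma linked_sym: "linked a b \<Longrightarrow> linked b a"
proof -
  assume "linked a b"
  moreover have "linked b a" if "distinct [a, b, c]" "cyc3 a b c \<in> U" for c
    using cyc3_inv[OF that] cyc3_rotate[of b a c] that
    unfolding linked_def by (metis cyc3_rotate distinct_length_2_or_more)
  ultimately show ?thesis unfolding linked_def by blast
qed

text \<open>The third points \<open>x\<close> and \<open>y\<close> of the given 3-cycles are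
  arbitrary. Unless one of these cycles already gives the claim, conjugating \<open>(a b x)\<close>
  by \<open>(b c y)\<close> sends \<open>b\<close> to \<open>c\<close>. For \<open>x = y\<close> the
  result is the inverse of the wanted 3-cycle; otherwise it is \<open>(a c x)\<close>, and
  conjugating this by \<open>(a b x)\<close> gives \<open>(b c a)\<close>.\<close>

lemma cyc3_mem_if_linked:
  assumes "linked a b" "linked b c" "distinct [a, b, c]"
  shows "cyc3 a b c \<in> U"
proof -
  obtain x where x: "distinct [a, b, x]" "cyc3 a b x \<in> U" using assms unfolding linked_def by auto
  obtain y where y: "distinct [b, c, y]" "cyc3 b c y \<in> U" using assms unfolding linked_def by auto
  have conj: "cyc3 (g p) (g q) (g r) \<in> U" if "g \<in> U" "cyc3 p q r \<in> U" for g p q r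
    using U_comp U_inv that cyc3_conj U_bij by metis
  consider "x = c" | "y = a" | "x \<noteq> c" "x = y" "y \<noteq> a" | "x \<noteq> c" "x \<noteq> y" "y \<noteq> a" by blast
  then show ?thesis
  proof cases
    case 1
    then show ?thesis using x by simp
  next
    case 2
    then show ?thesis using y assms(3) cyc3_rotate[of a b c] by auto
  next
    case 3
    have "cyc3 (cyc3 b c y a) (cyc3 b c y b) (cyc3 b c y x) \<in> U" by (rule conj[OF y(2) x(2)])
    then have "cyc3 a c b \<in> U"
      using 3 assms(3) x y by (auto simp: cyc3_def[of b c y] split: if_splits)
    then show ?thesis using cyc3_inv[of a c b] assms(3) by auto
  next
    case 4
    have "cyc3 (cyc3 b c y a) (cyc3 b c y b) (cyc3 b c y x) \<in> U" by (rule conj[OF y(2) x(2)])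
    then have "cyc3 a c x \<in> U"
      using 4 assms(3) x y by (auto simp: cyc3_def[of b c y] split: if_splits)
    then have "cyc3 (cyc3 a b x a) (cyc3 a b x c) (cyc3 a b x x) \<in> U" by (rule conj[OF x(2)])
    then have "cyc3 b c a \<in> U"
      using 4 assms(3) x by (auto simp: cyc3_def[of a b x] split: if_splits)
    then show ?thesis using assms(3) cyc3_rotate[of a b c] by simp
  qed
qed

lemma linked_trans: "linked a b \<Longrightarrow> linked b c \<Longrightarrow> linked a c"
proof (cases "distinct [a, b, c]")
  case True
  assume ab: "linked a b" "linked b c"
  have "cyc3 a b c \<in> U" using cyc3_mem_if_linked ab True by blast
  then have "cyc3 a c b \<in> U" using True cyc3_inv by blast
  then show ?thesis using True unfolding linked_def by (intro disjI2 exI[of _ b]) auto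
qed (auto simp: linked_def)

lemma linked_image: "u \<in> U \<Longrightarrow> linked a b \<Longrightarrow> linked (u a) (u b)"
proof -
  assume u: "u \<in> U" and "linked a b"
  then consider "a = b" | c where "distinct [a, b, c]" "cyc3 a b c \<in> U"
    unfolding linked_def by blast
  then show ?thesis
  proof cases
    case 2
    have "cyc3 (u a) (u b) (u c) \<in> U" using U_comp U_inv u 2 cyc3_conj U_bij by metis
    moreover have "distinct [u a, u b, u c]" using 2(1) U_bij[OF u] by (auto simp: bij_def inj_eq)
    ultimately show ?thesis unfolding linked_def by blast
  qed (simp add: linked_def)
qed

lemma linked_mem: "linked a b \<Longrightarrow> a \<in> V \<Longrightarrow> b \<in> V"
proof -
  assume "linked a b" and a: "a \<in> V"
  then consider "a = b" | c where "distinct [a, b, c]" "cyc3 a b c \<in> U"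
    unfolding linked_def by blast
  then show ?thesis
  proof cases
    case 2
    then have "cyc3 a b c a \<in> V" using U_permutes a permutes_in_image by metis
    then show ?thesis by (simp add: cyc3_def)
  qed (use a in simp)
qed

text \<open>Let \<open>G\<close> be a largest set supporting no nontrivial element of
  \<open>U\<close>; pigeonhole gives \<open>card G < t\<close>. If \<open>S - G\<close> had
  \<open>t\<close> points, some \<open>x\<close> in \<open>U\<close> supported there would move a
  point \<open>q\<close>, and by maximality some \<open>y\<close> in \<open>U\<close> supported on
  \<open>insert q G\<close> moves \<open>q\<close> as well. The supports meet only in
  \<open>q\<close>, so the commutator is a 3-cycle through \<open>q\<close>, although
  \<open>q\<close> is linked to no other point.\<close>

lemma few_unlinked:
  assumes "f < fact t" "0 < t"
  shows "card {a \<in> V. \<forall>b. linked a b \<longrightarrow> a = b} < 2 * t"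
proof -
  define S where "S = {a \<in> V. \<forall>b. linked a b \<longrightarrow> a = b}"
  define free where "free Y \<longleftrightarrow> Y \<subseteq> V \<and> (\<forall>u\<in>U. u permutes Y \<longrightarrow> u = id)" for Y
  have large: "\<exists>u\<in>U. u permutes T \<and> u \<noteq> id" if T: "T \<subseteq> V" "t \<le> card T" for T
  proof (rule exists_nontrivial[OF T(1)])
    show "f < fact (card T)" using assms(1) fact_mono_nat[OF T(2)] by linarith
  qed
  have "free {}" by (auto simp: free_def permutes_empty)
  moreover have bound: "\<forall>Y. free Y \<longrightarrow> card Y < Suc (card V)"
    using finite_V by (auto simp: free_def less_Suc_eq_le intro: card_mono)
  ultimately obtain G where G: "free G" "\<And>Y. free Y \<Longrightarrow> card Y \<le> card G"
    using ex_has_greatest_nat[of free "{}" card "Suc (card V)"] by (meson less_imp_le)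
  have fG: "finite G" and GV: "G \<subseteq> V"
    using G(1) finite_V by (auto simp: free_def intro: finite_subset)
  have cG: "card G < t" using large[OF GV] G(1) by (force simp: free_def)
  have "card (S - G) < t"
  proof (rule ccontr)
    assume "\<not> card (S - G) < t"
    then obtain x where x: "x \<in> U" "x permutes S - G" "x \<noteq> id"
      using large[of "S - G"] by (auto simp: S_def)
    then obtain q where q: "x q \<noteq> q" by (metis eq_id_iff)
    then have qS: "q \<in> S" "q \<notin> G" using x(2) by (auto simp: permutes_def)
    have "\<not> free (insert q G)" using G(2)[of "insert q G"] qS fG by auto
    then obtain y where y: "y \<in> U" "y permutes insert q G" "y \<noteq> id"
      using qS GV by (auto simp: free_def S_def)
    have yq: "y q \<noteq> q"
    proof
      assume "y q = q"
      then have "y permutes G" using y(2) permutes_superset[of y "insert q G" G] by auto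
      then show False using G(1) y by (auto simp: free_def)
    qed
    have "p = q" if "x p \<noteq> p" "y p \<noteq> p" for p using that x(2) y(2) by (auto simp: permutes_def)
    note cyc = commutator_cyc3[OF U_bij[OF x(1)] U_bij[OF y(1)] this q yq]
    have "x \<circ> y \<circ> inv x \<circ> inv y \<in> U" using x y by (intro U_comp U_inv)
    then have "linked q (x q)" using cyc unfolding linked_def by auto
    then show False using qS q by (auto simp: S_def)
  qed
  moreover have "card S \<le> card (S - G) + card G"
    using card_Un_le[of "S - G" G] card_mono[of "S - G \<union> G" S] fG finite_V by (fastforce simp: S_def)
  ultimately show ?thesis using cG unfolding S_def by linarith
qed

definition link_class :: "'a \<Rightarrow> 'a set"
  where "link_class a = {b \<in> V. linked a b}"

definition link_classes :: "'a set set"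
  where "link_classes = link_class ` V"

lemma link_class_eq: "linked a b \<Longrightarrow> link_class a = link_class b"
  using linked_trans linked_sym unfolding link_class_def by blast

lemma self_in_link_class: "a \<in> V \<Longrightarrow> a \<in> link_class a" by (simp add: link_class_def linked_def)

lemma link_classes_eqI: "K \<in> link_classes \<Longrightarrow> a \<in> K \<Longrightarrow> K = link_class a"
  unfolding link_classes_def using link_class_eq by (auto simp: link_class_def)

lemma link_classes_disjoint:
  "K \<in> link_classes \<Longrightarrow> L \<in> link_classes \<Longrightarrow> K \<noteq> L \<Longrightarrow> K \<inter> L = {}" using link_classes_eqI by blast

lemma finite_link_classes: "finite link_classes" using finite_V by (simp add: link_classes_def)

lemma link_class_image: "u \<in> U \<Longrightarrow> K \<in> link_classes \<Longrightarrow> u ` K \<in> link_classes"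
proof -
  assume u: "u \<in> U" and "K \<in> link_classes"
  then obtain a where a: "a \<in> V" "K = link_class a" by (auto simp: link_classes_def)
  have perm: "u permutes V" and ui: "inv u \<in> U" and bij: "bij u"
    using u U_permutes U_inv U_bij by auto
  have "u ` K = link_class (u a)"
  proof
    show "u ` K \<subseteq> link_class (u a)"
      using linked_image[OF u] a permutes_in_image[OF perm] by (auto simp: link_class_def)
    show "link_class (u a) \<subseteq> u ` K"
    proof
      fix b assume b: "b \<in> link_class (u a)"
      then have "linked (inv u (u a)) (inv u b)"
        using linked_image[OF ui] by (simp add: link_class_def)
      then have "inv u b \<in> K" using b a permutes_in_image[OF permutes_inv[OF perm]] bij
        by (auto simp: link_class_def bij_def)
      then show "b \<in> u ` K" using bij by (metis bij_inv_eq_iff image_eqI)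
    qed
  qed
  then show ?thesis using a permutes_in_image[OF perm] by (simp add: link_classes_def)
qed

text \<open>Singleton classes are bounded by \<open>few_unlinked\<close>. Given \<open>t\<close>
  larger classes, some nontrivial \<open>u\<close> in \<open>U\<close> permutes their
  representatives and fixes all other points. A moved representative \<open>a\<close> is linked to
  some \<open>b\<close> that is not a representative, so \<open>u b = b\<close>; hence
  \<open>u a\<close> is linked to \<open>b\<close> and to \<open>a\<close>, giving one class two
  representatives.\<close>

lemma few_link_classes:
  assumes "f < fact t" "0 < t"
  shows "card link_classes \<le> 3 * t"
proof -
  define S where "S = {a \<in> V. \<forall>b. linked a b \<longrightarrow> a = b}"
  let ?C = "link_classes - link_class ` S"
  have cS: "card (link_class ` S) < 2 * t"
    using few_unlinked[OF assms] card_image_le[of S link_class] finite_V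
    unfolding S_def by fastforce
  define rep where "rep K = (SOME a. a \<in> K)" for K :: "'a set"
  have rep: "rep K \<in> K" if "K \<in> ?C" for K
    using that self_in_link_class unfolding rep_def link_classes_def by (metis DiffD1 imageE someI)
  have inj: "inj_on rep ?C"
  proof (rule inj_onI)
    fix K L assume KL: "K \<in> ?C" "L \<in> ?C" "rep K = rep L"
    then have "rep K \<in> K \<inter> L" using rep by (metis IntI)
    then show "K = L" using KL link_classes_disjoint by blast
  qed
  have "card ?C < t"
  proof (rule ccontr)
    assume "\<not> card ?C < t"
    then have "t \<le> card (rep ` ?C)" using inj by (simp add: card_image)
    then have ft: "f < fact (card (rep ` ?C))"
      using assms(1) fact_mono_nat by (meson order_less_le_trans)
    have "rep ` ?C \<subseteq> V"
      using rep by (auto simp: link_classes_def link_class_def image_subset_iff Ball_def)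
    then obtain u where u: "u \<in> U" "u permutes rep ` ?C" "u \<noteq> id"
      using exists_nontrivial ft by blast
    then obtain a where ua: "u a \<noteq> a" by (metis eq_id_iff)
    then have aC: "a \<in> rep ` ?C" "u a \<in> rep ` ?C"
      using u(2) permutes_in_image[OF u(2)] by (auto simp: permutes_def)
    then obtain K where K: "K \<in> ?C" "a = rep K" by blast
    have aK: "a \<in> K" "a \<in> V" "K = link_class a" using K rep link_classes_eqI \<open>rep ` ?C \<subseteq> V\<close> by auto
    then have "a \<notin> S" using K(1) aK(3) by blast
    then obtain b where b: "linked a b" "a \<noteq> b" using aK(2) unfolding S_def by blast
    have "b \<in> K" using b(1) aK linked_mem by (simp add: link_class_def)
    have "b \<notin> rep ` ?C"
    proof
      assume "b \<in> rep ` ?C"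
      then obtain L where "L \<in> ?C" "b = rep L" by blast
      then have "L = K" using \<open>b \<in> K\<close> link_classes_disjoint K rep by blast
      then show False using K(2) b(2) \<open>b = rep L\<close> by simp
    qed
    then have "u b = b" using u(2) by (simp add: permutes_def)
    then have "linked (u a) b" using linked_image[OF u(1) b(1)] by simp
    then have "linked a (u a)" using b linked_trans linked_sym by blast
    then have "u a \<in> K" using aK linked_mem by (simp add: link_class_def)
    obtain L where L: "L \<in> ?C" "u a = rep L" using aC by blast
    have "u a \<in> L" using L rep by simp
    then have "L = K" using \<open>u a \<in> K\<close> link_classes_disjoint[of L K] K(1) L(1) by blast
    then show False using ua K(2) L(2) by simp
  qed
  moreover have "card link_classes \<le> card ?C + card (link_class ` S)"
  proof -
    have "link_classes \<subseteq> ?C \<union> link_class ` S" "finite (?C \<union> link_class ` S)"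
      using finite_link_classes finite_V by (auto simp: S_def)
    then show ?thesis
      using card_Un_le[of ?C "link_class ` S"] card_mono[of "?C \<union> link_class ` S" link_classes] by linarith
  qed
  ultimately show ?thesis using cS by linarith
qed


end

section \<open>Orbits of node sets, and a link class that is almost everything\<close>

lemma exists_permutes_image:
  assumes "finite V" "Y \<subseteq> V" "Y' \<subseteq> V" "card Y = card Y'"
  shows "\<exists>\<sigma>. \<sigma> permutes V \<and> \<sigma> ` Y = Y'"
proof -
  have fin: "finite Y" "finite Y'" using assms finite_subset by blast+
  obtain g where g: "bij_betw g Y Y'" using fin assms(4) finite_same_card_bij by blast
  have "card (V - Y) = card (V - Y')" using assms fin by (simp add: card_Diff_subset)
  then obtain g' where g': "bij_betw g' (V - Y) (V - Y')"
    using assms(1) finite_same_card_bij finite_Diff by metis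
  define \<sigma> where "\<sigma> x = (if x \<in> Y then g x else if x \<in> V then g' x else x)" for x
  have "bij_betw \<sigma> Y Y'" using g by (rule bij_betw_cong[THEN iffD1, rotated]) (simp add: \<sigma>_def)
  moreover have "bij_betw \<sigma> (V - Y) (V - Y')"
    using g' by (rule bij_betw_cong[THEN iffD1, rotated]) (simp add: \<sigma>_def)
  ultimately have "bij_betw \<sigma> (Y \<union> (V - Y)) (Y' \<union> (V - Y'))" by (rule bij_betw_combine) auto
  moreover have "Y \<union> (V - Y) = V" "Y' \<union> (V - Y') = V" using assms by auto
  ultimately have "\<sigma> permutes V" using assms(2) by (intro bij_imp_permutes) (auto simp: \<sigma>_def)
  moreover have "\<sigma> ` Y = Y'" using \<open>bij_betw \<sigma> Y Y'\<close> by (simp add: bij_betw_def)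
  ultimately show ?thesis by blast
qed

lemma card_le_fibres:
  assumes "finite A" "\<And>x. x \<in> A \<Longrightarrow> card {y \<in> A. g y = g x} \<le> q"
  shows "card A \<le> card (g ` A) * q"
proof -
  have "card A = (\<Sum>b\<in>g ` A. card {y \<in> A. g y = b})"
    using sum.image_gen[OF assms(1), of "\<lambda>_. 1::nat" g] by simp
  also have "\<dots> \<le> (\<Sum>b\<in>g ` A. q)" using assms(2) by (intro sum_mono) auto
  finally show ?thesis by simp
qed

lemma binomial_le_between:
  assumes "(a::nat) \<le> b" "b \<le> n - a" "a \<le> n"
  shows "n choose a \<le> n choose b"
proof (cases "2 * b \<le> n")
  case True
  then show ?thesis using assms by (intro binomial_mono) auto
next
  case False
  then have "n choose b = n choose (n - b)" using assms by (intro binomial_symmetric) auto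
  moreover have "n choose a \<le> n choose (n - b)" using False assms by (intro binomial_mono) auto
  ultimately show ?thesis by simp
qed

context small_index_subgroup
begin

text \<open>The symmetric group is transitive on sets of size \<open>card Y\<close>, and each left
  coset of \<open>U\<close> carries \<open>Y\<close> to as many sets as \<open>U\<close>
  does.\<close>

lemma binomial_le_translates:
  assumes "Y \<subseteq> V"
  shows "card V choose card Y \<le> f * card ((\<lambda>u. u ` Y) ` U)"
proof -
  let ?A = "{Y'. Y' \<subseteq> V \<and> card Y' = card Y}"
  define \<sigma> where "\<sigma> Y' = (SOME \<sigma>. \<sigma> permutes V \<and> \<sigma> ` Y = Y')" for Y'
  have \<sigma>: "\<sigma> Y' permutes V" "\<sigma> Y' ` Y = Y'" if "Y' \<in> ?A" for Y'
    using someI_ex[OF exists_permutes_image[OF finite_V assms, of Y']] that unfolding \<sigma>_def by auto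
  define g where "g Y' = label (\<sigma> Y')" for Y'
  have "finite U"
    by (rule finite_subset[OF _ finite_permutations[OF finite_V]]) (use U_permutes in blast)
  have fA: "finite ?A" by (rule finite_subset[of _ "Pow V"]) (use finite_V in auto)
  \<comment> \<open>The single permutation \<open>inv (\<sigma> Z)\<close> moves all sets with the
    label of \<open>Z\<close> into the orbit of \<open>Y\<close> under \<open>U\<close>.\<close>
  have "card {Y' \<in> ?A. g Y' = g Z} \<le> card ((\<lambda>u. u ` Y) ` U)" if Z: "Z \<in> ?A" for Z
  proof (rule card_inj_on_le[of "\<lambda>Y'. inv (\<sigma> Z) ` Y'"])
    have "bij (inv (\<sigma> Z))" using \<sigma>[OF Z] permutes_bij permutes_inv by blast
    then show "inj_on (\<lambda>Y'. inv (\<sigma> Z) ` Y') {Y' \<in> ?A. g Y' = g Z}"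
      by (auto simp: inj_on_def bij_def inj_image_eq_iff)
    show "(\<lambda>Y'. inv (\<sigma> Z) ` Y') ` {Y' \<in> ?A. g Y' = g Z} \<subseteq> (\<lambda>u. u ` Y) ` U"
    proof safe
      fix Y' assume Y': "Y' \<subseteq> V" "card Y' = card Y" "g Y' = g Z"
      have "inv (\<sigma> Z) \<circ> \<sigma> Y' \<in> U" using label[of "\<sigma> Z" "\<sigma> Y'"] \<sigma> Y' Z by (auto simp: g_def)
      moreover have "inv (\<sigma> Z) ` Y' = (inv (\<sigma> Z) \<circ> \<sigma> Y') ` Y"
        using \<sigma>(2)[of Y'] Y' by (simp only: image_comp[symmetric] mem_Collect_eq simp_thms)
      ultimately show "inv (\<sigma> Z) ` Y' \<in> (\<lambda>u. u ` Y) ` U" by blast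
    qed
    show "finite ((\<lambda>u. u ` Y) ` U)" using \<open>finite U\<close> by simp
  qed
  then have "card ?A \<le> card (g ` ?A) * card ((\<lambda>u. u ` Y) ` U)" by (rule card_le_fibres[OF fA])
  moreover have "card (g ` ?A) \<le> f"
  proof -
    have "g ` ?A \<subseteq> label ` {\<sigma>. \<sigma> permutes V}" using \<sigma> by (auto simp: g_def)
    then show ?thesis
      using card_labels card_mono[of "label ` {\<sigma>. \<sigma> permutes V}" "g ` ?A"] finite_V
      by (simp add: finite_permutations)
  qed
  ultimately show ?thesis
    using n_subsets[OF finite_V, of "card Y"] by (metis le_trans mult_le_mono1)
qed

lemma Union_link_classes_image:
  "u \<in> U \<Longrightarrow> G \<subseteq> link_classes \<Longrightarrow> u ` \<Union>G \<in> Union ` Pow link_classes"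
proof -
  assume "u \<in> U" "G \<subseteq> link_classes"
  then have "(\<lambda>K. u ` K) ` G \<in> Pow link_classes" using link_class_image by auto
  moreover have "u ` \<Union>G = \<Union>((\<lambda>K. u ` K) ` G)" by auto
  ultimately show ?thesis by blast
qed

text \<open>If every class misses more than \<open>h\<close> points, then no class exceeds half of
  \<open>V\<close>: \<open>U\<close> would map such a class to itself, and the binomial coefficient
  for its complement would be at most \<open>f\<close>. So some union of classes has size between
  \<open>B\<close> and \<open>card V - B\<close>. As \<open>U\<close> permutes the classes, this
  union has at most \<open>2 ^ (3 * t)\<close> translates, too few for
  \<open>binomial_le_translates\<close>.\<close>

lemma exists_large_link_class:
  assumes t: "f < fact t" "0 < t" and B: "0 < B" "3 * B \<le> card V" "f * 2 ^ (3 * t) < card V choose B"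
    and h: "\<And>y. h < y \<Longrightarrow> 2 * y \<le> card V \<Longrightarrow> f < card V choose y"
  shows "\<exists>K\<subseteq>V. card (V - K) \<le> h \<and>
    (\<forall>a\<in>K. \<forall>b\<in>K. \<forall>c\<in>K. distinct [a, b, c] \<longrightarrow> cyc3 a b c \<in> U)"
proof (rule ccontr)
  assume contr: "\<not> ?thesis"
  have classV: "K \<subseteq> V" if "K \<in> link_classes" for K
    using that by (auto simp: link_classes_def link_class_def)
  have fcl: "finite K" if "K \<in> link_classes" for K
    using classV[OF that] finite_V finite_subset by blast
  have far: "h < card (V - K)" if K: "K \<in> link_classes" for K
  proof (rule ccontr)
    assume "\<not> h < card (V - K)"
    moreover have "cyc3 a b c \<in> U" if "a \<in> K" "b \<in> K" "c \<in> K" "distinct [a, b, c]" for a b c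
    proof (rule cyc3_mem_if_linked)
      show "linked a b" "linked b c"
        using link_classes_eqI[OF K] that by (auto simp: link_class_def)
    qed (use that in simp)
    ultimately show False using contr classV[OF K] by (meson not_less)
  qed
  have half: "2 * card K \<le> card V" if K: "K \<in> link_classes" for K
  proof (rule ccontr)
    assume big: "\<not> 2 * card K \<le> card V"
    have cd: "card (V - K) = card V - card K" and le: "card K \<le> card V"
      using card_Diff_subset[OF fcl[OF K] classV[OF K]] card_mono[OF finite_V classV[OF K]] by auto
    have "u ` K = K" if u: "u \<in> U" for u
    proof (rule ccontr)
      assume ne: "u ` K \<noteq> K"
      have uK: "u ` K \<in> link_classes" using link_class_image u K by blast
      have "card (u ` K) = card K"
        using U_bij[OF u] by (intro card_image) (auto simp: bij_def inj_on_def)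
      then have "card (u ` K \<union> K) = 2 * card K"
        using link_classes_disjoint[OF uK K ne] fcl K uK by (simp add: card_Un_disjoint)
      moreover have "card (u ` K \<union> K) \<le> card V" using classV K uK finite_V by (intro card_mono) auto
      ultimately show False using big by simp
    qed
    then have "(\<lambda>u. u ` K) ` U \<subseteq> {K}" by auto
    then have "card ((\<lambda>u. u ` K) ` U) \<le> 1" using card_mono[of "{K}"] by fastforce
    then have "f * card ((\<lambda>u. u ` K) ` U) \<le> f" by (metis mult.right_neutral mult_le_mono2)
    then have "card V choose card K \<le> f" using binomial_le_translates[OF classV[OF K]] by linarith
    moreover have "f < card V choose (card V - card K)" using far[OF K] big cd by (intro h) auto
    ultimately show False using binomial_symmetric[OF le] by simp
  qed
  have "\<Union>link_classes = V" using classV self_in_link_class by (fastforce simp: link_classes_def)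
  then have "\<exists>G. G \<subseteq> link_classes \<and> B \<le> card (\<Union>G)" using B by (intro exI[of _ link_classes]) auto
  then obtain G where G: "G \<subseteq> link_classes" "B \<le> card (\<Union>G)"
      and min: "\<And>G'. G' \<subseteq> link_classes \<Longrightarrow> B \<le> card (\<Union>G') \<Longrightarrow> card G \<le> card G'"
    using ex_has_least_nat[of "\<lambda>G. G \<subseteq> link_classes \<and> B \<le> card (\<Union>G)" _ card] by metis
  have fG: "finite G" using G finite_link_classes finite_subset by blast
  have "G \<noteq> {}" using G B by auto
  then obtain K where K: "K \<in> G" by blast
  then have Kc: "K \<in> link_classes" using G by blast
  \<comment> \<open>By minimality of \<open>G\<close>, either a single class suffices, and it is at
    most half of \<open>V\<close>, or two sets of fewer than \<open>B\<close> points each make up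
    the union; \<open>3 * B \<le> card V\<close> settles both cases.\<close>
  have "card (\<Union>G) \<le> card V - B"
  proof (cases "B \<le> card K")
    case True
    then have "card G \<le> 1" using min[of "{K}"] Kc by auto
    then have "G = {K}"
      using K fG by (metis card_1_singletonE card_gt_0_iff le_antisym less_eq_Suc_le One_nat_def singletonD empty_iff)
    then show ?thesis using half[OF Kc] B by auto
  next
    case False
    have "card (G - {K}) < card G" using K fG by (meson card_Diff1_less)
    then have "card (\<Union>(G - {K})) < B"
      using min[of "G - {K}"] G by (meson Diff_subset not_le subset_trans)
    moreover have "\<Union>(G - {K}) \<union> K = \<Union>G" using K by auto
    then have "card (\<Union>G) \<le> card (\<Union>(G - {K})) + card K" using card_Un_le[of "\<Union>(G - {K})" K] by simp
    ultimately show ?thesis using False B by linarith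
  qed
  then have "card V choose B \<le> card V choose card (\<Union>G)"
    using G B by (intro binomial_le_between) auto
  also have "\<dots> \<le> f * card ((\<lambda>u. u ` \<Union>G) ` U)" using G classV by (intro binomial_le_translates) blast
  also have "\<dots> \<le> f * 2 ^ (3 * t)"
  proof (rule mult_le_mono2)
    have "(\<lambda>u. u ` \<Union>G) ` U \<subseteq> Union ` Pow link_classes" using Union_link_classes_image G by blast
    then have "card ((\<lambda>u. u ` \<Union>G) ` U) \<le> card (Union ` Pow link_classes)"
      using finite_link_classes by (intro card_mono) auto
    also have "\<dots> \<le> card (Pow link_classes)" using finite_link_classes by (intro card_image_le) auto
    also have "\<dots> \<le> 2 ^ (3 * t)"
      using few_link_classes[OF t] finite_link_classes by (simp add: card_Pow)
    finally show "card ((\<lambda>u. u ` \<Union>G) ` U) \<le> 2 ^ (3 * t)" .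
  qed
  finally show False using B by simp
qed

end

subsection \<open>Perfect matchings\<close>

definition perfect_matchings :: "'a set \<Rightarrow> 'a set set set"
  where "perfect_matchings S =
    {M. (\<forall>e\<in>M. e \<subseteq> S \<and> card e = 2) \<and> (\<forall>v\<in>S. \<exists>!e. e \<in> M \<and> v \<in> e)}"

definition kind :: "'a set \<Rightarrow> nat \<Rightarrow> 'a set set \<Rightarrow> 'a set set"
  where "kind A j M = {e \<in> M. card (e \<inter> A) = j}"

abbreviation crossing :: "'a set \<Rightarrow> 'a set set \<Rightarrow> nat"
  where "crossing A M \<equiv> card (kind A 1 M)"

lemma pm_edge:
  "M \<in> perfect_matchings S \<Longrightarrow> e \<in> M \<Longrightarrow> e \<subseteq> S" 
  "M \<in> perfect_matchings S \<Longrightarrow> e \<in> M \<Longrightarrow> card e = 2"  by (auto simp: perfect_matchings_def)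

lemma pm_cover: "M \<in> perfect_matchings S \<Longrightarrow> v \<in> S \<Longrightarrow> \<exists>e\<in>M. v \<in> e"
  by (auto simp: perfect_matchings_def)

lemma pm_disjoint:
  "M \<in> perfect_matchings S \<Longrightarrow> e \<in> M \<Longrightarrow> e' \<in> M \<Longrightarrow> v \<in> e \<Longrightarrow> v \<in> e' \<Longrightarrow> e = e'"
  using pm_edge(1) unfolding perfect_matchings_def by blast

lemma pm_Union: "M \<in> perfect_matchings S \<Longrightarrow> \<Union>M = S"
  using pm_edge(1) pm_cover by fastforce

lemma finite_pm:
  assumes "finite S"
  shows "finite (perfect_matchings S)" "M \<in> perfect_matchings S \<Longrightarrow> finite M"
proof -
  have "perfect_matchings S \<subseteq> Pow (Pow S)" by (auto simp: perfect_matchings_def)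
  then show "finite (perfect_matchings S)" using assms by (meson finite_Pow_iff finite_subset)
  show "M \<in> perfect_matchings S \<Longrightarrow> finite M"
    using assms \<open>perfect_matchings S \<subseteq> Pow (Pow S)\<close> by (meson PowD finite_Pow_iff finite_subset subsetD)
qed

text \<open>Each edge contributes its number of ends in \<open>A\<close>, and the edges partition
  \<open>S\<close>. In particular an odd \<open>A\<close> has an odd number of crossing
  edges.\<close>

lemma pm_card_inter:
  assumes "finite S" "M \<in> perfect_matchings S" "A \<subseteq> S"
  shows "2 * card (kind A 2 M) + card (kind A 1 M) = card A"
proof -
  have fM: "finite M" using assms finite_pm by blast
  have fe: "finite e" if "e \<in> M" for e
    using that assms pm_edge(1) finite_subset by metis
  have "A = (\<Union>e\<in>M. e \<inter> A)" using pm_Union[OF assms(2)] assms(3) by auto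
  then have "card A = (\<Sum>e\<in>M. card (e \<inter> A))"
  proof -
    have "\<forall>e\<in>M. \<forall>e'\<in>M. e \<noteq> e' \<longrightarrow> (e \<inter> A) \<inter> (e' \<inter> A) = {}" using pm_disjoint[OF assms(2)] by blast
    then show ?thesis using card_UN_disjoint[of M "\<lambda>e. e \<inter> A"] fM fe \<open>A = (\<Union>e\<in>M. e \<inter> A)\<close> by simp
  qed
  also have "\<dots> = (\<Sum>e\<in>M. 2 * of_bool (card (e \<inter> A) = 2) + of_bool (card (e \<inter> A) = 1))"
  proof (rule sum.cong)
    fix e assume "e \<in> M"
    then have "card (e \<inter> A) \<le> 2" using card_mono[of e "e \<inter> A"] fe pm_edge[OF assms(2)] by auto
    then show "card (e \<inter> A) = 2 * of_bool (card (e \<inter> A) = 2) + of_bool (card (e \<inter> A) = 1)"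
      by (cases "card (e \<inter> A) = 0") auto
  qed simp
  also have "\<dots> = 2 * (\<Sum>e\<in>M. of_bool (card (e \<inter> A) = 2)) + (\<Sum>e\<in>M. of_bool (card (e \<inter> A) = 1))"
    by (simp add: sum.distrib sum_distrib_left)
  also have "\<dots> = 2 * card (kind A 2 M) + card (kind A 1 M)"
    unfolding kind_def card_eq_sum by (simp only: sum.inter_filter[OF fM] of_bool_def)
  finally show ?thesis by simp
qed

lemma kind_complement:
  assumes "M \<in> perfect_matchings S" "finite S"
  shows "kind (S - A) 1 M = kind A 1 M" "kind (S - A) 2 M = kind A 0 M"
proof -
  have "card (e \<inter> (S - A)) = 2 - card (e \<inter> A)" "card (e \<inter> A) \<le> 2" if "e \<in> M" for e
  proof -
    have e: "e \<subseteq> S" "card e = 2" "finite e" using that assms pm_edge finite_subset by metis+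
    then have "e \<inter> (S - A) = e - e \<inter> A" by auto
    then show "card (e \<inter> (S - A)) = 2 - card (e \<inter> A)" using e by (simp add: card_Diff_subset)
    show "card (e \<inter> A) \<le> 2" using e card_mono[of e "e \<inter> A"] by auto
  qed
  then show "kind (S - A) 1 M = kind A 1 M" "kind (S - A) 2 M = kind A 0 M"
    unfolding kind_def by fastforce+
qed

lemma pm_image:
  assumes "inj \<rho>" "M \<in> perfect_matchings S"
  shows "(`) \<rho> ` M \<in> perfect_matchings (\<rho> ` S)"
  unfolding perfect_matchings_def
proof (intro CollectI conjI ballI)
  fix e assume "e \<in> (`) \<rho> ` M"
  then show "e \<subseteq> \<rho> ` S" "card e = 2"
    using assms pm_edge[OF assms(2)] by (auto simp: card_image inj_on_subset)
next
  fix v assume "v \<in> \<rho> ` S"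
  then obtain w where w: "w \<in> S" "v = \<rho> w" by blast
  then obtain e where e: "e \<in> M" "w \<in> e" using pm_cover[OF assms(2)] by blast
  show "\<exists>!e. e \<in> (`) \<rho> ` M \<and> v \<in> e"
  proof (rule ex1I[of _ "\<rho> ` e"])
    show "\<rho> ` e \<in> (`) \<rho> ` M \<and> v \<in> \<rho> ` e" using e w by auto
    fix e' assume "e' \<in> (`) \<rho> ` M \<and> v \<in> e'"
    then obtain e'' where "e'' \<in> M" "e' = \<rho> ` e''" "v \<in> \<rho> ` e''" by blast
    then have "w \<in> e''" using w assms(1) by (auto simp: inj_def)
    then show "e' = \<rho> ` e" using pm_disjoint[OF assms(2) e(1) \<open>e'' \<in> M\<close> e(2)] \<open>e' = \<rho> ` e''\<close> by simp
  qed
qed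

lemma pm_insert:
  assumes "M \<in> perfect_matchings S" "u \<notin> S" "v \<notin> S" "u \<noteq> v"
  shows "insert {u, v} M \<in> perfect_matchings (insert u (insert v S))" "{u, v} \<notin> M"
proof -
  show "{u, v} \<notin> M" using assms pm_edge(1) by blast
  show "insert {u, v} M \<in> perfect_matchings (insert u (insert v S))" unfolding perfect_matchings_def
  proof (intro CollectI conjI ballI)
    fix e assume "e \<in> insert {u, v} M"
    then show "e \<subseteq> insert u (insert v S)" "card e = 2" using assms pm_edge[OF assms(1)] by auto
  next
    fix w assume w: "w \<in> insert u (insert v S)"
    show "\<exists>!e. e \<in> insert {u, v} M \<and> w \<in> e"
    proof (cases "w \<in> {u, v}")
      case True
      then show ?thesis
        using assms pm_edge[OF assms(1)] by (intro ex1I[of _ "{u, v}"]) auto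
    next
      case False
      then obtain e where "e \<in> M" "w \<in> e" using w pm_cover[OF assms(1)] by blast
      then show ?thesis
        using False pm_disjoint[OF assms(1)] by (intro ex1I[of _ e]) auto
    qed
  qed
qed

text \<open>Induction by splitting off a crossing edge or, for \<open>i = 0\<close>, one edge inside
  \<open>A\<close> and one inside \<open>B\<close>; in the latter case \<open>m\<close> is even, so
  both sides still have two nodes.\<close>

lemma exists_perfect_matching_crossing:
  assumes "finite A" "finite B" "A \<inter> B = {}" "card A = m" "card B = m" "i \<le> m" "even (m - i)"
  shows "\<exists>M\<in>perfect_matchings (A \<union> B). crossing A M = i"
  using assms
proof (induction m arbitrary: A B i rule: less_induct)
  case (less m)
  have fin: "finite (kind X j M)" if "M \<in> perfect_matchings S" "finite S" for X :: "'a set" and j M S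
    using finite_pm(2)[OF that(2,1)] by (simp add: kind_def)
  show ?case
  proof (cases "i = 0")
    case False
    then obtain a b where ab: "a \<in> A" "b \<in> B"
      using less.prems by (metis card.empty ex_in_conv le_zero_eq)
    have "\<exists>M\<in>perfect_matchings ((A - {a}) \<union> (B - {b})). crossing (A - {a}) M = i - 1"
      using False less.prems ab by (intro less.IH[of "m - 1"]) auto
    then obtain M where M: "M \<in> perfect_matchings ((A - {a}) \<union> (B - {b}))" "crossing (A - {a}) M = i - 1"
      by blast
    have eq: "insert a (insert b ((A - {a}) \<union> (B - {b}))) = A \<union> B" using ab by auto
    have ins: "insert {a, b} M \<in> perfect_matchings (A \<union> B)" "{a, b} \<notin> M"
      using pm_insert[OF M(1), of a b] less.prems(3) ab unfolding eq by auto
    have "e \<inter> A = e \<inter> (A - {a})" if "e \<in> M" for e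
      using pm_edge(1)[OF M(1) that] less.prems(3) ab by auto
    then have "kind A 1 M = kind (A - {a}) 1 M" by (auto simp: kind_def)
    moreover have "kind A 1 (insert {a, b} M) = insert {a, b} (kind A 1 M)"
    proof -
      have "{a, b} \<inter> A = {a}" using ab less.prems(3) by auto
      then show ?thesis by (auto simp: kind_def)
    qed
    moreover have "{a, b} \<notin> kind A 1 M" using ins(2) by (simp add: kind_def)
    ultimately have "crossing A (insert {a, b} M) = i" using M False fin[OF M(1)] less.prems by simp
    then show ?thesis using ins by blast
  next
    case True
    show ?thesis
    proof (cases "m = 0")
      case True
      then have "{} \<in> perfect_matchings (A \<union> B)" "crossing A {} = i"
        using less.prems by (auto simp: perfect_matchings_def kind_def)
      then show ?thesis by blast
    next
      case False
      then have m: "2 \<le> m" "even m" using True less.prems by auto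
      obtain a where a: "a \<in> A" using m less.prems by (metis False card.empty ex_in_conv)
      have "card (A - {a}) \<noteq> 0" using m less.prems a by simp
      then obtain a' where a': "a' \<in> A" "a' \<noteq> a"
        by (metis Diff_iff all_not_in_conv card.empty singletonI)
      obtain b where b: "b \<in> B" using m less.prems by (metis False card.empty ex_in_conv)
      have "card (B - {b}) \<noteq> 0" using m less.prems b by simp
      then obtain b' where b': "b' \<in> B" "b' \<noteq> b"
        by (metis Diff_iff all_not_in_conv card.empty singletonI)
      have "\<exists>M\<in>perfect_matchings ((A - {a, a'}) \<union> (B - {b, b'})). crossing (A - {a, a'}) M = 0"
        using less.prems m a a' b b' by (intro less.IH[of "m - 2"]) (auto simp: card_Diff_subset)
      then obtain M where M: "M \<in> perfect_matchings ((A - {a, a'}) \<union> (B - {b, b'}))"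
          "crossing (A - {a, a'}) M = 0" by blast
      let ?M = "insert {b, b'} M"
      have 1: "?M \<in> perfect_matchings (insert b (insert b' ((A - {a, a'}) \<union> (B - {b, b'}))))"
        using pm_insert[OF M(1), of b b'] less.prems(3) b b' by auto
      have eq: "insert a (insert a' (insert b (insert b' ((A - {a, a'}) \<union> (B - {b, b'}))))) = A \<union> B"
        using a a' b b' by auto
      have 2: "insert {a, a'} ?M \<in> perfect_matchings (A \<union> B)"
        using pm_insert[OF 1, of a a'] less.prems(3) a a' b b' unfolding eq by auto
      have "e \<inter> A = e \<inter> (A - {a, a'})" if "e \<in> M" for e
        using pm_edge(1)[OF M(1) that] less.prems(3) by auto
      then have "kind A 1 M = kind (A - {a, a'}) 1 M" by (auto simp: kind_def)
      also have "\<dots> = {}" using M(2) fin[OF M(1)] less.prems by auto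
      finally have "kind A 1 M = {}" .
      moreover have "{b, b'} \<inter> A = {}" "{a, a'} \<inter> A = {a, a'}" using a a' b b' less.prems(3) by auto
      ultimately have "kind A 1 (insert {a, a'} ?M) = {}" using a' unfolding kind_def by auto
      then show ?thesis using 2 True by (intro bexI[of _ "insert {a, a'} ?M"]) simp_all
    qed
  qed
qed

section \<open>Counting perfect matchings with prescribed edges and crossing number\<close>

lemma exists_permutes_preserving:
  assumes "finite D" "e \<subseteq> D" "e' \<subseteq> D" "card e = card e'" "card (e \<inter> A) = card (e' \<inter> A)"
  shows "\<exists>\<rho>. \<rho> permutes D \<and> \<rho> ` e = e' \<and> (\<forall>x. \<rho> x \<in> A \<longleftrightarrow> x \<in> A)"
proof -
  have fin: "finite e" "finite e'" using assms finite_subset by blast+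
  obtain \<sigma> where \<sigma>: "\<sigma> permutes D \<inter> A" "\<sigma> ` (e \<inter> A) = e' \<inter> A"
    using exists_permutes_image[of "D \<inter> A" "e \<inter> A" "e' \<inter> A"] assms by auto
  have "card (e - A) = card (e' - A)"
    using assms fin card_Diff_subset_Int[of e A] card_Diff_subset_Int[of e' A] by simp
  then obtain \<tau> where \<tau>: "\<tau> permutes D - A" "\<tau> ` (e - A) = e' - A"
    using exists_permutes_image[of "D - A" "e - A" "e' - A"] assms by auto
  have fix\<sigma>: "\<sigma> x = x" if "x \<notin> A" for x using \<sigma>(1) that by (simp add: permutes_def)
  have fix\<tau>: "\<tau> x = x" if "x \<in> A" for x using \<tau>(1) that by (simp add: permutes_def)
  have in\<sigma>: "\<sigma> x \<in> A \<longleftrightarrow> x \<in> A" for x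
    using permutes_in_image[OF \<sigma>(1), of x] \<sigma>(1) fix\<sigma> by (metis Int_iff permutes_def)
  have in\<tau>: "\<tau> x \<in> A \<longleftrightarrow> x \<in> A" for x
    using permutes_in_image[OF \<tau>(1), of x] \<tau>(1) fix\<tau> by (metis Diff_iff permutes_def)
  have "\<sigma> \<circ> \<tau> permutes D"
    using \<sigma>(1) \<tau>(1) by (meson Diff_subset inf_le1 permutes_compose permutes_subset)
  moreover have "(\<sigma> \<circ> \<tau>) ` e = e'"
  proof -
    have "\<tau> ` e = \<tau> ` (e \<inter> A) \<union> \<tau> ` (e - A)" by blast
    also have "\<tau> ` (e \<inter> A) = e \<inter> A" using fix\<tau> by force
    finally have "(\<sigma> \<circ> \<tau>) ` e = \<sigma> ` (e \<inter> A) \<union> \<sigma> ` (e' - A)"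
      using \<tau>(2) by (metis image_Un image_comp)
    also have "\<sigma> ` (e' - A) = e' - A" using fix\<sigma> by force
    finally show ?thesis using \<sigma>(2) by auto
  qed
  ultimately show ?thesis using in\<sigma> in\<tau> by (metis comp_apply)
qed

definition level :: "'a set \<Rightarrow> 'a set \<Rightarrow> nat \<Rightarrow> 'a set set set"
  where "level S A i = {M \<in> perfect_matchings S. crossing A M = i}"

definition extensions :: "'a set \<Rightarrow> 'a set \<Rightarrow> nat \<Rightarrow> 'a set set \<Rightarrow> 'a set set set"
  where "extensions S A i F = {M \<in> level S A i. F \<subseteq> M}"

lemma finite_extensions: "finite S \<Longrightarrow> finite (extensions S A i F)"
  using finite_pm(1)[of S] by (auto simp: extensions_def level_def)

text \<open>Relabelling by a permutation that fixes the nodes of \<open>F\<close>, preserves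
  \<open>A\<close> and carries \<open>e\<close> to \<open>e'\<close> is injective on matchings. With
  the roles of \<open>e\<close> and \<open>e'\<close> exchanged this gives equality.\<close>

lemma card_extensions_insert_le:
  assumes "finite S" "\<Union>F \<subseteq> S" "e \<subseteq> S - \<Union>F" "e' \<subseteq> S - \<Union>F" "card e = card e'"
    and "card (e \<inter> A) = card (e' \<inter> A)"
  shows "card (extensions S A i (insert e F)) \<le> card (extensions S A i (insert e' F))"
proof -
  obtain \<rho> where \<rho>: "\<rho> permutes S - \<Union>F" "\<rho> ` e = e'" "\<And>x. \<rho> x \<in> A \<longleftrightarrow> x \<in> A"
    using exists_permutes_preserving[of "S - \<Union>F" e e' A] assms by auto
  have inj: "inj \<rho>" using \<rho>(1) permutes_inj by blast
  have \<rho>S: "\<rho> ` S = S" using \<rho>(1) by (meson Diff_subset permutes_image permutes_subset)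
  have "card (\<rho> ` x \<inter> A) = card (x \<inter> A)" for x
  proof -
    have "\<rho> ` x \<inter> A = \<rho> ` (x \<inter> A)" using \<rho>(3) by auto
    then show ?thesis using inj by (simp add: card_image inj_on_subset)
  qed
  then have k: "kind A j ((`) \<rho> ` M) = (`) \<rho> ` kind A j M" for j M by (auto simp: kind_def)
  have inj2: "inj ((`) \<rho>)" using inj by (simp add: inj_image_eq_iff inj_on_def)
  have F: "\<rho> ` x = x" if "x \<in> F" for x
  proof -
    have "\<rho> v = v" if "v \<in> x" for v using \<rho>(1) \<open>x \<in> F\<close> that by (auto simp: permutes_def)
    then show ?thesis by simp
  qed
  show ?thesis
  proof (rule card_inj_on_le[of "\<lambda>M. (`) \<rho> ` M"])
    show "inj_on (\<lambda>M. (`) \<rho> ` M) (extensions S A i (insert e F))"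
      by (rule inj_onI) (simp add: inj_image_eq_iff[OF inj2])
    show "(\<lambda>M. (`) \<rho> ` M) ` extensions S A i (insert e F) \<subseteq> extensions S A i (insert e' F)"
    proof safe
      fix M assume M: "M \<in> extensions S A i (insert e F)"
      have "(`) \<rho> ` M \<in> perfect_matchings S"
        using pm_image[OF inj, of M S] M \<rho>S by (simp add: extensions_def level_def)
      moreover have "crossing A ((`) \<rho> ` M) = i"
        using M inj2 by (simp add: k extensions_def level_def card_image inj_on_subset)
      moreover have "insert e' F \<subseteq> (`) \<rho> ` M"
      proof -
        have "e \<in> M" "F \<subseteq> M" using M by (auto simp: extensions_def)
        then have "\<rho> ` e \<in> (`) \<rho> ` M" "(`) \<rho> ` F \<subseteq> (`) \<rho> ` M" by auto
        moreover have "(`) \<rho> ` F = F" using F by simp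
        ultimately show ?thesis using \<rho>(2) by simp
      qed
      ultimately show "(`) \<rho> ` M \<in> extensions S A i (insert e' F)"
        by (simp add: extensions_def level_def)
    qed
  qed (rule finite_extensions[OF assms(1)])
qed

text \<open>The number of edges with \<open>j\<close> ends in \<open>A\<close>, as a polynomial in
  the number \<open>i\<close> of crossing edges: \<open>i\<close> for \<open>j = 1\<close>, and
  \<open>(m - i) / 2\<close> for \<open>j = 0\<close> and \<open>j = 2\<close> alike, since both
  sides have \<open>m\<close> nodes.\<close>

definition kind_poly :: "nat \<Rightarrow> nat \<Rightarrow> real poly"
  where "kind_poly m j = (if j = 1 then [:0, 1:] else [:real m / 2, - 1 / 2:])"

lemma card_kind_poly:
  assumes "finite S" "A \<subseteq> S" "card A = m" "card (S - A) = m" "M \<in> perfect_matchings S" "j \<le> 2"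
  shows "real (card (kind A j M)) = poly (kind_poly m j) (real (crossing A M))"
proof -
  have "2 * card (kind A 2 M) + crossing A M = m" "2 * card (kind A 0 M) + crossing A M = m"
    using pm_card_inter[of S M A] pm_card_inter[of S M "S - A"] kind_complement[of M S A] assms by simp_all
  moreover have "j = 0 \<or> j = 1 \<or> j = 2" using assms(6) by linarith
  ultimately have "j = 1 \<or> 2 * card (kind A j M) + crossing A M = m" by blast
  then have "j = 1 \<or> 2 * real (card (kind A j M)) + real (crossing A M) = real m" by linarith
  then show ?thesis by (cases "j = 1") (simp_all add: kind_poly_def field_simps)
qed

text \<open>Double counting of pairs \<open>e' \<in> M\<close>, with \<open>e'\<close> in
  \<open>E\<close> and \<open>M\<close> an extension of \<open>F\<close>. All \<open>e'\<close> have
  equally many extensions by relabelling, and each \<open>M\<close> contains as candidates all its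
  edges of kind \<open>j\<close> except those in \<open>F\<close>. \<open>M0\<close> guarantees that
  \<open>e\<close> itself is a candidate.\<close>

lemma card_extensions_insert:
  assumes S: "finite S" "A \<subseteq> S" "card A = m" "card (S - A) = m"
    and M0: "M0 \<in> perfect_matchings S" "insert e F \<subseteq> M0" "e \<notin> F" and j: "card (e \<inter> A) = j"
    and E: "E = {e'. e' \<subseteq> S - \<Union>F \<and> card e' = 2 \<and> card (e' \<inter> A) = j}"
  shows "real (card E) * real (card (extensions S A i (insert e F))) =
      (poly (kind_poly m j) (real i) - real (card (kind A j F))) * real (card (extensions S A i F))"
    and "0 < card E"
proof -
  have FS: "\<Union>F \<subseteq> S" and e: "e \<subseteq> S" "card e = 2" using M0 pm_edge[OF M0(1)] by blast+
  have edis: "e \<inter> \<Union>F = {}"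
  proof (rule ccontr)
    assume "e \<inter> \<Union>F \<noteq> {}"
    then obtain v x where "v \<in> e" "x \<in> F" "v \<in> x" by blast
    then show False using pm_disjoint[OF M0(1), of e x v] M0(2,3) by auto
  qed
  have fE: "finite E" unfolding E by (rule finite_subset[of _ "Pow S"]) (use S in auto)
  have eE: "e \<in> E" using e edis j by (auto simp: E)
  then show "0 < card E" using fE card_gt_0_iff by blast
  have "card (e \<inter> A) \<le> 2" using e S card_mono[of e "e \<inter> A"] by (metis finite_subset inf_le1)
  then have j2: "j \<le> 2" using j by simp
  have same: "card (extensions S A i (insert e' F)) = card (extensions S A i (insert e F))" if "e' \<in> E" for e'
    using that eE FS S(1) by (intro antisym card_extensions_insert_le) (auto simp: E)
  have "card E * card (extensions S A i (insert e F)) = (\<Sum>e'\<in>E. card (extensions S A i (insert e' F)))"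
    by (simp add: same)
  also have "\<dots> = (\<Sum>e'\<in>E. card {M \<in> extensions S A i F. e' \<in> M})"
    by (intro sum.cong arg_cong[of _ _ card]) (auto simp: extensions_def)
  also have "\<dots> = (\<Sum>M\<in>extensions S A i F. card {e' \<in> E. e' \<in> M})"
    using sum_multicount_gen[of E "extensions S A i F" "\<lambda>e' M. e' \<in> M"] fE finite_extensions[OF S(1)]
    by simp
  finally have "real (card E) * real (card (extensions S A i (insert e F))) =
      (\<Sum>M\<in>extensions S A i F. real (card {e' \<in> E. e' \<in> M}))"
    by (simp only: of_nat_mult[symmetric] of_nat_sum[symmetric])
  also have "\<dots> = (\<Sum>M\<in>extensions S A i F. poly (kind_poly m j) (real i) - real (card (kind A j F)))"
  proof (rule sum.cong)
    fix M assume "M \<in> extensions S A i F"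
    then have M: "M \<in> perfect_matchings S" "crossing A M = i" "F \<subseteq> M"
      by (auto simp: extensions_def level_def)
    have "{e' \<in> E. e' \<in> M} = kind A j M - kind A j F"
    proof (intro equalityI subsetI)
      fix x assume x: "x \<in> {e' \<in> E. e' \<in> M}"
      then have "x \<noteq> {}" "x \<inter> \<Union>F = {}" by (auto simp: E)
      then have "x \<notin> F" by auto
      then show "x \<in> kind A j M - kind A j F" using x by (simp add: E kind_def)
    next
      fix x assume "x \<in> kind A j M - kind A j F"
      then have x: "x \<in> M" "x \<notin> F" "card (x \<inter> A) = j" by (auto simp: kind_def)
      moreover have "x \<inter> \<Union>F = {}"
      proof (rule ccontr)
        assume "x \<inter> \<Union>F \<noteq> {}"
        then obtain v y where "v \<in> x" "y \<in> F" "v \<in> y" by blast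
        then show False using pm_disjoint[OF M(1), of x y v] x M(3) by auto
      qed
      ultimately show "x \<in> {e' \<in> E. e' \<in> M}" using pm_edge[OF M(1) x(1)] by (auto simp: E)
    qed
    moreover have sub: "kind A j F \<subseteq> kind A j M" and fin: "finite (kind A j M)"
      using M(3) finite_pm(2)[OF S(1) M(1)] by (auto simp: kind_def)
    moreover have "finite (kind A j F)" using sub fin by (rule finite_subset)
    ultimately have "real (card {e' \<in> E. e' \<in> M}) = real (card (kind A j M)) - real (card (kind A j F))"
      using card_mono[OF fin sub] by (simp add: card_Diff_subset of_nat_diff)
    then show "real (card {e' \<in> E. e' \<in> M}) = poly (kind_poly m j) (real i) - real (card (kind A j F))"
      using card_kind_poly[OF S M(1) j2] M(2) by simp
  qed simp
  finally show "real (card E) * real (card (extensions S A i (insert e F))) =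
      (poly (kind_poly m j) (real i) - real (card (kind A j F))) * real (card (extensions S A i F))"
    by simp
qed

text \<open>Lagrange interpolation at the points of \<open>I\<close>: the weight of \<open>i\<close>
  is the value at 0 of the basis polynomial \<open>L i\<close>.\<close>

lemma exists_extrapolation_weights:
  assumes "finite (I :: nat set)"
  shows "\<exists>\<alpha>::nat \<Rightarrow> real. \<forall>q. degree q < card I \<longrightarrow> (\<Sum>i\<in>I. \<alpha> i * poly q (real i)) = poly q 0"
proof -
  define L where "L i = (\<Prod>j\<in>I - {i}. smult (1 / (real i - real j)) [:- real j, 1:])" for i
  have at: "poly (L i) (real k) = of_bool (k = i)" if "i \<in> I" "k \<in> I" for i k
  proof (cases "k = i")
    case True
    have "poly (smult (1 / (real i - real j)) [:- real j, 1:]) (real i) = 1" if "j \<in> I - {i}" for j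
      using that by (simp add: diff_divide_distrib[symmetric])
    then show ?thesis using True by (simp add: L_def poly_prod del: poly_smult poly_pCons)
  next
    case False
    then have "k \<in> I - {i}" "finite (I - {i})" using that assms by auto
    then have "(\<Prod>j\<in>I - {i}. poly (smult (1 / (real i - real j)) [:- real j, 1:]) (real k)) = 0"
      by (intro prod_zero) auto
    then show ?thesis using False by (simp add: L_def poly_prod)
  qed
  have deg: "degree (L i) < card I" if "i \<in> I" for i
  proof -
    have "degree (L i) \<le> (\<Sum>j\<in>I - {i}. degree (smult (1 / (real i - real j)) [:- real j, 1:]))"
      unfolding L_def by (rule degree_prod_sum_le[unfolded comp_def]) (use assms in simp)
    also have "\<dots> \<le> (\<Sum>j\<in>I - {i}. 1)" by (intro sum_mono) simp
    also have "\<dots> < card I"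
      using card_Diff1_less[OF assms that] by (simp only: card_eq_sum[symmetric])
    finally show ?thesis .
  qed
  have "(\<Sum>i\<in>I. poly (L i) 0 * poly q (real i)) = poly q 0" if q: "degree q < card I" for q
  proof -
    define p where "p = (\<Sum>i\<in>I. smult (poly q (real i)) (L i))"
    have "p = q"
    proof (rule poly_eqI_degree[of "real ` I"])
      fix x assume "x \<in> real ` I"
      then obtain k where k: "k \<in> I" "x = real k" by blast
      have "poly p x = (\<Sum>i\<in>I. poly q (real i) * of_bool (k = i))"
        using at k by (simp add: p_def poly_sum)
      also have "\<dots> = poly q x"
        using assms k by (simp add: if_distrib sum.delta' of_bool_def cong: if_cong)
      finally show "poly p x = poly q x" .
    next
      have c: "card (real ` I) = card I" by (simp add: card_image)
      show "degree q < card (real ` I)" using q c by simp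
      have "degree p \<le> card I - 1" unfolding p_def
      proof (rule degree_sum_le[OF assms])
        fix i assume "i \<in> I"
        then show "degree (smult (poly q (real i)) (L i)) \<le> card I - 1"
          using deg[of i] degree_smult_le[of "poly q (real i)" "L i"] by linarith
      qed
      then show "degree p < card (real ` I)" using q c by linarith
    qed
    then have "poly q 0 = poly p 0" by simp
    then show ?thesis by (simp add: p_def poly_sum mult.commute)
  qed
  then show ?thesis by (intro exI[of _ "\<lambda>i. poly (L i) 0"]) blast
qed

text \<open>\<open>q\<close> is a product with one factor for each edge of \<open>F\<close>:
  \<open>kind_poly\<close> minus the number of edges of that kind already chosen, divided by the
  number of candidates. At 0 the factors for \<open>j \<noteq> 1\<close> are nonnegative, because
  \<open>M0\<close> has at most \<open>m / 2\<close> edges of each such kind. For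
  \<open>j = 1\<close> the first factor is 0 but later ones are negative, so the vanishing of
  \<open>q\<close> at 0 is carried through the induction.\<close>

lemma extensions_poly:
  assumes S: "finite S" "A \<subseteq> S" "card A = m" "card (S - A) = m"
    and M0: "M0 \<in> perfect_matchings S"
  shows "finite F \<Longrightarrow> F \<subseteq> M0 \<Longrightarrow> \<exists>q :: real poly. degree q \<le> card F \<and>
    (\<forall>i. real (card (extensions S A i F)) = real (card (level S A i)) * poly q (real i)) \<and>
    0 \<le> poly q 0 \<and> (kind A 1 F \<noteq> {} \<longrightarrow> poly q 0 = 0)"
proof (induction F rule: finite_induct)
  case empty
  show ?case by (intro exI[of _ 1]) (simp add: extensions_def kind_def)
next
  case (insert e F)
  then obtain q :: "real poly" where q: "degree q \<le> card F"
      "\<And>i. real (card (extensions S A i F)) = real (card (level S A i)) * poly q (real i)"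
      "0 \<le> poly q 0" "kind A 1 F \<noteq> {} \<Longrightarrow> poly q 0 = 0" by auto
  define j where "j = card (e \<inter> A)"
  define E where "E = {e'. e' \<subseteq> S - \<Union>F \<and> card e' = 2 \<and> card (e' \<inter> A) = j}"
  note rec = card_extensions_insert[OF S M0 insert.prems insert.hyps(2) j_def[symmetric] E_def]
  have finM0: "finite M0" using M0 S finite_pm(2) by blast
  define r where "r = smult (1 / real (card E)) (q * (kind_poly m j - [:real (card (kind A j F)):]))"
  have "degree r \<le> card (insert e F)"
  proof -
    let ?X = "kind_poly m j - [:real (card (kind A j F)):]"
    have "degree ?X \<le> 1" by (simp add: kind_poly_def)
    moreover have "degree r \<le> degree (q * ?X)" unfolding r_def by (rule degree_smult_le)
    moreover have "degree (q * ?X) \<le> degree q + degree ?X" by (rule degree_mult_le)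
    ultimately have "degree r \<le> card F + 1" using q(1) by linarith
    then show ?thesis using insert.hyps by simp
  qed
  moreover have "real (card (extensions S A i (insert e F))) = real (card (level S A i)) * poly r (real i)" for i
    using rec(1)[of i] rec(2) q(2)[of i] by (simp add: r_def field_simps)
  moreover have "0 \<le> poly r 0 \<and> (kind A 1 (insert e F) \<noteq> {} \<longrightarrow> poly r 0 = 0)"
  proof (cases "j = 1")
    case True
    \<comment> \<open>At 0 the new factor is a negative multiple of
      \<open>card (kind A 1 F)\<close>; either this number is 0 or \<open>poly q 0\<close>
      is.\<close>
    have "poly q 0 * real (card (kind A 1 F)) = 0" using q(4) by (cases "kind A 1 F = {}") auto
    then show ?thesis using True by (auto simp: r_def kind_poly_def)
  next
    case False
    have "card (e \<inter> A) \<le> 2"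
    proof -
      have "card e = 2" using insert.prems pm_edge(2)[OF M0] by blast
      then show ?thesis using card_mono[of e "e \<inter> A"] by (simp add: card_ge_0_finite)
    qed
    then have j2: "j \<le> 2" by (simp add: j_def)
    have "card (kind A j F) \<le> card (kind A j M0)"
      using insert.prems finM0 by (intro card_mono) (auto simp: kind_def)
    moreover have "real (card (kind A j M0)) \<le> real m / 2"
      using card_kind_poly[OF S M0 j2] False by (simp add: kind_poly_def)
    ultimately have "0 \<le> poly r 0" using q(3) False by (simp add: r_def kind_poly_def)
    moreover have "kind A 1 (insert e F) = kind A 1 F" using False by (auto simp: kind_def j_def)
    ultimately show ?thesis using q(4) by (auto simp: r_def)
  qed
  ultimately show ?case by blast
qed

text \<open>Weights that are constant on each level, with total \<open>\<alpha> i\<close> on level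
  \<open>i\<close>, turn sums over matchings into extrapolation of polynomials to 0. As the sides
  are odd, exactly the \<open>h + 1\<close> odd numbers up to \<open>2 * h + 1\<close> occur as
  crossing numbers, which suffices for degree up to \<open>h\<close>; the crossing number itself has
  degree 1, hence \<open>0 < h\<close>.\<close>

lemma exists_pseudo_distribution:
  assumes "finite A" "finite B" "A \<inter> B = {}" "card A = 2 * h + 1" "card B = 2 * h + 1" "0 < h"
  shows "\<exists>\<alpha> :: 'a set set \<Rightarrow> real.
    (\<Sum>M\<in>perfect_matchings (A \<union> B). \<alpha> M) = 1 \<and>
    (\<Sum>M\<in>perfect_matchings (A \<union> B). \<alpha> M * real (crossing A M)) = 0 \<and>
    (\<forall>M0\<in>perfect_matchings (A \<union> B). \<forall>T\<subseteq>M0. card T \<le> h \<longrightarrow>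
      0 \<le> (\<Sum>M | M \<in> perfect_matchings (A \<union> B) \<and> T \<subseteq> M. \<alpha> M))"
proof -
  define S where "S = A \<union> B"
  define m where "m = 2 * h + 1"
  have S: "finite S" "A \<subseteq> S" "card A = m" "card (S - A) = m"
    using assms Diff_triv[of B A] by (auto simp: S_def m_def Un_Diff Int_commute)
  define I where "I = (\<lambda>j. 2 * j + 1) ` {..h}"
  have cI: "card I = h + 1" and fI: "finite I" by (auto simp: I_def card_image inj_on_def)
  obtain \<alpha> :: "nat \<Rightarrow> real" where \<alpha>:
      "\<And>q. degree q < card I \<Longrightarrow> (\<Sum>i\<in>I. \<alpha> i * poly q (real i)) = poly q 0"
    using exists_extrapolation_weights[OF fI] by blast
  have level_pos: "card (level S A i) \<noteq> 0" if "i \<in> I" for i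
  proof -
    have "\<exists>M\<in>perfect_matchings S. crossing A M = i" unfolding S_def using that assms
      by (intro exists_perfect_matching_crossing[where m = m]) (auto simp: I_def m_def)
    then have "level S A i \<noteq> {}" by (auto simp: level_def)
    moreover have "finite (level S A i)" using finite_pm(1)[OF S(1)] by (simp add: level_def)
    ultimately show ?thesis by (simp add: card_gt_0_iff)
  qed
  have cross_I: "crossing A M \<in> I" if "M \<in> perfect_matchings S" for M
  proof -
    have "2 * card (kind A 2 M) + crossing A M = 2 * h + 1"
      using pm_card_inter[OF S(1) that S(2)] S(3) by (simp add: m_def)
    then show ?thesis unfolding I_def by (intro image_eqI[of _ _ "h - card (kind A 2 M)"]) auto
  qed
  define \<mu> where "\<mu> M = \<alpha> (crossing A M) / real (card (level S A (crossing A M)))" for M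
  have sum_levels: "(\<Sum>M | M \<in> perfect_matchings S \<and> F \<subseteq> M. \<mu> M * g (crossing A M)) =
      (\<Sum>i\<in>I. \<alpha> i * (real (card (extensions S A i F)) / real (card (level S A i)) * g i))" for F and g :: "nat \<Rightarrow> real"
  proof -
    let ?P = "{M. M \<in> perfect_matchings S \<and> F \<subseteq> M}"
    have "(\<Sum>M\<in>?P. \<mu> M * g (crossing A M)) =
        (\<Sum>i\<in>I. \<Sum>M | M \<in> ?P \<and> crossing A M = i. \<mu> M * g (crossing A M))"
      using cross_I finite_pm(1)[OF S(1)] fI by (intro sum.group[symmetric]) auto
    also have "\<dots> = (\<Sum>i\<in>I. \<alpha> i * (real (card (extensions S A i F)) / real (card (level S A i)) * g i))"
    proof (rule sum.cong)
      fix i assume "i \<in> I"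
      have "{M. M \<in> ?P \<and> crossing A M = i} = extensions S A i F"
        by (auto simp: extensions_def level_def)
      moreover have "(\<Sum>M\<in>extensions S A i F. \<mu> M * g (crossing A M)) =
          (\<Sum>M\<in>extensions S A i F. \<alpha> i / real (card (level S A i)) * g i)"
        by (intro sum.cong) (auto simp: extensions_def level_def \<mu>_def)
      ultimately show "(\<Sum>M | M \<in> ?P \<and> crossing A M = i. \<mu> M * g (crossing A M)) =
          \<alpha> i * (real (card (extensions S A i F)) / real (card (level S A i)) * g i)" by simp
    qed simp
    finally show ?thesis .
  qed
  have empty: "extensions S A i {} = level S A i" for i by (simp add: extensions_def)
  have "(\<Sum>M\<in>perfect_matchings S. \<mu> M) = (\<Sum>i\<in>I. \<alpha> i * poly 1 (real i))"
    using sum_levels[where F = "{}" and g = "\<lambda>_. 1"] level_pos by (simp add: empty cong: sum.cong)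
  also have "\<dots> = 1" using \<alpha>[of 1] cI by simp
  finally have 1: "(\<Sum>M\<in>perfect_matchings S. \<mu> M) = 1" .
  have "(\<Sum>M\<in>perfect_matchings S. \<mu> M * real (crossing A M)) = (\<Sum>i\<in>I. \<alpha> i * poly [:0, 1:] (real i))"
    using sum_levels[where F = "{}" and g = real] level_pos by (simp add: empty cong: sum.cong)
  also have "\<dots> = 0" using \<alpha>[of "[:0, 1:]"] cI assms(6) by simp
  finally have 2: "(\<Sum>M\<in>perfect_matchings S. \<mu> M * real (crossing A M)) = 0" .
  have 3: "0 \<le> (\<Sum>M | M \<in> perfect_matchings S \<and> T \<subseteq> M. \<mu> M)"
    if M0: "M0 \<in> perfect_matchings S" and T: "T \<subseteq> M0" "card T \<le> h" for M0 T
  proof -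
    have "finite T" using T M0 S finite_pm(2) finite_subset by metis
    then obtain q where q: "degree q \<le> card T"
        "\<And>i. real (card (extensions S A i T)) = real (card (level S A i)) * poly q (real i)" "0 \<le> poly q 0"
      using extensions_poly[OF S M0 _ T(1)] by blast
    have "(\<Sum>M | M \<in> perfect_matchings S \<and> T \<subseteq> M. \<mu> M) = (\<Sum>i\<in>I. \<alpha> i * poly q (real i))"
      using sum_levels[where F = T and g = "\<lambda>_. 1"] level_pos by (simp add: q(2) cong: sum.cong)
    also have "\<dots> = poly q 0" using q(1) T(2) cI by (intro \<alpha>) simp
    finally show ?thesis using q(3) by simp
  qed
  show ?thesis using 1 2 3 unfolding S_def by blast
qed

section \<open>Functions of a matching that depend on few nodes\<close>

definition touching :: "'a set \<Rightarrow> 'a set set \<Rightarrow> 'a set set"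
  where "touching W M = {e \<in> M. e \<inter> W \<noteq> {}}"

text \<open>Every node of \<open>W\<close> in \<open>S\<close> already has its edge in
  \<open>touching W M\<close>, so a perfect matching containing these edges has no further choice at
  \<open>W\<close>.\<close>

lemma touching_eqI:
  assumes "M \<in> perfect_matchings S" "M' \<in> perfect_matchings S" "touching W M \<subseteq> M'"
  shows "touching W M' = touching W M"
proof
  show "touching W M \<subseteq> touching W M'" using assms(3) by (auto simp: touching_def)
  show "touching W M' \<subseteq> touching W M"
  proof
    fix e assume "e \<in> touching W M'"
    then obtain w where e: "e \<in> M'" "w \<in> e" "w \<in> W" by (auto simp: touching_def)
    then have "w \<in> S" using pm_edge(1)[OF assms(2)] by blast
    then obtain e' where e': "e' \<in> M" "w \<in> e'" using pm_cover[OF assms(1)] by blast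
    then have "e' \<in> touching W M" using e by (auto simp: touching_def)
    then show "e \<in> touching W M" using pm_disjoint[OF assms(2) e(1) _ e(2) e'(2)] assms(3) by auto
  qed
qed

lemma card_touching_le:
  assumes "finite W" "finite S" "M \<in> perfect_matchings S"
  shows "card (touching W M) \<le> card W"
proof (rule surj_card_le[OF assms(1)])
  define g where "g w = (THE e. e \<in> M \<and> w \<in> e)" for w
  show "touching W M \<subseteq> g ` W"
  proof
    fix e assume "e \<in> touching W M"
    then obtain w where w: "e \<in> M" "w \<in> e" "w \<in> W" by (auto simp: touching_def)
    then have "g w = e" unfolding g_def using pm_disjoint[OF assms(3)] by (intro the_equality) auto
    then show "e \<in> g ` W" using w by blast
  qed
qed

text \<open>Matchings are grouped by \<open>T = touching W M\<close>, on which \<open>\<psi>\<close>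
  is constant. Having exactly the touching edges \<open>T\<close> is the same as containing
  \<open>T\<close>, and \<open>T\<close> has at most \<open>card W\<close> edges, so each group has
  nonnegative total weight.\<close>

lemma pseudo_distribution_nonneg:
  fixes \<alpha> \<psi> :: "'a set set \<Rightarrow> real"
  assumes "finite S" "finite W" "card W \<le> h"
    and \<alpha>: "\<And>M0 T. M0 \<in> perfect_matchings S \<Longrightarrow> T \<subseteq> M0 \<Longrightarrow> card T \<le> h \<Longrightarrow>
      0 \<le> (\<Sum>M | M \<in> perfect_matchings S \<and> T \<subseteq> M. \<alpha> M)"
    and nonneg: "\<And>M. M \<in> perfect_matchings S \<Longrightarrow> 0 \<le> \<psi> M"
    and local: "\<And>M M'. M \<in> perfect_matchings S \<Longrightarrow> M' \<in> perfect_matchings S \<Longrightarrow>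
      touching W M = touching W M' \<Longrightarrow> \<psi> M = \<psi> M'"
  shows "0 \<le> (\<Sum>M\<in>perfect_matchings S. \<alpha> M * \<psi> M)"
proof -
  let ?P = "perfect_matchings S"
  have "(\<Sum>M\<in>?P. \<alpha> M * \<psi> M) = (\<Sum>T\<in>touching W ` ?P. \<Sum>M | M \<in> ?P \<and> touching W M = T. \<alpha> M * \<psi> M)"
    using finite_pm(1)[OF assms(1)] by (rule sum.image_gen)
  moreover have "0 \<le> (\<Sum>M | M \<in> ?P \<and> touching W M = T. \<alpha> M * \<psi> M)" if T: "T \<in> touching W ` ?P" for T
  proof -
    obtain M0 where M0: "M0 \<in> ?P" "T = touching W M0" using T by blast
    have eq: "{M. M \<in> ?P \<and> touching W M = T} = {M. M \<in> ?P \<and> T \<subseteq> M}"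
    proof (intro Collect_cong conj_cong refl iffI)
      fix M assume "M \<in> ?P" "T \<subseteq> M"
      then show "touching W M = T" using touching_eqI M0 by blast
    qed (auto simp: touching_def)
    have "(\<Sum>M | M \<in> ?P \<and> touching W M = T. \<alpha> M * \<psi> M) =
        (\<Sum>M | M \<in> ?P \<and> touching W M = T. \<alpha> M * \<psi> M0)"
    proof (rule sum.cong)
      fix M assume "M \<in> {M. M \<in> ?P \<and> touching W M = T}"
      then have "\<psi> M = \<psi> M0" using M0 by (intro local) auto
      then show "\<alpha> M * \<psi> M = \<alpha> M * \<psi> M0" by simp
    qed simp
    also have "\<dots> = (\<Sum>M | M \<in> ?P \<and> T \<subseteq> M. \<alpha> M) * \<psi> M0" unfolding eq by (simp add: sum_distrib_right)
    also have "0 \<le> \<dots>"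
    proof (rule mult_nonneg_nonneg)
      show "0 \<le> (\<Sum>M | M \<in> ?P \<and> T \<subseteq> M. \<alpha> M)"
      proof (rule \<alpha>[OF M0(1)])
        show "T \<subseteq> M0" using M0(2) by (auto simp: touching_def)
        show "card T \<le> h" using card_touching_le[OF assms(2,1) M0(1)] M0(2) assms(3) by simp
      qed
      show "0 \<le> \<psi> M0" using M0(1) by (rule nonneg)
    qed
    finally show ?thesis .
  qed
  ultimately show ?thesis by (simp only: sum_nonneg)
qed

text \<open>\<open>M\<close> is moved towards \<open>M'\<close> one edge at a time. For
  \<open>{u, v'}\<close> in \<open>M'\<close> and \<open>{u, v}\<close> in \<open>M\<close>, the
  3-cycle \<open>u, v', v\<close> maps the second edge to the first, avoids \<open>W\<close> and
  keeps all common edges. It replaces the transposition of \<open>v\<close> and \<open>v'\<close>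
  because only even permutations are available.\<close>

lemma local_if_cyc3_invariant:
  assumes S: "finite S"
    and inv: "\<And>a b c M. a \<in> S - W \<Longrightarrow> b \<in> S - W \<Longrightarrow> c \<in> S - W \<Longrightarrow> distinct [a, b, c] \<Longrightarrow>
      M \<in> perfect_matchings S \<Longrightarrow> \<psi> ((`) (cyc3 a b c) ` M) = \<psi> M"
    and M': "M' \<in> perfect_matchings S"
  shows "M \<in> perfect_matchings S \<Longrightarrow> touching W M = touching W M' \<Longrightarrow> \<psi> M = \<psi> M'"
proof (induction "card (M' - M)" arbitrary: M rule: less_induct)
  case less
  note M = less.prems(1) and T = less.prems(2)
  show ?case
  proof (cases "M' \<subseteq> M")
    case True
    have "M \<subseteq> M'"
    proof
      fix e assume e: "e \<in> M"
      then obtain v where v: "v \<in> e" "v \<in> S"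
        using pm_edge[OF M e] by (metis card.empty ex_in_conv subsetD zero_neq_numeral)
      then obtain e' where "e' \<in> M'" "v \<in> e'" using pm_cover[OF M'] by blast
      then show "e \<in> M'" using pm_disjoint[OF M e] True v by blast
    qed
    then show ?thesis using True by simp
  next
    case False
    then obtain e' where e': "e' \<in> M'" "e' \<notin> M" by blast
    then obtain u v' where uv': "e' = {u, v'}" "u \<noteq> v'"
      using pm_edge(2)[OF M'] by (meson card_2_iff)
    have inS: "u \<in> S" "v' \<in> S" using pm_edge(1)[OF M' e'(1)] uv' by auto
    obtain e where e: "e \<in> M" "u \<in> e" using pm_cover[OF M inS(1)] by blast
    obtain x y where xy: "e = {x, y}" "x \<noteq> y" using pm_edge(2)[OF M e(1)] by (meson card_2_iff)
    then obtain v where uv: "e = {u, v}" "u \<noteq> v" using e(2) by (cases "u = x") auto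
    have vv': "v \<noteq> v'" and vS: "v \<in> S" using e' e uv uv' pm_edge(1)[OF M e(1)] by auto
    have "e' \<inter> W = {}" using T e' by (auto simp: touching_def)
    have "e \<notin> M'" using pm_disjoint[OF M' e'(1), of e u] uv'(1) e' e by blast
    have "e \<inter> W = {}"
    proof (rule ccontr)
      assume "e \<inter> W \<noteq> {}"
      then have "e \<in> touching W M" using e(1) by (simp add: touching_def)
      then show False using \<open>e \<notin> M'\<close> unfolding T by (simp add: touching_def)
    qed
    with \<open>e' \<inter> W = {}\<close> have W: "u \<in> S - W" "v' \<in> S - W" "v \<in> S - W"
      using uv(1) uv'(1) inS vS by auto
    define g where "g = cyc3 u v' v"
    have g: "g u = v'" "g v' = v" "g v = u" using uv uv' vv' by (auto simp: g_def cyc3_def)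
    have "bij g" using g by (intro o_bij[of "cyc3 u v v'"]) (auto simp: g_def cyc3_def fun_eq_iff)
    then have inj: "inj g" by (simp add: bij_def)
    have "g ` S = S"
    proof -
      have "g ` S \<subseteq> S" using inS vS by (auto simp: g_def cyc3_def)
      then show ?thesis using endo_inj_surj[OF S] inj inj_on_subset by blast
    qed
    define M1 where "M1 = (`) g ` M"
    have M1: "M1 \<in> perfect_matchings S" using pm_image[OF inj M] \<open>g ` S = S\<close> by (simp add: M1_def)
    have e'M1: "e' \<in> M1"
    proof -
      have "g ` e = e'" using g uv uv' by auto
      then show ?thesis using e by (auto simp: M1_def)
    qed
    have keep: "f \<in> M1" if f: "f \<in> M" "f \<in> M'" for f
    proof -
      have "v' \<notin> f" "u \<notin> f" using pm_disjoint[OF M' e'(1) f(2)] f(1) e'(2) uv'(1) by blast+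
      moreover have "v \<notin> f" using pm_disjoint[OF M e(1) f(1)] f(2) \<open>e \<notin> M'\<close> uv(1) by blast
      ultimately have "g w = w" if "w \<in> f" for w using that by (auto simp: g_def cyc3_def)
      then have "g ` f = f" by simp
      then show ?thesis using f(1) unfolding M1_def by (metis imageI)
    qed
    have "touching W M1 = touching W M'"
    proof (rule touching_eqI[OF M' M1])
      show "touching W M' \<subseteq> M1"
      proof
        fix f assume f: "f \<in> touching W M'"
        then have "f \<in> touching W M" by (simp only: T)
        then show "f \<in> M1" using f keep by (simp add: touching_def)
      qed
    qed
    moreover have "M' - M1 \<subset> M' - M" using keep e' e'M1 by blast
    then have "card (M' - M1) < card (M' - M)"
      using finite_pm(2)[OF S M'] by (intro psubset_card_mono) auto
    ultimately have "\<psi> M1 = \<psi> M'" using less.hyps M1 by blast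
    moreover have "\<psi> M1 = \<psi> M" unfolding M1_def g_def using W uv uv' vv' M by (intro inv) auto
    ultimately show ?thesis by simp
  qed
qed

subsection \<open>Cycles over a matching\<close>

abbreviation polygon :: "(nat \<Rightarrow> nat) \<Rightarrow> nat \<Rightarrow> nat set set"
  where "polygon f l \<equiv> (\<lambda>i. {f i, f (Suc i mod l)}) ` {..<l}"

lemma cyclesE:
  assumes "C \<in> cycles l n"
  obtains f where "3 \<le> l" "inj_on f {..<l}" "f ` {..<l} \<subseteq> {1..n}" "C = polygon f l"
proof -
  obtain vs where vs: "distinct vs" "length vs = l" "3 \<le> l" "set vs \<subseteq> {1..n}"
      "C = {{vs ! i, vs ! (Suc i mod l)} | i. i < l}" using assms by (auto simp: cycles_def)
  show thesis
  proof (rule that[of "(!) vs"])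
    show "inj_on ((!) vs) {..<l}" using vs by (simp add: inj_on_nth)
    show "(!) vs ` {..<l} \<subseteq> {1..n}" using vs(2,4) by (auto simp: subset_iff)
    show "C = (\<lambda>i. {vs ! i, vs ! (Suc i mod l)}) ` {..<l}" using vs(5) by auto
  qed (rule vs(3))
qed

lemma cyclesI:
  assumes "3 \<le> l" "inj_on f {..<l}" "f ` {..<l} \<subseteq> {1..n}"
  shows "polygon f l \<in> cycles l n"
proof -
  have nth: "map f [0..<l] ! (Suc i mod l) = f (Suc i mod l)" if "i < l" for i using that by simp
  have "distinct (map f [0..<l])" "set (map f [0..<l]) \<subseteq> {1..n}"
    using assms(2,3) by (auto simp: distinct_map atLeast0LessThan)
  moreover have set: "g ` {..<l} = {g i |i. i < l}" for g :: "nat \<Rightarrow> nat set" by auto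
  have "polygon f l =
      (\<lambda>i. {map f [0..<l] ! i, map f [0..<l] ! (Suc i mod l)}) ` {..<l}"
    using nth by (intro image_cong) auto
  note trans[OF this set]
  ultimately show ?thesis
    unfolding cycles_def using assms(1)
    by (intro CollectI exI[of _ "map f [0..<l]"] conjI) (assumption | simp only: length_map length_upt minus_nat.diff_0)+
qed

lemma finite_cycles: "finite (cycles l n)"
proof (rule finite_subset)
  show "cycles l n \<subseteq> Pow (Pow {1..n})"
  proof
    fix C assume "C \<in> cycles l n"
    then obtain f where f: "3 \<le> l" "f ` {..<l} \<subseteq> {1..n}" "C = polygon f l" by (rule cyclesE)
    have "{f i, f (Suc i mod l)} \<subseteq> {1..n}" if "i < l" for i
    proof -
      have "Suc i mod l < l" using f(1) by simp
      then show ?thesis using f(2) that by (simp add: image_subset_iff)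
    qed
    then show "C \<in> Pow (Pow {1..n})" using f(3) by auto
  qed
qed simp

lemma card_cycle_edge:
  assumes "C \<in> cycles l n" "e \<in> C"
  shows "card e = 2"
proof -
  obtain f where f: "3 \<le> l" "inj_on f {..<l}" "C = polygon f l" using assms(1) by (rule cyclesE)
  obtain i where i: "i < l" "e = {f i, f (Suc i mod l)}" using assms(2) f(3) by auto
  have "Suc i mod l \<noteq> i" "Suc i mod l < l" using i(1) f(1) by (auto simp: mod_Suc)
  then have "f i \<noteq> f (Suc i mod l)" using f(2) i(1) by (metis inj_onD lessThan_iff)
  then show ?thesis using i by simp
qed

lemma cycle_degree:
  assumes "C \<in> cycles l n" "v \<in> \<Union>C"
  shows "card {e \<in> C. v \<in> e} = 2"
proof -
  obtain f where f: "3 \<le> l" "inj_on f {..<l}" "C = polygon f l" using assms(1) by (rule cyclesE)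
  define E where "E i = {f i, f (Suc i mod l)}" for i
  have eq: "f i = f j \<longleftrightarrow> i = j" if "i < l" "j < l" for i j using f(2) that by (auto simp: inj_on_def)
  have lt: "Suc i mod l < l" for i using f(1) by simp
  have CE: "C = E ` {..<l}" using f(3) by (simp add: E_def)
  obtain i0 where "i0 < l" "v \<in> E i0" using assms(2) CE by auto
  then obtain k where k: "k < l" "v = f k" using lt[of i0] unfolding E_def by blast
  \<comment> \<open>The cyclic predecessor of \<open>k\<close>; truncated subtraction alone would
    give 0 for \<open>k = 0\<close>.\<close>
  define k' where "k' = (if k = 0 then l - 1 else k - 1)"
  have k': "k' < l" "Suc k' mod l = k" "k' \<noteq> k" using k(1) f(1) by (auto simp: k'_def mod_Suc)
  have uniq: "i = k'" if "i < l" "Suc i mod l = k" for i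
    using that k(1) f(1) by (auto simp: k'_def mod_Suc split: if_splits)
  have "{e \<in> C. v \<in> e} = {E k, E k'}"
  proof
    show "{e \<in> C. v \<in> e} \<subseteq> {E k, E k'}"
    proof
      fix e assume "e \<in> {e \<in> C. v \<in> e}"
      then obtain i where i: "i < l" "e = E i" "v \<in> E i" using CE by auto
      then have "f k = f i \<or> f k = f (Suc i mod l)" using k by (simp add: E_def)
      then have "k = i \<or> k = Suc i mod l" using eq[OF k(1) i(1)] eq[OF k(1) lt] by blast
      then show "e \<in> {E k, E k'}" using i uniq by blast
    qed
    show "{E k, E k'} \<subseteq> {e \<in> C. v \<in> e}" using k k' CE by (auto simp: E_def)
  qed
  \<comment> \<open>This is where \<open>3 \<le> l\<close> enters: on a polygon of length 2 both
    edges at \<open>v\<close> would coincide.\<close>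
  moreover have "E k \<noteq> E k'"
  proof
    assume "E k = E k'"
    then have "f (Suc k mod l) = f k' \<or> f (Suc k mod l) = f k" using k' by (auto simp: E_def)
    then have "Suc k mod l = k' \<or> Suc k mod l = k" using eq[OF lt k'(1)] eq[OF lt k(1)] by blast
    then show False using k(1) f(1) by (auto simp: k'_def mod_Suc split: if_splits)
  qed
  ultimately show ?thesis by simp
qed

section \<open>Action of node permutations on cycles and their characteristic vectors\<close>

lemma cycles_image:
  assumes "\<pi> permutes {1..n}" "C \<in> cycles l n"
  shows "(`) \<pi> ` C \<in> cycles l n"
proof -
  obtain f where f: "3 \<le> l" "inj_on f {..<l}" "f ` {..<l} \<subseteq> {1..n}"
      "C = polygon f l" using assms(2) by (rule cyclesE)
  have "(`) \<pi> ` C = polygon (\<pi> \<circ> f) l" unfolding f(4) image_image by simp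
  also have "\<dots> \<in> cycles l n"
  proof (rule cyclesI[OF f(1)])
    show "inj_on (\<pi> \<circ> f) {..<l}"
      using f(2) permutes_inj[OF assms(1)] by (simp add: comp_inj_on inj_on_subset)
    show "(\<pi> \<circ> f) ` {..<l} \<subseteq> {1..n}"
    proof -
      have "\<pi> ` f ` {..<l} \<subseteq> \<pi> ` {1..n}" using f(3) by (rule image_mono)
      then show ?thesis using permutes_image[OF assms(1)] by (simp add: image_comp)
    qed
  qed
  finally show ?thesis .
qed

lemma node_action_indicator:
  assumes "bij \<pi>"
  shows "node_action \<pi> (indicat_real C) = indicat_real ((`) \<pi> ` C)"
proof
  fix e
  have "inv \<pi> ` e \<in> C \<longleftrightarrow> e \<in> (`) \<pi> ` C"
  proof
    assume "inv \<pi> ` e \<in> C"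
    moreover have "\<pi> ` inv \<pi> ` e = e" using assms by (simp add: bij_is_surj image_f_inv_f)
    ultimately show "e \<in> (`) \<pi> ` C" by (metis imageI)
  next
    assume "e \<in> (`) \<pi> ` C"
    then show "inv \<pi> ` e \<in> C" using assms by (auto simp: bij_is_inj inv_f_f image_comp comp_def)
  qed
  then show "node_action \<pi> (indicat_real C) e = indicat_real ((`) \<pi> ` C) e"
    by (simp add: node_action_def indicator_def)
qed

lemma inj_node_action:
  assumes "bij \<pi>"
  shows "inj (node_action \<pi>)"
proof (rule injI)
  fix x y assume eq: "node_action \<pi> x = node_action \<pi> y"
  show "x = y"
  proof
    fix e
    have "inv \<pi> ` \<pi> ` e = e" using assms by (simp add: bij_is_inj image_inv_f_f)
    then show "x e = y e" using fun_cong[OF eq, of "\<pi> ` e"] by (simp add: node_action_def)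
  qed
qed

section \<open>Nodes with copies, and cycles lying over a matching\<close>

definition doubled :: "nat \<Rightarrow> (nat \<Rightarrow> nat) \<Rightarrow> nat \<Rightarrow> nat"
  where "doubled N \<pi> x = (if x \<in> {1..N} then \<pi> x else if x \<in> {N + 1..2 * N} then N + \<pi> (x - N) else x)"

lemma doubled_low: "x \<in> {1..N} \<Longrightarrow> doubled N \<pi> x = \<pi> x"
  and doubled_high: "x \<in> {1..N} \<Longrightarrow> doubled N \<pi> (N + x) = N + \<pi> x"
  and doubled_other: "x \<notin> {1..2 * N} \<Longrightarrow> doubled N \<pi> x = x" by (auto simp: doubled_def)

lemma doubled_cases:
  fixes x N :: nat
  obtains "x \<in> {1..N}" | y where "y \<in> {1..N}" "x = N + y" | "x \<notin> {1..2 * N}"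
proof -
  have "x \<in> {1..N} \<or> x - N \<in> {1..N} \<and> x = N + (x - N) \<or> x \<notin> {1..2 * N}" by auto
  then show thesis using that by blast
qed

lemma doubled_comp:
  assumes "\<tau> permutes {1..N}"
  shows "doubled N (\<sigma> \<circ> \<tau>) = doubled N \<sigma> \<circ> doubled N \<tau>"
proof
  fix x
  have mem: "\<tau> y \<in> {1..N} \<longleftrightarrow> y \<in> {1..N}" for y by (rule permutes_in_image[OF assms])
  show "doubled N (\<sigma> \<circ> \<tau>) x = (doubled N \<sigma> \<circ> doubled N \<tau>) x"
    by (cases x rule: doubled_cases[where N = N])
      (simp_all add: doubled_low doubled_high doubled_other mem del: atLeastAtMost_iff One_nat_def)
qed

lemma doubled_inv:
  assumes "\<pi> permutes {1..N}"
  shows "doubled N (inv \<pi>) \<circ> doubled N \<pi> = id" "doubled N \<pi> \<circ> doubled N (inv \<pi>) = id"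
proof -
  have "doubled N id = id" by (auto simp: doubled_def fun_eq_iff)
  then show "doubled N (inv \<pi>) \<circ> doubled N \<pi> = id" "doubled N \<pi> \<circ> doubled N (inv \<pi>) = id"
    using doubled_comp[OF assms] doubled_comp[OF permutes_inv[OF assms]] permutes_inv_o[OF assms] by metis+
qed

lemma doubled_permutes:
  assumes "\<pi> permutes {1..N}" "2 * N \<le> n"
  shows "doubled N \<pi> permutes {1..n}"
proof -
  have "bij (doubled N \<pi>)" using doubled_inv[OF assms(1)] by (rule o_bij)
  moreover have "doubled N \<pi> x = x" if "x \<notin> {1..n}" for x
    using that assms(2) by (auto simp: doubled_def)
  ultimately show ?thesis by (simp add: permutes_def bij_iff)
qed

text \<open>Node \<open>N + v\<close> is the copy of node \<open>v \<le> N\<close>; the symmetric group of the first \<open>N\<close> nodes acts on both.\<close>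

definition fibre :: "nat \<Rightarrow> nat \<Rightarrow> nat \<Rightarrow> nat set set \<Rightarrow> nat set set set"
  where "fibre l n N M = {C \<in> cycles l n. {e \<in> C. e \<subseteq> {1..N}} = M \<and> (\<forall>v\<in>\<Union>M. {v, N + v} \<in> C)}"

lemma finite_fibre: "finite (fibre l n N M)" using finite_cycles by (simp add: fibre_def)

lemma fibre_image_subset:
  assumes \<pi>: "\<pi> permutes {1..N}" "2 * N \<le> n" and C: "C \<in> fibre l n N M"
  shows "(`) (doubled N \<pi>) ` C \<in> fibre l n N ((`) \<pi> ` M)"
proof -
  let ?p = "doubled N \<pi>"
  have C': "C \<in> cycles l n" "{e \<in> C. e \<subseteq> {1..N}} = M" "\<And>v. v \<in> \<Union>M \<Longrightarrow> {v, N + v} \<in> C"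
    using C by (auto simp: fibre_def)
  have p_in: "?p x \<in> {1..N} \<longleftrightarrow> x \<in> {1..N}" for x
  proof (cases x rule: doubled_cases[where N = N])
    case 1
    then show ?thesis
      using permutes_in_image[OF \<pi>(1), of x] by (simp add: doubled_low del: atLeastAtMost_iff One_nat_def)
  next
    case (2 y)
    have "N + \<pi> y \<notin> {1..N}" "N + y \<notin> {1..N}" using 2(1) permutes_in_image[OF \<pi>(1), of y] by auto
    then show ?thesis using 2 by (simp add: doubled_high del: atLeastAtMost_iff One_nat_def)
  next
    case 3
    then show ?thesis by (simp add: doubled_other del: atLeastAtMost_iff One_nat_def)
  qed
  have p_eq: "?p ` e = \<pi> ` e" if "e \<subseteq> {1..N}" for e
    using that by (intro image_cong) (auto simp: doubled_def)
  have p_sub: "?p ` e \<subseteq> {1..N} \<longleftrightarrow> e \<subseteq> {1..N}" for e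
    by (simp only: image_subset_iff p_in) (simp only: subset_eq)
  have "{e \<in> (`) ?p ` C. e \<subseteq> {1..N}} = (`) ?p ` {e \<in> C. e \<subseteq> {1..N}}" using p_sub by auto
  also have "\<dots> = (`) \<pi> ` M"
    unfolding C'(2)[symmetric] by (rule image_cong[OF refl]) (use p_eq in blast)
  finally have "{e \<in> (`) ?p ` C. e \<subseteq> {1..N}} = (`) \<pi> ` M" .
  moreover have "{w, N + w} \<in> (`) ?p ` C" if w: "w \<in> \<Union>((`) \<pi> ` M)" for w
  proof -
    obtain e v where v: "e \<in> M" "v \<in> e" "w = \<pi> v" using w by auto
    have "v \<in> {1..N}" using v C'(2) by blast
    then have "?p v = w" "?p (N + v) = N + w" using v(3) by (auto simp: doubled_def)
    then have "{w, N + w} = ?p ` {v, N + v}" by simp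
    then show ?thesis using C'(3) v by blast
  qed
  moreover have "(`) ?p ` C \<in> cycles l n" by (rule cycles_image[OF doubled_permutes[OF \<pi>] C'(1)])
  ultimately show ?thesis unfolding fibre_def by (intro CollectI conjI ballI)
qed

lemma fibre_image_bij:
  assumes "\<pi> permutes {1..N}" "2 * N \<le> n"
  shows "bij_betw (\<lambda>C. (`) (doubled N \<pi>) ` C) (fibre l n N M) (fibre l n N ((`) \<pi> ` M))"
proof (rule bij_betw_byWitness[where f' = "\<lambda>C. (`) (doubled N (inv \<pi>)) ` C"])
  have cancel: "(`) g ` ((`) f ` C) = C" if "g \<circ> f = id" for f g :: "nat \<Rightarrow> nat" and C
    using that by (simp add: image_comp)
  show "\<forall>C\<in>fibre l n N M. (`) (doubled N (inv \<pi>)) ` (`) (doubled N \<pi>) ` C = C"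
    using cancel doubled_inv[OF assms(1)] by blast
  show "\<forall>C\<in>fibre l n N ((`) \<pi> ` M). (`) (doubled N \<pi>) ` (`) (doubled N (inv \<pi>)) ` C = C"
    using cancel doubled_inv[OF assms(1)] by blast
  show "(\<lambda>C. (`) (doubled N \<pi>) ` C) ` fibre l n N M \<subseteq> fibre l n N ((`) \<pi> ` M)"
    using fibre_image_subset[OF assms] by blast
  show "(\<lambda>C. (`) (doubled N (inv \<pi>)) ` C) ` fibre l n N ((`) \<pi> ` M) \<subseteq> fibre l n N M"
    using fibre_image_subset[OF permutes_inv[OF assms(1)] assms(2), of _ l "(`) \<pi> ` M"]
      cancel[OF permutes_inv_o(2)[OF assms(1)]] by auto
qed

text \<open>Each edge \<open>{a, b}\<close> of \<open>M\<close> becomes a block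
  \<open>N + a, a, b, N + b\<close> of consecutive nodes; the blocks are strung together and the
  cycle is completed by nodes above \<open>N\<close> that are not copies of
  \<open>{1..2 * m}\<close>. Two nodes up to \<open>N\<close> are then adjacent only in the middle
  of a block.\<close>

lemma fibre_nonempty:
  assumes M: "M \<in> perfect_matchings {1..2 * m}" and l: "4 * m \<le> l" "3 \<le> l"
    and N: "2 * m \<le> N" "N + l \<le> n + 2 * m"
  shows "fibre l n N M \<noteq> {}"
proof -
  let ?S = "{1..2 * m}"
  have cM: "card M = m"
  proof -
    have "e \<inter> ?S = e" "card e = 2" if "e \<in> M" for e using pm_edge[OF M that] by auto
    then have "kind ?S 2 M = M" "kind ?S 1 M = {}" by (auto simp: kind_def)
    then show ?thesis using pm_card_inter[of ?S M ?S] M by simp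
  qed
  have fM: "finite M" using finite_pm(2)[OF _ M] by simp
  obtain e where e: "bij_betw e {..<m} M"
    using ex_bij_betw_nat_finite[OF fM] cM by (auto simp: atLeast0LessThan)
  have "\<exists>x y. e j = {x, y} \<and> x \<noteq> y" if "j < m" for j
    using pm_edge(2)[OF M, of "e j"] bij_betwE[OF e] that by (metis card_2_iff lessThan_iff)
  then obtain a b where ab: "\<And>j. j < m \<Longrightarrow> e j = {a j, b j}" "\<And>j. j < m \<Longrightarrow> a j \<noteq> b j" by metis
  have eM: "e j \<in> M" if "j < m" for j using bij_betwE[OF e] that by simp
  have abS: "a j \<in> ?S" "b j \<in> ?S" if "j < m" for j
    using pm_edge(1)[OF M eM[OF that]] ab(1)[OF that] by auto
  have same: "i = j" if "i < m" "j < m" "x \<in> e i" "x \<in> e j" for i j x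
    using pm_disjoint[OF M eM eM] that e by (auto simp: bij_betw_def inj_on_def)
  have mem: "a j \<in> e j" "b j \<in> e j" if "j < m" for j using ab(1)[OF that] by auto
  have aa: "a i = a j \<longleftrightarrow> i = j" if "i < m" "j < m" for i j
    using same[OF that, of "a i"] mem that by metis
  have bb: "b i = b j \<longleftrightarrow> i = j" if "i < m" "j < m" for i j
    using same[OF that, of "b i"] mem that by metis
  have nab: "a i \<noteq> b j" if "i < m" "j < m" for i j
    using same[OF that, of "a i"] mem that ab(2) by metis
  \<comment> \<open>The nodes available for completing the cycle. There are at least
    \<open>n - N - 2 * m\<close> of them, and \<open>N + l \<le> n + 2 * m\<close> makes this at
    least \<open>l - 4 * m\<close>.\<close>
  define T where "T = {N + 1..n} - (\<lambda>v. N + v) ` ?S"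
  have "card T \<ge> l - 4 * m"
  proof -
    have "card ((\<lambda>v. N + v) ` ?S) = 2 * m" by (simp add: card_image)
    then have "card T \<ge> (n - N) - 2 * m"
      using diff_card_le_card_Diff[of "(\<lambda>v. N + v) ` ?S" "{N + 1..n}"] by (simp add: T_def)
    then show ?thesis using N l by linarith
  qed
  then obtain T' where T': "T' \<subseteq> T" "card T' = l - 4 * m" "finite T'"
    using obtain_subset_with_card_n by metis
  obtain x where x: "bij_betw x {..<l - 4 * m} T'"
    using ex_bij_betw_nat_finite[OF T'(3)] T'(2) by (auto simp: atLeast0LessThan)
  have xT: "x i \<in> T" if "i < l - 4 * m" for i using bij_betwE[OF x] T'(1) that by blast
  define f where "f i = (if i < 4 * m then
      (if i mod 4 = 0 then N + a (i div 4) else if i mod 4 = 1 then a (i div 4)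
       else if i mod 4 = 2 then b (i div 4) else N + b (i div 4))
      else x (i - 4 * m))" for i
  have f4: "f (4 * j) = N + a j" "f (4 * j + 1) = a j" "f (4 * j + 2) = b j" "f (4 * j + 3) = N + b j"
    if "j < m" for j
  proof -
    have *: "4 * j < 4 * m" "4 * j + 1 < 4 * m" "4 * j + 2 < 4 * m" "4 * j + 3 < 4 * m"
      using that by linarith+
    have **: "(4 * j + 1) div 4 = j" "(4 * j + 1) mod 4 = 1" "(4 * j + 2) div 4 = j" "(4 * j + 2) mod 4 = 2"
        "(4 * j + 3) div 4 = j" "(4 * j + 3) mod 4 = 3" "4 * j div 4 = j" "4 * j mod 4 = 0"
      by presburger+
    show "f (4 * j) = N + a j" "f (4 * j + 1) = a j" "f (4 * j + 2) = b j" "f (4 * j + 3) = N + b j"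
      unfolding f_def ** using * by simp_all
  qed
  let ?q = "\<lambda>i j. i = 4 * j \<or> i = 4 * j + 1 \<or> i = 4 * j + 2 \<or> i = 4 * j + 3"
  have cases4: "\<exists>j<m. ?q i j" if "i < 4 * m" for i
  proof (intro exI[of _ "i div 4"] conjI)
    show "i div 4 < m" using that by linarith
  qed presburger
  have ex: "f i \<in> T" "f i = x (i - 4 * m)" "i - 4 * m < l - 4 * m" if "\<not> i < 4 * m" "i < l" for i
  proof -
    show "i - 4 * m < l - 4 * m" using that by linarith
    then show "f i \<in> T" using that xT by (simp add: f_def)
    show "f i = x (i - 4 * m)" using that by (simp add: f_def)
  qed
  have Tgt: "N < y" "y \<le> n" "y - N \<notin> ?S" if "y \<in> T" for y using that by (auto simp: T_def image_iff)
  have low: "f i \<le> N \<longleftrightarrow> i < 4 * m \<and> (\<exists>j<m. i = 4 * j + 1 \<or> i = 4 * j + 2)" if "i < l" for i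
  proof (cases "i < 4 * m")
    case True
    then obtain j where j: "j < m" "?q i j" using cases4 by blast
    have "a j \<ge> 1" "b j \<ge> 1" "a j \<le> N" "b j \<le> N" using abS[OF j(1)] N(1) by auto
    moreover have "\<not> (\<exists>j'<m. 4 * j = 4 * j' + 1 \<or> 4 * j = 4 * j' + 2)"
        "\<not> (\<exists>j'<m. 4 * j + 3 = 4 * j' + 1 \<or> 4 * j + 3 = 4 * j' + 2)" by presburger+
    ultimately show ?thesis using j(2) f4[OF j(1)] True j(1) by auto
  next
    case False
    then show ?thesis using Tgt(1)[OF ex(1)[OF False that]] by simp
  qed
  have "inj_on f {..<l}"
  proof (rule inj_onI)
    fix i i' assume ii: "i \<in> {..<l}" "i' \<in> {..<l}" "f i = f i'"
    have mixed: False if lt: "i < 4 * m" and ge: "\<not> i' < 4 * m" "i' < l" "f i = f i'" for i i'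
    proof -
      obtain j where j: "j < m" "?q i j" using cases4 lt by blast
      have "f i \<in> T" using ex(1) ge by simp
      then have "N < f i" "f i - N \<notin> ?S" using Tgt by auto
      then show False using j f4[OF j(1)] abS[OF j(1)] N(1) by auto
    qed
    show "i = i'"
    proof (cases "i < 4 * m"; cases "i' < 4 * m")
      assume lt: "i < 4 * m" "i' < 4 * m"
      obtain j where j: "j < m" "?q i j" using cases4 lt(1) by blast
      obtain j' where j': "j' < m" "?q i' j'" using cases4 lt(2) by blast
      have bnd: "a j \<in> ?S" "b j \<in> ?S" "a j' \<in> ?S" "b j' \<in> ?S" using abS j j' by auto
      have ne: "a j \<noteq> N + y" "b j \<noteq> N + y" "a j' \<noteq> N + y" "b j' \<noteq> N + y" if "y \<in> ?S" for y
        using bnd that N(1) by auto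
      note ne = ne[OF bnd(1)] ne[OF bnd(2)] ne[OF bnd(3)] ne[OF bnd(4)]
      have "i = 4 * j \<and> f i = N + a j \<or> i = 4 * j + 1 \<and> f i = a j \<or>
          i = 4 * j + 2 \<and> f i = b j \<or> i = 4 * j + 3 \<and> f i = N + b j" using j(2) f4[OF j(1)] by metis
      moreover have "i' = 4 * j' \<and> f i' = N + a j' \<or> i' = 4 * j' + 1 \<and> f i' = a j' \<or>
          i' = 4 * j' + 2 \<and> f i' = b j' \<or> i' = 4 * j' + 3 \<and> f i' = N + b j'"
        using j'(2) f4[OF j'(1)] by metis
      moreover note ii(3)
      ultimately show ?thesis
        by (elim disjE conjE) (simp_all add: aa[OF j(1) j'(1)] bb[OF j(1) j'(1)]
          nab[OF j(1) j'(1)] nab[OF j'(1) j(1)] nab[OF j(1) j'(1), symmetric] nab[OF j'(1) j(1), symmetric]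
          ne ne[symmetric])
    next
      assume "\<not> i < 4 * m" "\<not> i' < 4 * m"
      then have ge: "4 * m \<le> i" "4 * m \<le> i'" by auto
      then have "x (i - 4 * m) = x (i' - 4 * m)" "i - 4 * m < l - 4 * m" "i' - 4 * m < l - 4 * m"
        using ex(2,3)[of i] ex(2,3)[of i'] ii by auto
      then have "i - 4 * m = i' - 4 * m" using x by (auto simp: bij_betw_def inj_on_def)
      then show ?thesis using ge by linarith
    qed (use mixed[of i i'] mixed[of i' i] ii in auto)
  qed
  moreover have "f ` {..<l} \<subseteq> {1..n}"
  proof
    fix y assume "y \<in> f ` {..<l}"
    then obtain i where i: "i < l" "y = f i" by auto
    show "y \<in> {1..n}"
    proof (cases "i < 4 * m")
      case True
      then obtain j where j: "j < m" "?q i j" using cases4 by blast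
      have "N + 2 * m \<le> n" using l N by linarith
      then show ?thesis using j(2) f4[OF j(1)] abS[OF j(1)] i(2) by auto
    next
      case False
      then show ?thesis using Tgt(1,2)[OF ex(1)[OF False i(1)]] i(2) by auto
    qed
  qed
  ultimately have cyc: "polygon f l \<in> cycles l n" using cyclesI[OF l(2)] by blast
  let ?C = "polygon f l"
  have edge: "{f i, f (Suc i)} \<in> ?C" if "Suc i < l" for i
    using that by (intro image_eqI[of _ _ i]) auto
  have "{y \<in> ?C. y \<subseteq> {1..N}} = M"
  proof
    show "{y \<in> ?C. y \<subseteq> {1..N}} \<subseteq> M"
    proof
      fix y assume "y \<in> {y \<in> ?C. y \<subseteq> {1..N}}"
      then obtain i where i: "i < l" "y = {f i, f (Suc i mod l)}" "f i \<le> N" "f (Suc i mod l) \<le> N"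
        by auto
      obtain j where j: "j < m" "i = 4 * j + 1 \<or> i = 4 * j + 2" "i < 4 * m"
        using low[OF i(1)] i(3) by blast
      \<comment> \<open>Each block ends with a copy, so a position carrying a node up to
        \<open>N\<close> is not the last one and the index does not wrap around.\<close>
      have "Suc i < 4 * m" using j by linarith
      then have suc: "Suc i mod l = Suc i" using l(1) by simp
      show "y \<in> M"
      proof (cases "i = 4 * j + 1")
        case True
        then have "y = {a j, b j}" using i(2) suc f4[OF j(1)] by (simp add: numeral_eq_Suc)
        then show ?thesis using eM[OF j(1)] ab(1)[OF j(1)] by simp
      next
        case False
        then have "f (Suc i) = N + b j" using j f4(4)[OF j(1)] by (simp add: numeral_eq_Suc)
        then show ?thesis using i(4) abS(2)[OF j(1)] unfolding suc by simp
      qed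
    qed
    show "M \<subseteq> {y \<in> ?C. y \<subseteq> {1..N}}"
    proof
      fix y assume y: "y \<in> M"
      then obtain j where j: "j < m" "y = e j" using e by (auto simp: bij_betw_def)
      have "Suc (4 * j + 1) < l" using j l by linarith
      then have "{f (4 * j + 1), f (Suc (4 * j + 1))} \<in> ?C" by (rule edge)
      then have "y \<in> ?C" using f4[OF j(1)] ab(1)[OF j(1)] j(2) by (simp add: numeral_eq_Suc)
      moreover have "y \<subseteq> {1..N}" using pm_edge(1)[OF M y] N(1) by auto
      ultimately show "y \<in> {y \<in> ?C. y \<subseteq> {1..N}}" by blast
    qed
  qed
  moreover have "{v, N + v} \<in> ?C" if "v \<in> \<Union>M" for v
  proof -
    obtain y where "y \<in> M" "v \<in> y" using \<open>v \<in> \<Union>M\<close> by blast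
    then obtain j where j: "j < m" "v \<in> e j" using e by (auto simp: bij_betw_def)
    have lt: "Suc (4 * j) < l" "Suc (4 * j + 2) < l" using j l by linarith+
    have "v = a j \<or> v = b j" using j ab(1) by auto
    moreover have "{f (4 * j), f (4 * j + 1)} \<in> ?C" "{f (4 * j + 2), f (4 * j + 3)} \<in> ?C"
      using edge[OF lt(1)] edge[OF lt(2)] by (simp_all add: numeral_eq_Suc)
    ultimately show ?thesis using f4[OF j(1)] by (auto simp: insert_commute)
  qed
  ultimately have "?C \<in> fibre l n N M" unfolding fibre_def using cyc by blast
  then show ?thesis by blast
qed

subsection \<open>The lower bound\<close>

text \<open>\<open>M\<close> may be any set of edges: on an empty fibre division by 0 gives 0, so
  the averages are equivariant without a hypothesis on \<open>M\<close>.\<close>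

definition fibre_average :: "nat \<Rightarrow> nat \<Rightarrow> nat \<Rightarrow> (nat set set \<Rightarrow> real) \<Rightarrow> nat set set \<Rightarrow> real"
  where "fibre_average l n N \<phi> M = (\<Sum>C\<in>fibre l n N M. \<phi> C) / real (card (fibre l n N M))"

lemma fibre_average_image:
  assumes "\<pi> permutes {1..N}" "2 * N \<le> n"
  shows "fibre_average l n N \<phi> ((`) \<pi> ` M) = fibre_average l n N (\<lambda>C. \<phi> ((`) (doubled N \<pi>) ` C)) M"
  using sum.reindex_bij_betw[OF fibre_image_bij[OF assms], of \<phi>]
    bij_betw_same_card[OF fibre_image_bij[OF assms]] by (simp add: fibre_average_def)

lemma fibre_average_cong:
  "(\<And>C. C \<in> cycles l n \<Longrightarrow> \<phi> C = \<phi>' C) \<Longrightarrow> fibre_average l n N \<phi> M = fibre_average l n N \<phi>' M"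
  unfolding fibre_average_def by (intro arg_cong2[of _ _ _ _ "(/)"] sum.cong) (auto simp: fibre_def)

text \<open>Invariance under all 3-cycles, hence all even permutations, of the first
  \<open>N\<close> nodes outside \<open>W\<close>. By \<open>local_if_cyc3_invariant\<close> the
  average is then determined, on perfect matchings, by the edges touching \<open>W\<close>.\<close>

definition node_local :: "nat \<Rightarrow> nat \<Rightarrow> nat \<Rightarrow> nat \<Rightarrow> (nat set set \<Rightarrow> real) \<Rightarrow> bool"
  where "node_local l n N h \<phi> \<longleftrightarrow> (\<exists>W. finite W \<and> card W \<le> h \<and>
    (\<forall>a\<in>{1..N} - W. \<forall>b\<in>{1..N} - W. \<forall>c\<in>{1..N} - W. distinct [a, b, c] \<longrightarrow>
      (\<forall>M\<subseteq>Pow {1..N}. fibre_average l n N \<phi> ((`) (cyc3 a b c) ` M) = fibre_average l n N \<phi> M)))"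

lemma sum_fun_apply: "(\<Sum>z\<in>Z. f z) x = (\<Sum>z\<in>Z. f z x)" for f :: "'a \<Rightarrow> 'b \<Rightarrow> real"
  by (induction Z rule: infinite_finite_induct) auto

lemma cycle_polytope_weights:
  assumes "y \<in> cycle_polytope l n"
  shows "\<exists>u. (\<forall>C\<in>cycles l n. 0 \<le> u C) \<and> (\<Sum>C\<in>cycles l n. u C) = 1 \<and>
    (\<forall>e. y e = (\<Sum>C\<in>cycles l n. u C * indicat_real C e))"
proof -
  let ?X = "cycles l n"
  have inj: "inj_on indicat_real ?X"
  proof (rule inj_onI)
    fix C D :: "nat set set" assume eq: "indicat_real C = indicat_real D"
    have "e \<in> C \<longleftrightarrow> e \<in> D" for e
      using fun_cong[OF eq, of e] by (cases "e \<in> C"; cases "e \<in> D") simp_all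
    then show "C = D" by blast
  qed
  obtain u where u: "\<forall>z\<in>indicat_real ` ?X. 0 \<le> u z" "sum u (indicat_real ` ?X) = 1"
      "(\<Sum>z\<in>indicat_real ` ?X. u z *\<^sub>R z) = y"
    using assms finite_cycles unfolding cycle_polytope_def
    by (auto simp: convex_hull_finite[OF finite_imageI[OF finite_cycles]])
  have "(\<Sum>C\<in>?X. u (indicat_real C)) = 1" using u(2) by (simp add: sum.reindex[OF inj])
  moreover have "y e = (\<Sum>C\<in>?X. u (indicat_real C) * indicat_real C e)" for e
    unfolding u(3)[symmetric] sum_fun_apply by (simp add: sum.reindex[OF inj] scaleR_fun_def)
  ultimately show ?thesis using u(1) by (intro exI[of _ "\<lambda>C. u (indicat_real C)"]) auto
qed

text \<open>A sum of nonnegative terms vanishes only termwise. Applied to convex weights, this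
  places the cycles that represent a point of a face into that face.\<close>

lemma weights_tight:
  fixes u g :: "'c \<Rightarrow> real"
  assumes "finite X" "\<And>C. C \<in> X \<Longrightarrow> 0 \<le> u C" "\<And>C. C \<in> X \<Longrightarrow> 0 \<le> g C" "(\<Sum>C\<in>X. u C * g C) = 0"
    "C \<in> X" "u C \<noteq> 0"
  shows "g C = 0" using sum_nonneg_eq_0_iff[of X "\<lambda>C. u C * g C"] assms by auto

locale cycle_slack_family =
  slack_family "node_symmetries n" indicat_real "cycles l n" "cycle_polytope l n" \<Phi>
  for n l :: nat and \<Phi> :: "(nat set set \<Rightarrow> real) set"
begin

lemma permutes_equivariant:
  assumes "\<pi> permutes {1..n}" "\<phi> \<in> \<Phi>"
  shows "\<exists>\<phi>'\<in>\<Phi>. \<forall>C\<in>cycles l n. \<phi> ((`) \<pi> ` C) = \<phi>' C"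
proof (rule equivariant[OF _ _ assms(2)])
  show "node_action \<pi> \<in> node_symmetries n" using assms(1) by (auto simp: node_symmetries_def)
  show "\<forall>C\<in>cycles l n. (`) \<pi> ` C \<in> cycles l n \<and> node_action \<pi> (indicat_real C) = indicat_real ((`) \<pi> ` C)"
    using cycles_image[OF assms(1)] node_action_indicator[OF permutes_bij[OF assms(1)]] by blast
qed

text \<open>\<open>U\<close> is the stabiliser of the averaged function, and the labels are its
  translates. By equivariance each translate is the average of a member of \<open>\<Phi>\<close>, so
  at most \<open>f\<close> labels occur.\<close>

lemma fibre_average_local:
  assumes \<Phi>: "card \<Phi> \<le> f" "\<phi> \<in> \<Phi>"
    and N: "2 * N \<le> n"
    and t: "f < fact t" "0 < t" and B: "0 < B" "3 * B \<le> N" "f * 2 ^ (3 * t) < N choose B"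
    and h: "\<And>y. h < y \<Longrightarrow> 2 * y \<le> N \<Longrightarrow> f < N choose y"
  shows "node_local l n N h \<phi>"
proof -
  let ?V = "{1..N}"
  let ?act = "\<lambda>\<pi> M. (`) \<pi> ` M"
  let ?avg = "fibre_average l n N"
  have act_comp: "?act (\<sigma> \<circ> \<tau>) M = ?act \<sigma> (?act \<tau> M)" for \<sigma> \<tau> :: "nat \<Rightarrow> nat" and M
    by (auto simp: image_comp comp_def)
  have act_id: "?act id M = M" for M :: "nat set set" by simp
  have act_V: "?act \<pi> M \<subseteq> Pow ?V" if \<pi>: "\<pi> permutes ?V" and M: "M \<subseteq> Pow ?V" for \<pi> M
  proof
    fix x assume "x \<in> ?act \<pi> M"
    then obtain e where "e \<subseteq> ?V" "x = \<pi> ` e" using M by blast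
    then show "x \<in> Pow ?V" using permutes_image[OF \<pi>] by blast
  qed
  define U where "U = {\<pi>. \<pi> permutes ?V \<and> (\<forall>M\<subseteq>Pow ?V. ?avg \<phi> (?act \<pi> M) = ?avg \<phi> M)}"
  \<comment> \<open>The inverse makes equal labels of \<open>\<sigma>\<close> and
    \<open>\<tau>\<close> yield \<open>inv \<sigma> \<circ> \<tau> \<in> U\<close>; the default 0
    limits the comparison to the edge sets over which \<open>U\<close> is defined.\<close>
  define label where "label \<sigma> = (\<lambda>M. if M \<subseteq> Pow ?V then ?avg \<phi> (?act (inv \<sigma>) M) else 0)" for \<sigma>
  interpret small_index_subgroup ?V U label f
  proof
    fix u v assume uv: "u \<in> U" "v \<in> U"
    then show "u permutes ?V" by (simp add: U_def)
    have "?avg \<phi> (?act (u \<circ> v) M) = ?avg \<phi> M" if "M \<subseteq> Pow ?V" for M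
      using uv act_V[of v M] that unfolding act_comp by (simp add: U_def)
    then show "u \<circ> v \<in> U" using uv by (simp add: U_def permutes_compose)
  next
    fix u assume u: "u \<in> U"
    then have p: "u permutes ?V" by (simp add: U_def)
    have "?avg \<phi> (?act (inv u) M) = ?avg \<phi> M" if "M \<subseteq> Pow ?V" for M
    proof -
      have "?avg \<phi> (?act u (?act (inv u) M)) = ?avg \<phi> (?act (inv u) M)"
        using u act_V[OF permutes_inv[OF p] that] by (simp only: U_def mem_Collect_eq)
      then show ?thesis unfolding act_comp[symmetric] permutes_inv_o(1)[OF p] act_id by simp
    qed
    then show "inv u \<in> U" using permutes_inv[OF p] by (simp add: U_def)
  next
    fix \<sigma> \<tau> assume st: "\<sigma> permutes ?V" "\<tau> permutes ?V" "label \<sigma> = label \<tau>"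
    have "?avg \<phi> (?act (inv \<sigma> \<circ> \<tau>) M) = ?avg \<phi> M" if "M \<subseteq> Pow ?V" for M
    proof -
      have "?avg \<phi> (?act (inv \<sigma>) (?act \<tau> M)) = ?avg \<phi> (?act (inv \<tau>) (?act \<tau> M))"
        using fun_cong[OF st(3), of "?act \<tau> M"] act_V[OF st(2) that] by (simp only: label_def if_True)
      then show ?thesis unfolding act_comp[symmetric] permutes_inv_o(2)[OF st(2)] act_id .
    qed
    then show "inv \<sigma> \<circ> \<tau> \<in> U" using st(1,2) by (simp add: U_def permutes_compose permutes_inv)
  next
    let ?lab = "\<lambda>\<phi>' M. if M \<subseteq> Pow ?V then ?avg \<phi>' M else 0"
    have "label ` {\<sigma>. \<sigma> permutes ?V} \<subseteq> ?lab ` \<Phi>"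
    proof safe
      fix \<sigma> :: "nat \<Rightarrow> nat" assume \<sigma>: "\<sigma> permutes ?V"
      have i: "inv \<sigma> permutes ?V" using \<sigma> by (rule permutes_inv)
      obtain \<phi>' where \<phi>': "\<phi>' \<in> \<Phi>" "\<forall>C\<in>cycles l n. \<phi> ((`) (doubled N (inv \<sigma>)) ` C) = \<phi>' C"
        using permutes_equivariant[OF doubled_permutes[OF i N] \<Phi>(2)] by blast
      have "?avg \<phi> (?act (inv \<sigma>) M) = ?avg \<phi>' M" for M
        unfolding fibre_average_image[OF i N] using \<phi>'(2) by (intro fibre_average_cong) blast
      then have "label \<sigma> = ?lab \<phi>'" by (simp only: label_def)
      then show "label \<sigma> \<in> ?lab ` \<Phi>" using \<phi>'(1) by blast
    qed
    then have "card (label ` {\<sigma>. \<sigma> permutes ?V}) \<le> card (?lab ` \<Phi>)"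
      using finite_family by (intro card_mono) auto
    also have "\<dots> \<le> f" using card_image_le[OF finite_family] \<Phi>(1) le_trans by blast
    finally show "card (label ` {\<sigma>. \<sigma> permutes ?V}) \<le> f" .
  qed simp
  obtain K where K: "K \<subseteq> ?V" "card (?V - K) \<le> h"
      "\<forall>a\<in>K. \<forall>b\<in>K. \<forall>c\<in>K. distinct [a, b, c] \<longrightarrow> cyc3 a b c \<in> U"
    using exists_large_link_class[of t B h] t B h by auto
  have "?V - (?V - K) = K" using K(1) by blast
  then show ?thesis
    using K(2,3) unfolding node_local_def by (intro exI[of _ "?V - K"]) (simp add: U_def)
qed

lemma no_local_family:
  assumes l: "4 * (2 * h + 1) \<le> l" "3 \<le> l" "0 < h"
    and N: "2 * (2 * h + 1) \<le> N" "N + l \<le> n + 2 * (2 * h + 1)"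
    and local: "\<And>\<phi>. \<phi> \<in> \<Phi> \<Longrightarrow> node_local l n N h \<phi>"
  shows False
proof -
  define m where "m = 2 * h + 1"
  let ?A = "{1..m}" and ?B = "{m + 1..2 * m}" and ?S = "{1..2 * m}"
  let ?P = "perfect_matchings ?S" and ?X = "cycles l n" and ?F = "fibre l n N"
  have AB: "?A \<union> ?B = ?S" by auto
  have SN: "?S \<subseteq> {1..N}" using N by (auto simp: m_def)
  have "\<exists>\<alpha> :: nat set set \<Rightarrow> real.
    (\<Sum>M\<in>perfect_matchings (?A \<union> ?B). \<alpha> M) = 1 \<and>
    (\<Sum>M\<in>perfect_matchings (?A \<union> ?B). \<alpha> M * real (crossing ?A M)) = 0 \<and>
    (\<forall>M0\<in>perfect_matchings (?A \<union> ?B). \<forall>T\<subseteq>M0. card T \<le> h \<longrightarrow>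
      0 \<le> (\<Sum>M | M \<in> perfect_matchings (?A \<union> ?B) \<and> T \<subseteq> M. \<alpha> M))"
    by (rule exists_pseudo_distribution) (use l in \<open>auto simp: m_def\<close>)
  then obtain \<alpha> :: "nat set set \<Rightarrow> real" where \<alpha>: "(\<Sum>M\<in>?P. \<alpha> M) = 1"
      "(\<Sum>M\<in>?P. \<alpha> M * real (crossing ?A M)) = 0"
      "\<And>M0 T. M0 \<in> ?P \<Longrightarrow> T \<subseteq> M0 \<Longrightarrow> card T \<le> h \<Longrightarrow> 0 \<le> (\<Sum>M | M \<in> ?P \<and> T \<subseteq> M. \<alpha> M)" unfolding AB by blast
  have fP: "finite ?P" by (rule finite_pm) simp
  have F_ne: "?F M \<noteq> {}" if "M \<in> ?P" for M using fibre_nonempty[OF that] l N by (simp add: m_def)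
  have F_card: "real (card (?F M)) \<noteq> 0" if "M \<in> ?P" for M
    using F_ne[OF that] finite_fibre[of l n N M] by simp
  \<comment> \<open>The weight \<open>\<alpha> M\<close> is spread uniformly over the fibre of
    \<open>M\<close>, so that sums over cycles become \<open>\<alpha>\<close>-sums of fibre
    averages.\<close>
  define c where "c C = (\<Sum>M\<in>?P. if C \<in> ?F M then \<alpha> M / real (card (?F M)) else 0)" for C
  have c_sum: "(\<Sum>C\<in>?X. c C * g C) = (\<Sum>M\<in>?P. \<alpha> M * fibre_average l n N g M)" for g
  proof -
    have "(\<Sum>C\<in>?X. c C * g C) = (\<Sum>M\<in>?P. \<Sum>C\<in>?X. (if C \<in> ?F M then \<alpha> M / real (card (?F M)) else 0) * g C)"
      unfolding c_def sum_distrib_right by (rule sum.swap)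
    also have "\<dots> = (\<Sum>M\<in>?P. \<alpha> M * fibre_average l n N g M)"
    proof (rule sum.cong)
      fix M
      have "?X \<inter> {C. C \<in> ?F M} = ?F M" by (auto simp: fibre_def)
      then have "(\<Sum>C\<in>?X. (if C \<in> ?F M then \<alpha> M / real (card (?F M)) else 0) * g C) =
          (\<Sum>C\<in>?F M. \<alpha> M / real (card (?F M)) * g C)"
        using sum.inter_restrict[OF finite_cycles, of "\<lambda>C. \<alpha> M / real (card (?F M)) * g C" l n "?F M"]
        by (simp add: if_distrib[of "\<lambda>x. x * _"] cong: if_cong)
      then show "(\<Sum>C\<in>?X. (if C \<in> ?F M then \<alpha> M / real (card (?F M)) else 0) * g C) =
          \<alpha> M * fibre_average l n N g M"
        by (simp add: fibre_average_def sum_distrib_left sum_divide_distrib)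
    qed simp
    finally show ?thesis .
  qed
  have avg_const: "fibre_average l n N g M = k" if "M \<in> ?P" "\<And>C. C \<in> ?F M \<Longrightarrow> g C = k" for g M k
    using that F_card[OF that(1)] by (simp add: fibre_average_def)
  have "(\<Sum>C\<in>?X. c C) = (\<Sum>C\<in>?X. c C * 1)" by simp
  also have "\<dots> = (\<Sum>M\<in>?P. \<alpha> M * fibre_average l n N (\<lambda>_. 1) M)" by (rule c_sum)
  also have "\<dots> = (\<Sum>M\<in>?P. \<alpha> M)" using avg_const[of _ "\<lambda>_. 1" 1] by (intro sum.cong) auto
  finally have c1: "(\<Sum>C\<in>?X. c C) = 1" using \<alpha>(1) by simp
  have c_nonneg: "0 \<le> (\<Sum>C\<in>?X. c C * \<phi> C)" if \<phi>: "\<phi> \<in> \<Phi>" for \<phi>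
  proof -
    obtain W where W: "finite W" "card W \<le> h"
        "\<forall>a\<in>{1..N} - W. \<forall>b\<in>{1..N} - W. \<forall>c\<in>{1..N} - W. distinct [a, b, c] \<longrightarrow>
        (\<forall>M\<subseteq>Pow {1..N}. fibre_average l n N \<phi> ((`) (cyc3 a b c) ` M) = fibre_average l n N \<phi> M)"
      using local[OF \<phi>] unfolding node_local_def by blast
    have PN: "M \<subseteq> Pow {1..N}" if "M \<in> ?P" for M using pm_edge(1)[OF that] SN by blast
    have inv: "fibre_average l n N \<phi> ((`) (cyc3 a b d) ` M) = fibre_average l n N \<phi> M"
      if "a \<in> ?S - W" "b \<in> ?S - W" "d \<in> ?S - W" "distinct [a, b, d]" "M \<in> ?P" for a b d M
    proof -
      have "a \<in> {1..N} - W" "b \<in> {1..N} - W" "d \<in> {1..N} - W" using that SN by blast+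
      then show ?thesis using W(3) that(4) PN[OF that(5)] by blast
    qed
    have "0 \<le> (\<Sum>M\<in>?P. \<alpha> M * fibre_average l n N \<phi> M)"
    proof (rule pseudo_distribution_nonneg[OF _ W(1,2) \<alpha>(3)])
      show "0 \<le> fibre_average l n N \<phi> M" for M
        unfolding fibre_average_def using nonneg[OF \<phi>]
        by (intro divide_nonneg_nonneg sum_nonneg) (auto simp: fibre_def)
      show "fibre_average l n N \<phi> M = fibre_average l n N \<phi> M'"
        if "M \<in> ?P" "M' \<in> ?P" "touching W M = touching W M'" for M M'
        by (rule local_if_cyc3_invariant[OF _ inv that(2) that(1) that(3)]) auto
    qed auto
    then show ?thesis unfolding c_sum .
  qed
  \<comment> \<open>An affine combination with signed weights \<open>c\<close>. Membership in the
    polytope provides genuinely convex weights \<open>u\<close> for the same point, and the two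
    descriptions are played off against each other.\<close>
  define y where "y e = (\<Sum>C\<in>?X. c C * indicat_real C e)" for e
  have "y \<in> cycle_polytope l n" unfolding y_def using c_nonneg by (intro membership[OF c1] ballI)
  then obtain u where u: "\<And>C. C \<in> ?X \<Longrightarrow> 0 \<le> u C" "(\<Sum>C\<in>?X. u C) = 1"
      "\<And>e. y e = (\<Sum>C\<in>?X. u C * indicat_real C e)" using cycle_polytope_weights by blast
  have y_const: "y e = k" if "\<And>M C. M \<in> ?P \<Longrightarrow> C \<in> ?F M \<Longrightarrow> indicat_real C e = k" for e k
  proof -
    have "y e = (\<Sum>M\<in>?P. \<alpha> M * k)"
      unfolding y_def c_sum using avg_const that by (intro sum.cong) auto
    then show ?thesis using \<alpha>(1) by (simp add: sum_distrib_right[symmetric])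
  qed
  have rung: "{v, N + v} \<in> C" if "M \<in> ?P" "C \<in> ?F M" "v \<in> ?S" for M C v
    using that pm_Union[OF that(1)] by (simp add: fibre_def)
  have rung_y: "y {v, N + v} = 1" if "v \<in> ?S" for v using rung that by (intro y_const) simp
  \<comment> \<open>Both cycle edges at \<open>v\<close> are already taken, by the rung and by the
    matching edge.\<close>
  have bad: "{v, w} \<notin> C" if M: "M \<in> ?P" "C \<in> ?F M" and vw: "v \<in> ?S" "w \<notin> ?S" "w \<noteq> N + v" for M C v w
  proof
    assume e: "{v, w} \<in> C"
    obtain e0 where e0: "e0 \<in> M" "v \<in> e0" using pm_cover[OF M(1) vw(1)] by blast
    have e0S: "e0 \<subseteq> ?S" using pm_edge(1)[OF M(1) e0(1)] .
    have C: "C \<in> ?X" and e0C: "e0 \<in> C" using M(2) e0(1) by (auto simp: fibre_def)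
    have "N + v \<notin> ?S" using SN vw(1) N(1) by (auto simp: m_def)
    then have "e0 \<noteq> {v, N + v}" "e0 \<noteq> {v, w}" "{v, w} \<noteq> {v, N + v}"
      using e0S vw by (auto simp: doubleton_eq_iff)
    then have "card {{v, N + v}, e0, {v, w}} = 3" by auto
    moreover have "{{v, N + v}, e0, {v, w}} \<subseteq> {e \<in> C. v \<in> e}"
      using e e0 e0C rung[OF M vw(1)] by auto
    moreover have "finite {e \<in> C. v \<in> e}"
    proof -
      have "card {e \<in> C. v \<in> e} = 2" using cycle_degree[OF C] e by blast
      then show ?thesis by (intro card_ge_0_finite) simp
    qed
    ultimately have "3 \<le> card {e \<in> C. v \<in> e}" by (metis card_mono)
    moreover have "card {e \<in> C. v \<in> e} = 2" using cycle_degree[OF C] e by blast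
    ultimately show False by simp
  qed
  have bad_y: "y {v, w} = 0" if "v \<in> ?S" "w \<notin> ?S" "w \<noteq> N + v" for v w
    using bad that by (intro y_const) simp
  have support_rung: "{v, N + v} \<in> C" if C: "C \<in> ?X" "u C \<noteq> 0" and v: "v \<in> ?S" for C v
  proof -
    have "(\<Sum>C\<in>?X. u C * (1 - indicat_real C {v, N + v})) = 0"
      using u(2,3) rung_y[OF v] by (simp add: right_diff_distrib sum_subtractf)
    then have "1 - indicat_real C {v, N + v} = 0"
      using C u(1) by (intro weights_tight[of ?X u "\<lambda>C. 1 - indicat_real C {v, N + v}"])
        (auto simp: finite_cycles indicator_le_1)
    then show ?thesis by (simp add: indicator_def split: if_splits)
  qed
  have support_bad: "{v, w} \<notin> C" if C: "C \<in> ?X" "u C \<noteq> 0" and v: "v \<in> ?S" "w \<notin> ?S" "w \<noteq> N + v" for C v w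
  proof -
    have "(\<Sum>C\<in>?X. u C * indicat_real C {v, w}) = 0" using u(3) bad_y[OF v] by simp
    then have "indicat_real C {v, w} = 0"
      using C u(1) by (intro weights_tight[of ?X u "\<lambda>C. indicat_real C {v, w}"]) (auto simp: finite_cycles)
    then show ?thesis by (simp add: indicator_def split: if_splits)
  qed
  \<comment> \<open>\<open>D\<close> is not restricted to two-element sets; its other members lie in
    no cycle, so \<open>C \<inter> D\<close> consists of the edges of \<open>C\<close> between
    \<open>?A\<close> and \<open>?B\<close>.\<close>
  define D where "D = {e. e \<subseteq> ?S \<and> card (e \<inter> ?A) = 1}"
  have fD: "finite D" by (rule finite_subset[of _ "Pow ?S"]) (auto simp: D_def)
  have D_count: "(\<Sum>e\<in>D. \<Sum>C\<in>?X. g C * indicat_real C e) = (\<Sum>C\<in>?X. g C * real (card (C \<inter> D)))" for g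
  proof -
    have "(\<Sum>e\<in>D. indicat_real C e) = real (card (C \<inter> D))" for C
      using fD by (simp add: indicator_def of_bool_def sum.If_cases Int_commute)
    then show ?thesis by (subst sum.swap) (simp add: sum_distrib_left[symmetric])
  qed
  have "(\<Sum>e\<in>D. y e) = (\<Sum>M\<in>?P. \<alpha> M * fibre_average l n N (\<lambda>C. real (card (C \<inter> D))) M)"
    unfolding y_def D_count by (rule c_sum)
  also have "\<dots> = (\<Sum>M\<in>?P. \<alpha> M * real (crossing ?A M))"
  proof (intro sum.cong refl arg_cong2[of _ _ _ _ "(*)"] avg_const)
    fix M C assume M: "M \<in> ?P" "C \<in> ?F M"
    have "C \<inter> D = kind ?A 1 M"
    proof
      show "C \<inter> D \<subseteq> kind ?A 1 M" using M(2) SN by (auto simp: D_def kind_def fibre_def)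
      show "kind ?A 1 M \<subseteq> C \<inter> D"
        using M(2) pm_edge(1)[OF M(1)] by (auto simp: D_def kind_def fibre_def)
    qed
    then show "real (card (C \<inter> D)) = real (crossing ?A M)" by simp
  qed
  finally have "(\<Sum>C\<in>?X. u C * real (card (C \<inter> D))) = 0" using \<alpha>(2) D_count[of u] u(3) by simp
  \<comment> \<open>A cycle of positive weight lies in the face. At each node of \<open>?S\<close>
    its second edge stays inside \<open>?S\<close>, so it restricts to a perfect matching there, and
    the odd set \<open>?A\<close> forces a crossing edge.\<close>
  moreover have "(\<Sum>C\<in>?X. u C * 1) \<le> (\<Sum>C\<in>?X. u C * real (card (C \<inter> D)))"
  proof (rule sum_mono)
    fix C assume C: "C \<in> ?X"
    show "u C * 1 \<le> u C * real (card (C \<inter> D))"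
    proof (cases "u C = 0")
      case False
      define M where "M = {e \<in> C. e \<subseteq> ?S}"
      have "M \<in> ?P" unfolding perfect_matchings_def
      proof (intro CollectI conjI ballI)
        fix e assume "e \<in> M"
        then show "e \<subseteq> ?S" "card e = 2" using card_cycle_edge[OF C] by (auto simp: M_def)
      next
        fix v assume v: "v \<in> ?S"
        have r: "{v, N + v} \<in> C" using support_rung[OF C False v] .
        have "card {e \<in> C. v \<in> e} = 2" using cycle_degree[OF C] r by blast
        then obtain p q where pq: "{e \<in> C. v \<in> e} = {p, q}" "p \<noteq> q" by (meson card_2_iff)
        moreover have "{v, N + v} \<in> {e \<in> C. v \<in> e}" using r by simp
        ultimately obtain e2 where e2: "{e \<in> C. v \<in> e} = {{v, N + v}, e2}" "e2 \<noteq> {v, N + v}"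
          by (metis insert_commute insertE singletonD)
        have e2C: "e2 \<in> C" "v \<in> e2" using e2(1) by blast+
        obtain x z where "e2 = {x, z}" "x \<noteq> z"
          using card_cycle_edge[OF C e2C(1)] by (meson card_2_iff)
        then obtain w where w: "e2 = {v, w}" "v \<noteq> w" using e2C(2) by (cases "x = v") auto
        have "w \<in> ?S" using support_bad[OF C False v, of w] w e2 e2C by blast
        have notS: "N + v \<notin> ?S" using v N(1) by (auto simp: m_def)
        show "\<exists>!e. e \<in> M \<and> v \<in> e"
        proof (rule ex1I[of _ e2])
          show "e2 \<in> M \<and> v \<in> e2" using e2C w(1) v \<open>w \<in> ?S\<close> by (simp add: M_def)
          fix e assume e: "e \<in> M \<and> v \<in> e"
          then have "e \<in> {{v, N + v}, e2}" unfolding e2(1)[symmetric] by (simp add: M_def)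
          moreover have "e \<noteq> {v, N + v}" using e notS by (auto simp: M_def)
          ultimately show "e = e2" by blast
        qed
      qed
      then have "2 * card (kind ?A 2 M) + crossing ?A M = 2 * h + 1"
        using pm_card_inter[of ?S M ?A] by (simp add: m_def)
      moreover have "kind ?A 1 M = C \<inter> D" by (auto simp: kind_def M_def D_def)
      moreover have "1 \<le> j" if "2 * i + j = 2 * h + 1" for i j :: nat using that by presburger
      ultimately have "1 \<le> card (C \<inter> D)" by metis
      then show ?thesis using u(1)[OF C] by (intro mult_left_mono) simp_all
    qed simp
  qed
  ultimately show False using u(2) by simp
qed

end

lemma exists_cycle_slack_family:
  assumes ext: "is_extension d Q p (complete_edges n) (cycle_polytope l n)"
    and sym: "symmetric_extension (node_symmetries n) d Q p"
  shows "\<exists>\<Phi>. card \<Phi> \<le> extension_size Q \<and> cycle_slack_family n l \<Phi>"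
  unfolding cycle_slack_family_def
proof (rule symmetric_extension_slack_family[OF ext sym finite_cycles])
  show "indicat_real ` cycles l n \<subseteq> cycle_polytope l n"
    unfolding cycle_polytope_def by (rule hull_subset)
  show "\<forall>g\<in>node_symmetries n. inj g"
    by (auto simp: node_symmetries_def intro: inj_node_action permutes_bij)
qed

section \<open>Numerical estimates\<close>

lemma eventually_two_power_le_fact: "\<exists>n0. \<forall>n\<ge>n0. (2::nat) ^ n < fact (n div 50)"
proof -
  \<comment> \<open>Terms of the exponential series at \<open>2 ^ 50\<close>. The bound
    \<open>1 / 2 ^ 50\<close> below, instead of 1, pays for the remainder of \<open>n\<close> modulo
    50.\<close>
  have "(\<lambda>j. inverse (fact j) * (2 ^ 50) ^ j :: real) \<longlonglongrightarrow> 0"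
    using summable_LIMSEQ_zero[OF summable_exp] .
  then have "eventually (\<lambda>j. inverse (fact j) * (2 ^ 50) ^ j < (1 / 2 ^ 50 :: real)) sequentially"
    by (rule order_tendstoD) simp
  then obtain j0 where j0: "\<And>j. j0 \<le> j \<Longrightarrow> inverse (fact j) * (2 ^ 50) ^ j < (1 / 2 ^ 50 :: real)"
    by (auto simp: eventually_sequentially)
  have "(2::nat) ^ n < fact (n div 50)" if "50 * j0 \<le> n" for n
  proof -
    let ?j = "n div 50"
    have "j0 \<le> ?j" using that by linarith
    then have "(2 ^ 50) ^ ?j * 2 ^ 50 < (fact ?j :: real)"
      using j0[of ?j] by (simp add: field_simps)
    moreover have "(2::real) ^ n \<le> 2 ^ (50 * ?j + 50)" by (intro power_increasing) linarith+
    moreover have "(2::real) ^ (50 * ?j + 50) = (2 ^ 50) ^ ?j * 2 ^ 50"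
      by (simp add: power_add power_mult)
    ultimately have "(2::real) ^ n < fact ?j" by linarith
    then have "real (2 ^ n) < real (fact ?j)" by simp
    then show ?thesis by (simp only: of_nat_less_iff)
  qed
  then show ?thesis by blast
qed

lemma two_power_le_binomial:
  assumes "2 * b \<le> a"
  shows "2 ^ b \<le> (a choose b :: nat)"
proof (cases "b = 0")
  case False
  have "(2::real) ^ b \<le> (real a / real b) ^ b"
    using assms False by (intro power_mono) (auto simp: field_simps)
  also have "\<dots> \<le> real (a choose b)" using assms by (intro binomial_ge_n_over_k_pow_k) simp
  finally show ?thesis by (metis of_nat_le_iff of_nat_numeral of_nat_power)
qed simp

text \<open>The left side is one summand of Vandermonde's identity.\<close>

lemma binomial_mult_le: "(a choose i) * (b choose j) \<le> (a + b choose (i + j) :: nat)"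
proof -
  have "(a choose i) * (b choose (i + j - i)) \<le> (\<Sum>k\<le>i + j. (a choose k) * (b choose (i + j - k)))"
    by (rule member_le_sum) auto
  then show ?thesis using vandermonde[of a b "i + j"] by simp
qed

theorem theorem26:
  shows "\<exists>C'::real. C' > 0 \<and>
    (\<forall>(n::nat) (l::nat). 42 \<le> l \<and> l \<le> n \<longrightarrow>
      (\<forall>(d::nat) (Q :: (nat \<Rightarrow> real) set) (p :: (nat \<Rightarrow> real) \<Rightarrow> nat set \<Rightarrow> real).
        is_extension d Q p (complete_edges n) (cycle_polytope l n) \<and>
        symmetric_extension (node_symmetries n) d Q p \<longrightarrow>
        C' * real ((n div 3) choose ((l div 6 - 1) div 2)) \<le> real (extension_size Q)))"
proof -
  obtain n1 where n1: "\<And>n. n1 \<le> n \<Longrightarrow> (2::nat) ^ n < fact (n div 50)"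
    using eventually_two_power_le_fact by blast
  \<comment> \<open>Below \<open>n0\<close> the binomial is at most \<open>2 ^ n0\<close>, so the
    constant reduces the claim to \<open>1 \<le> extension_size Q\<close>; from \<open>n0\<close> on
    the bound is proved with constant 1.\<close>
  define n0 where "n0 = max n1 1000"
  show ?thesis
  proof (intro exI[of _ "1 / 2 ^ n0"] conjI allI impI)
    fix n l d :: nat and Q :: "(nat \<Rightarrow> real) set" and p :: "(nat \<Rightarrow> real) \<Rightarrow> nat set \<Rightarrow> real"
    assume "42 \<le> l \<and> l \<le> n"
      and Qp: "is_extension d Q p (complete_edges n) (cycle_polytope l n) \<and>
        symmetric_extension (node_symmetries n) d Q p"
    then have nl: "42 \<le> l" "l \<le> n" by auto
    define k where "k = (l div 6 - 1) div 2"
    \<comment> \<open>The largest \<open>h\<close> with \<open>4 * (2 * h + 1) \<le> l\<close>, the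
      number of cycle nodes taken by a matching with \<open>2 * h + 1\<close> edges.\<close>
    define h where "h = (l - 4) div 8"
    \<comment> \<open>The first term leaves room for the copies, the second for the nodes that
      complete the cycle in \<open>fibre_nonempty\<close>.\<close>
    define N where "N = min (n div 2) (n - l + 2 * (2 * h + 1))"
    have hb: "8 * h + 4 \<le> l" "l < 8 * h + 12" "4 \<le> h" using nl(1) unfolding h_def by presburger+
    have q: "6 * (l div 6) \<le> l" "7 \<le> l div 6" using nl(1) by linarith+
    have "2 * k \<le> l div 6 - 1" unfolding k_def by (rule times_div_less_eq_dividend)
    then have kb: "12 * k + 6 \<le> l" "k \<le> h" using q hb(2) by linarith+
    have hl: "4 * (2 * h + 1) \<le> l" "3 \<le> l" "0 < h" using hb nl(1) by auto
    have hN: "2 * (2 * h + 1) \<le> N" "N + l \<le> n + 2 * (2 * h + 1)" "2 * N \<le> n"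
    proof -
      have "2 * (2 * h + 1) \<le> n div 2" using nl hb(1) by presburger
      then show "2 * (2 * h + 1) \<le> N" by (simp add: N_def)
      have "N \<le> n - l + 2 * (2 * h + 1)" "N \<le> n div 2" by (simp_all add: N_def)
      then show "N + l \<le> n + 2 * (2 * h + 1)" "2 * N \<le> n" using nl(2) by linarith+
    qed
    obtain \<Phi> where \<Phi>: "card \<Phi> \<le> extension_size Q" "cycle_slack_family n l \<Phi>"
      using exists_cycle_slack_family Qp by blast
    interpret cycle_slack_family n l \<Phi> by (rule \<Phi>(2))
    have nonlocal: "\<exists>\<phi>\<in>\<Phi>. \<not> node_local l n N h \<phi>"
    proof (rule ccontr)
      assume "\<not> ?thesis"
      then have local: "node_local l n N h \<phi>" if "\<phi> \<in> \<Phi>" for \<phi> using that by blast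
      show False by (rule no_local_family) (fact hl hN local)+
    qed
    let ?f = "extension_size Q"
    have f_pos: "1 \<le> ?f"
    proof (rule ccontr)
      assume "\<not> 1 \<le> ?f"
      then have "card \<Phi> = 0" using \<Phi>(1) by linarith
      then have "\<Phi> = {}" using finite_family by simp
      then show False using nonlocal by blast
    qed
    show "1 / 2 ^ n0 * real ((n div 3) choose ((l div 6 - 1) div 2)) \<le> real ?f"
    proof (cases "n0 \<le> n")
      case False
      have "(n div 3) choose k \<le> 2 ^ (n div 3)" by (rule binomial_le_pow2)
      also have "\<dots> \<le> 2 ^ n0" using False by (intro power_increasing) linarith+
      finally have "real ((n div 3) choose k) \<le> real (2 ^ n0)" by (simp only: of_nat_le_iff)
      then have "1 / 2 ^ n0 * real ((n div 3) choose k) \<le> 1" by (simp add: divide_le_eq)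
      also have "1 \<le> real ?f" using f_pos by linarith
      finally show ?thesis unfolding k_def .
    next
      case True
      have "(n div 3) choose k \<le> ?f"
      proof (rule ccontr)
        assume "\<not> (n div 3) choose k \<le> ?f"
        then have small: "?f < (n div 3) choose k" by simp
        have n: "1000 \<le> n" "n1 \<le> n" using True by (auto simp: n0_def)
        \<comment> \<open>Factorials outgrow \<open>2 ^ n\<close>, so even this small
          \<open>t\<close> satisfies \<open>f < fact t\<close>. The divisors 50 and 16 give
          \<open>3 * t \<le> b\<close>, whence \<open>2 ^ b\<close> covers the at most
          \<open>2 ^ (3 * t)\<close> unions of link classes.\<close>
        define t where "t = n div 50"
        define b where "b = n div 16"
        have t: "?f < fact t" "0 < t"
        proof -
          have "(n div 3) choose k \<le> 2 ^ (n div 3)" by (rule binomial_le_pow2)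
          also have "\<dots> \<le> 2 ^ n" by (intro power_increasing) auto
          also have "\<dots> < fact t" using n1[OF n(2)] by (simp add: t_def)
          finally show "?f < fact t" using small by simp
          show "0 < t" using n(1) by (simp add: t_def)
        qed
        \<comment> \<open>By the choice of \<open>h\<close>, \<open>2 * (2 * h + 1)\<close> is more
          than \<open>l / 2 - 4\<close>, so the second term in \<open>N\<close> is at least
          \<open>n / 2 - 4\<close>.\<close>
        have N_ge: "n div 2 \<le> N + 4"
        proof -
          have "n div 2 \<le> n - l + 2 * (2 * h + 1) + 4"
          proof -
            have "2 * (n div 2) \<le> l + (n - l)" using nl(2) by simp
            moreover have "x \<le> e + 2 * (2 * h + 1) + 4" if "2 * x \<le> l + e" for x e :: nat
              using that hb(2) by simp
            ultimately show ?thesis by blast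
          qed
          then show ?thesis by (simp add: N_def)
        qed
        have kn: "12 * k + 6 \<le> n" using nl kb by linarith
        obtain c c' where cc': "c = n div 2" "c' = n div 3" by blast
        have quot: "16 * b \<le> n" "n < 16 * b + 16" "50 * t \<le> n" "3 * c' \<le> n" "n < 2 * c + 2"
          unfolding b_def t_def cc' by simp_all
        have "c \<le> N + 4" using N_ge cc' by simp
        \<comment> \<open>With \<open>k \<le> n / 12\<close> and \<open>b \<le> n / 16\<close>, both
          \<open>3 (k + b) \<le> 7 n / 16\<close> and \<open>n / 3 + 2 b \<le> 11 n / 24\<close>
          stay below \<open>n / 2\<close> by a margin that absorbs all roundings once
          \<open>n \<ge> 1000\<close>.\<close>
        then have B: "0 < k + b" and B3: "3 * (k + b) \<le> N" and "c' \<le> N" "c' + 2 * b \<le> N" and tb: "3 * t \<le> b"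
          using n(1) kn quot unfolding distrib_left by linarith+
        then have n3: "n div 3 \<le> N" and n3b: "2 * b \<le> N - n div 3" using cc' by simp_all
        \<comment> \<open>The \<open>N\<close> nodes are split into \<open>n div 3\<close>, whose
          binomial exceeds \<open>f\<close>, and at least \<open>2 * b\<close> others, which
          contribute the factor \<open>2 ^ b\<close>.\<close>
        have "?f * 2 ^ (3 * t) \<le> ?f * 2 ^ b" using tb by (intro mult_le_mono2 power_increasing) auto
        also have "\<dots> < ((n div 3) choose k) * 2 ^ b" using small by simp
        also have "\<dots> \<le> ((n div 3) choose k) * ((N - n div 3) choose b)"
          using two_power_le_binomial[OF n3b] by simp
        also have "\<dots> \<le> N choose (k + b)"
          using binomial_mult_le[of "n div 3" k "N - n div 3" b] n3 by simp
        finally have fB: "?f * 2 ^ (3 * t) < N choose (k + b)" .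
        have fy: "?f < N choose y" if "h < y" "2 * y \<le> N" for y
        proof -
          have "(n div 3) choose k \<le> N choose k" using n3 by (rule binomial_right_mono)
          also have "\<dots> \<le> N choose y" using that kb(2) by (intro binomial_mono) auto
          finally show ?thesis using small by simp
        qed
        show False
        proof -
          have "node_local l n N h \<phi>" if "\<phi> \<in> \<Phi>" for \<phi>
            by (rule fibre_average_local[where f = ?f and t = t and B = "k + b"])
              (fact that \<Phi> hN t B B3 fB fy)+
          then show ?thesis using nonlocal by blast
        qed
      qed
      then have "real ((n div 3) choose k) \<le> real ?f" by (simp only: of_nat_le_iff)
      moreover have "1 / 2 ^ n0 * real ((n div 3) choose k) \<le> 1 * real ((n div 3) choose k)"
        by (intro mult_right_mono) simp_all
      ultimately show ?thesis by (simp add: k_def)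
    qed
  qed simp
qed

end
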